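(* A third-order ODE $u'''=f(x,u,p,q)$ (with $p=u'$, $q=u''$) is equivalent under a point transformation to the canonical form $$u'''=\frac32\frac{(u'')^2}{u'},$$ which has six point symmetries, if and only if $I_4=0$, $I_5\neq0$, $I_6=0$ and $I_7=0$.
   Context: Everything is local and over the complex numbers. $(x,u,p,q)$, with $p=u'$, $q=u''$, are local coordinates on the second-order jet space. Two third-order ODEs $u'''=f(x,u,u',u'')$ and $\bar u'''=\bar f(\bar x,\bar u,\bar u',\bar u'')$ are equivalent under a point transformation if there is a transformation $\bar x=\varphi(x,u)$, $\bar u=\psi(x,u)$ with $\varphi_x\psi_u-\varphi_u\psi_x\ne0$ mapping one to the other. For an ODE with right-hand side $f(x,u,p,q)$ put $\hat D_x=\partial_x+p\,\partial_u+q\,\partial_p+f\,\partial_q$; letter subscripts denote partial derivatives (e.g. $J_{5_x}=\partial J_5/\partial x$). Define $$I_1=-f_q,\qquad I_2=-\tfrac29 I_1^2-f_p-\tfrac13\hat D_xI_1,\qquad I_3=-\tfrac16 I_{1_q},$$ $$I_4=-\tfrac13I_1I_2-f_u-\tfrac12\hat D_xI_2,\qquad I_6=-I_{3_q},\qquad I_5=-I_3^2-I_{3_p}=-J_5^2,$$ $$I_7=\tfrac13I_1J_5-J_{5_x}-p\,J_{5_u}+2q\,I_3J_5,$$ where $J_5$ is a square root of $-I_5$. *)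

theory Defs
  imports "HOL-Analysis.Analysis" "HOL-Library.Function_Algebras"
begin

text \<open>
  Points \<open>(x, u)\<close> of the plane and points \<open>(x, u, p, q)\<close>, \<open>p = u'\<close>, \<open>q = u''\<close>, of the
  second-order jet space, over the complex numbers. A third-order ODE \<open>u''' = f(x,u,p,q)\<close> is a
  function \<open>f\<close> on jets together with an open set on which it is holomorphic; values of \<open>f\<close> outside
  that set are irrelevant.
\<close>

type_synonym plane = "complex \<times> complex"
type_synonym jet = "complex \<times> complex \<times> complex \<times> complex"

text \<open>Holomorphy in several variables: complex (Frechet) differentiability at every point.\<close>

definition holomorphic_plane :: "(plane \<Rightarrow> complex) \<Rightarrow> plane set \<Rightarrow> bool" where
  "holomorphic_plane F D \<longleftrightarrow> open D \<and>
     (\<forall>w\<in>D. \<exists>a b. (F has_derivative (\<lambda>(h, k). a * h + b * k)) (at w))"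

definition holomorphic_jet :: "(jet \<Rightarrow> complex) \<Rightarrow> jet set \<Rightarrow> bool" where
  "holomorphic_jet F U \<longleftrightarrow> open U \<and>
     (\<forall>z\<in>U. \<exists>a b c d.
        (F has_derivative (\<lambda>(h, k, l, m). a * h + b * k + c * l + d * m)) (at z))"

definition pd_x :: "(jet \<Rightarrow> complex) \<Rightarrow> jet \<Rightarrow> complex" where
  "pd_x F = (\<lambda>(x, u, p, q). deriv (\<lambda>t. F (t, u, p, q)) x)"

definition pd_u :: "(jet \<Rightarrow> complex) \<Rightarrow> jet \<Rightarrow> complex" where
  "pd_u F = (\<lambda>(x, u, p, q). deriv (\<lambda>t. F (x, t, p, q)) u)"

definition pd_p :: "(jet \<Rightarrow> complex) \<Rightarrow> jet \<Rightarrow> complex" where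
  "pd_p F = (\<lambda>(x, u, p, q). deriv (\<lambda>t. F (x, u, t, q)) p)"

definition pd_q :: "(jet \<Rightarrow> complex) \<Rightarrow> jet \<Rightarrow> complex" where
  "pd_q F = (\<lambda>(x, u, p, q). deriv (\<lambda>t. F (x, u, p, t)) q)"

definition jet_p :: "jet \<Rightarrow> complex" where "jet_p = (\<lambda>(x, u, p, q). p)"
definition jet_q :: "jet \<Rightarrow> complex" where "jet_q = (\<lambda>(x, u, p, q). q)"

definition on_jets :: "(plane \<Rightarrow> complex) \<Rightarrow> jet \<Rightarrow> complex" where
  "on_jets F = (\<lambda>(x, u, p, q). F (x, u))"

text \<open>
  Total derivative \<open>\<partial>\<^sub>x + p \<partial>\<^sub>u + q \<partial>\<^sub>p + r \<partial>\<^sub>q\<close>, with \<open>r\<close> the value of \<open>u'''\<close>. On functions of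
  \<open>(x, u, p)\<close> the value of \<open>r\<close> is immaterial, and \<open>total_deriv_low\<close> omits that term.
\<close>

definition total_deriv_low :: "(jet \<Rightarrow> complex) \<Rightarrow> jet \<Rightarrow> complex" where
  "total_deriv_low F z = pd_x F z + jet_p z * pd_u F z + jet_q z * pd_p F z"

definition total_deriv :: "complex \<Rightarrow> (jet \<Rightarrow> complex) \<Rightarrow> jet \<Rightarrow> complex" where
  "total_deriv r F z = pd_x F z + jet_p z * pd_u F z + jet_q z * pd_p F z + r * pd_q F z"

definition Dhat :: "(jet \<Rightarrow> complex) \<Rightarrow> (jet \<Rightarrow> complex) \<Rightarrow> jet \<Rightarrow> complex" where
  "Dhat f F z = total_deriv (f z) F z"

definition I1 :: "(jet \<Rightarrow> complex) \<Rightarrow> jet \<Rightarrow> complex" where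
  "I1 f z = - pd_q f z"

definition I2 :: "(jet \<Rightarrow> complex) \<Rightarrow> jet \<Rightarrow> complex" where
  "I2 f z = - (2/9) * (I1 f z)^2 - pd_p f z - (1/3) * Dhat f (I1 f) z"

definition I3 :: "(jet \<Rightarrow> complex) \<Rightarrow> jet \<Rightarrow> complex" where
  "I3 f z = - (1/6) * pd_q (I1 f) z"

definition I4 :: "(jet \<Rightarrow> complex) \<Rightarrow> jet \<Rightarrow> complex" where
  "I4 f z = - (1/3) * I1 f z * I2 f z - pd_u f z - (1/2) * Dhat f (I2 f) z"

definition I5 :: "(jet \<Rightarrow> complex) \<Rightarrow> jet \<Rightarrow> complex" where
  "I5 f z = - ((I3 f z)^2) - pd_p (I3 f) z"

definition I6 :: "(jet \<Rightarrow> complex) \<Rightarrow> jet \<Rightarrow> complex" where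
  "I6 f z = - pd_q (I3 f) z"

text \<open>The invariant \<open>I\<^sub>7\<close> depends on a choice \<open>J\<close> of a square root of \<open>- I\<^sub>5\<close>; the other
  choice changes its sign.\<close>

definition I7 :: "(jet \<Rightarrow> complex) \<Rightarrow> (jet \<Rightarrow> complex) \<Rightarrow> jet \<Rightarrow> complex" where
  "I7 f J z = (1/3) * I1 f z * J z - pd_x J z - jet_p z * pd_u J z
                + 2 * jet_q z * I3 f z * J z"

text \<open>
  Prolongation of \<open>(x, u) \<mapsto> (\<phi>(x,u), \<psi>(x,u))\<close>: every new derivative coordinate is the total
  derivative of the preceding one divided by the total derivative of \<open>\<phi>\<close>.
\<close>

definition prol_p :: "(plane \<Rightarrow> complex) \<Rightarrow> (plane \<Rightarrow> complex) \<Rightarrow> jet \<Rightarrow> complex" where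
  "prol_p \<phi> \<psi> z = total_deriv_low (on_jets \<psi>) z / total_deriv_low (on_jets \<phi>) z"

definition prol_q :: "(plane \<Rightarrow> complex) \<Rightarrow> (plane \<Rightarrow> complex) \<Rightarrow> jet \<Rightarrow> complex" where
  "prol_q \<phi> \<psi> z = total_deriv_low (prol_p \<phi> \<psi>) z / total_deriv_low (on_jets \<phi>) z"

definition prol_r :: "(plane \<Rightarrow> complex) \<Rightarrow> (plane \<Rightarrow> complex) \<Rightarrow> jet \<Rightarrow> complex \<Rightarrow> complex" where
  "prol_r \<phi> \<psi> z r = total_deriv r (prol_q \<phi> \<psi>) z / total_deriv_low (on_jets \<phi>) z"

definition prol_jet :: "(plane \<Rightarrow> complex) \<Rightarrow> (plane \<Rightarrow> complex) \<Rightarrow> jet \<Rightarrow> jet" where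
  "prol_jet \<phi> \<psi> z = (on_jets \<phi> z, on_jets \<psi> z, prol_p \<phi> \<psi> z, prol_q \<phi> \<psi> z)"

text \<open>
  Local equivalence, near the jet \<open>z0 \<in> U\<close>, of the ODE \<open>u''' = f\<close> with domain \<open>U\<close> to the ODE
  \<open>u''' = g\<close> with domain \<open>V\<close>: the third prolongation of a local point transformation is defined
  near \<open>z0\<close> and maps the hypersurface \<open>r = f\<close> of the third-order jet space to the
  hypersurface \<open>r = g\<close>.
\<close>

definition point_equivalent_near ::
  "(jet \<Rightarrow> complex) \<Rightarrow> jet set \<Rightarrow> jet \<Rightarrow> (jet \<Rightarrow> complex) \<Rightarrow> jet set \<Rightarrow> bool" where
  "point_equivalent_near f U z0 g V \<longleftrightarrow>
     (\<exists>\<phi> \<psi> D N.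
        holomorphic_plane \<phi> D \<and> holomorphic_plane \<psi> D \<and>
        open N \<and> z0 \<in> N \<and> N \<subseteq> U \<and>
        (\<forall>z\<in>N. (fst z, fst (snd z)) \<in> D \<and>
           pd_x (on_jets \<phi>) z * pd_u (on_jets \<psi>) z - pd_u (on_jets \<phi>) z * pd_x (on_jets \<psi>) z \<noteq> 0 \<and>
           total_deriv_low (on_jets \<phi>) z \<noteq> 0 \<and>
           prol_jet \<phi> \<psi> z \<in> V \<and>
           (\<forall>r. r = f z \<longleftrightarrow> prol_r \<phi> \<psi> z r = g (prol_jet \<phi> \<psi> z))))"

definition canonical_rhs :: "jet \<Rightarrow> complex" where
  "canonical_rhs z = (3/2) * (jet_q z)^2 / jet_p z"

definition canonical_domain :: "jet set" where
  "canonical_domain = {z. jet_p z \<noteq> 0}"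

text \<open>
  Infinitesimal point symmetries, on a region \<open>D\<close> of the plane, of the ODE \<open>u''' = g\<close> with domain
  \<open>V\<close>: holomorphic vector fields \<open>\<xi> \<partial>\<^sub>x + \<eta> \<partial>\<^sub>u\<close> on \<open>D\<close> whose third prolongation annihilates
  \<open>r - g\<close> on the hypersurface \<open>r = g\<close>. The prolongation coefficients are
  \<open>\<eta>\<^sub>k\<^sub>+\<^sub>1 = D \<eta>\<^sub>k - u\<^sub>k\<^sub>+\<^sub>1 D \<xi>\<close>, where \<open>D\<close> is the total derivative and \<open>u\<^sub>k\<close> is the \<open>k\<close>-th derivative
  of \<open>u\<close>. Vector fields are normalised to be \<open>0\<close> outside \<open>D\<close>, so that distinct functions are
  distinct vector fields on \<open>D\<close>.
\<close>

definition sym_p :: "(plane \<Rightarrow> complex) \<Rightarrow> (plane \<Rightarrow> complex) \<Rightarrow> jet \<Rightarrow> complex" where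
  "sym_p \<xi> \<eta> z = total_deriv_low (on_jets \<eta>) z - jet_p z * total_deriv_low (on_jets \<xi>) z"

definition sym_q :: "(plane \<Rightarrow> complex) \<Rightarrow> (plane \<Rightarrow> complex) \<Rightarrow> jet \<Rightarrow> complex" where
  "sym_q \<xi> \<eta> z = total_deriv_low (sym_p \<xi> \<eta>) z - jet_q z * total_deriv_low (on_jets \<xi>) z"

definition sym_r :: "(plane \<Rightarrow> complex) \<Rightarrow> (plane \<Rightarrow> complex) \<Rightarrow> jet \<Rightarrow> complex \<Rightarrow> complex" where
  "sym_r \<xi> \<eta> z r = total_deriv r (sym_q \<xi> \<eta>) z - r * total_deriv_low (on_jets \<xi>) z"

definition point_symmetries ::
  "(jet \<Rightarrow> complex) \<Rightarrow> jet set \<Rightarrow> plane set \<Rightarrow> (plane \<Rightarrow> complex \<times> complex) set" where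
  "point_symmetries g V D =
     {X. \<exists>\<xi> \<eta>. X = (\<lambda>w. (\<xi> w, \<eta> w)) \<and>
        holomorphic_plane \<xi> D \<and> holomorphic_plane \<eta> D \<and>
        (\<forall>w. w \<notin> D \<longrightarrow> X w = (0, 0)) \<and>
        (\<forall>z\<in>V. (fst z, fst (snd z)) \<in> D \<longrightarrow>
           sym_r \<xi> \<eta> z (g z) =
             on_jets \<xi> z * pd_x g z + on_jets \<eta> z * pd_u g z
             + sym_p \<xi> \<eta> z * pd_p g z + sym_q \<xi> \<eta> z * pd_q g z)}"

definition vf_scale :: "complex \<Rightarrow> (plane \<Rightarrow> complex \<times> complex) \<Rightarrow> plane \<Rightarrow> complex \<times> complex" where
  "vf_scale c X = (\<lambda>w. (c * fst (X w), c * snd (X w)))"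

lemma vector_space_vf_scale: "vector_space vf_scale"
  by unfold_locales (auto simp: vf_scale_def fun_eq_iff prod_eq_iff algebra_simps)

end

theory Submission
  imports Defs "HOL-Complex_Analysis.Complex_Analysis"
begin

text \<open>
  Write \<open>D\<close> for the total derivative along solutions of \<open>u''' = f\<close>. For a function \<open>\<chi>\<close> of
  \<open>(x, u)\<close> let \<open>S(\<chi>) = D (D\<^sup>2\<chi> / D\<chi>) - (D\<^sup>2\<chi> / D\<chi>)\<^sup>2 / 2\<close>, the Schwarzian derivative of \<open>\<chi>\<close> restricted
  to solutions. The canonical equation says that the Schwarzian derivative of \<open>u\<close> with respect to \<open>x\<close>
  vanishes, so by the chain rule for Schwarzian derivatives a point transformation \<open>(\<phi>, \<psi>)\<close>
  transforms \<open>u''' = f\<close> into it if and only if \<open>K = S(\<psi>) - S(\<phi>)\<close> vanishes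
  (\<open>prolongation_iff\<close>). The theorem is thus a statement about the defect \<open>K\<close> of a pair of functions.

  Put \<open>A = D\<phi>\<close>, \<open>B = D\<psi>\<close>, \<open>\<alpha> = \<phi>\<^sub>u / A\<close>, \<open>\<beta> = \<psi>\<^sub>u / B\<close>, \<open>\<delta> = \<beta> - \<alpha>\<close> and \<open>\<gamma> = \<alpha> + \<beta>\<close>; here \<open>\<delta>\<close> is the
  Jacobian divided by \<open>A B\<close>, hence nonzero. The derivatives of \<open>s = S(\<psi>)\<close> with respect to \<open>q\<close>, \<open>p\<close>, \<open>u\<close> are
  the coefficients of \<open>v''\<close>, \<open>v'\<close>, \<open>v\<close> that result from applying \<open>D\<^sup>3 + 2 s D + D s\<close> to \<open>\<beta> v\<close> for a
  solution \<open>v\<close> of the linearised equation (\<open>pd_schwarzian\<close>). If \<open>K\<^sub>q = 0\<close>, subtracting these formulas for \<open>\<phi>\<close> from those for \<open>\<psi>\<close> and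
  eliminating \<open>f\<^sub>q\<close>, \<open>f\<^sub>p\<close>, \<open>f\<^sub>u\<close> yields
  \<open>I\<^sub>1 = 3 D\<delta> / \<delta>\<close>, \<open>I\<^sub>3 = \<gamma> / 2\<close>, \<open>I\<^sub>5 = \<delta>\<^sup>2 / 4\<close>, and
  \<open>- 2 \<delta> I\<^sub>4 = (D\<delta> / \<delta>) (K \<gamma> - K\<^sub>p) - K D\<gamma> - D K\<^sub>p + 2 K\<^sub>u\<close> (\<open>I4_defect\<close>).
  Necessity is the case \<open>K = 0\<close>, with \<open>J = \<i> \<delta> / 2\<close>.

  For sufficiency, \<open>I\<^sub>6 = 0\<close> and the third \<open>q\<close>-derivative of \<open>I\<^sub>4 = 0\<close> imply that \<open>J\<close> depends on
  \<open>(x, u, p)\<close> only and \<open>J\<^sub>p = - 2 I\<^sub>3 J\<close>, after which \<open>I\<^sub>7 = 0\<close> reads \<open>I\<^sub>1 = 3 DJ / J\<close>. Together with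
  \<open>J\<^sup>2 = I\<^sub>3\<^sup>2 + I\<^sub>3\<^sub>p\<close> this makes \<open>1 / J\<close> a quadratic polynomial in \<open>p\<close> of discriminant \<open>-4\<close>. It is a
  product of two linear factors, which are two transversal direction fields in the plane. First
  integrals \<open>\<phi>\<close>, \<open>\<psi>\<close> of them have \<open>\<delta>\<close> equal to a constant multiple of \<open>J\<close>
  (\<open>adapted_coordinates\<close>), so that \<open>K\<^sub>q = 3 D\<delta> - I\<^sub>1 \<delta> = 0\<close>. Now \<open>I\<^sub>4 = 0\<close> is a linear differential
  equation for \<open>K\<close>. Its \<open>q\<close>-derivative is an ordinary differential equation in \<open>p\<close> with the solutions
  \<open>K = k B\<^sup>2 + l A\<^sup>2\<close>, where \<open>k\<close>, \<open>l\<close> depend on \<open>(x, u)\<close>, and what remains of the equation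
  says that \<open>k\<close> is a function of \<open>\<psi>\<close> and \<open>l\<close> a function of \<open>\<phi>\<close> (\<open>kl_transport\<close>). Replacing \<open>\<psi>\<close> by
  \<open>\<Psi>(\<psi>)\<close> adds \<open>{\<Psi>, \<psi>} B\<^sup>2\<close> to \<open>S(\<psi>)\<close>, where \<open>{\<Psi>, \<psi>}\<close> is the ordinary Schwarzian derivative, and
  likewise for \<open>\<phi>\<close>. Solving \<open>{\<Psi>, \<psi>} = - k\<close> and \<open>{\<Phi>, \<phi>} = l\<close> makes the defect vanish
  (\<open>equivalence_from_adapted\<close>).

  The analysis behind this: a continuous function that is holomorphic along each coordinate axis is
  holomorphic, and so are its partial derivatives, which commute. First integrals come from
  inverting the flow of a vector field, which depends holomorphically on its initial value because it
  is a uniform limit of holomorphic Picard iterates. A prescribed Schwarzian derivative is a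
  Riccati equation followed by two integrations.

  For the canonical equation, the symmetry condition on \<open>\<xi> \<partial>\<^sub>x + \<eta> \<partial>\<^sub>u\<close> is a polynomial identity in
  \<open>q\<close> and, after clearing denominators, in \<open>p\<close>. Its coefficients give \<open>\<xi>\<^sub>u = \<eta>\<^sub>x = 0\<close> and
  \<open>\<xi>\<^sub>x\<^sub>x\<^sub>x = \<eta>\<^sub>u\<^sub>u\<^sub>u = 0\<close>. On a connected domain \<open>\<xi>\<close> and \<open>\<eta>\<close> are therefore quadratic polynomials in
  \<open>x\<close> and in \<open>u\<close>, three parameters each: the algebra of two commuting projective actions on a line.
\<close>

section \<open>Complex differentiation along a direction\<close>

text \<open>
  The direction is a real-linear map from the complex line into a real normed space. This covers the
  coordinate axes of the plane and of the jet space, and also spaces with an additional real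
  parameter, over which one wants to integrate.
\<close>
definition dpd :: "(complex \<Rightarrow> 'a::real_normed_vector) \<Rightarrow> ('a \<Rightarrow> complex) \<Rightarrow> 'a \<Rightarrow> complex" where
  "dpd e F z = deriv (\<lambda>t. F (z + e t)) 0"

lemma DERIV_imp_field_differentiable: "(f has_field_derivative D) F \<Longrightarrow> f field_differentiable F"
  unfolding field_differentiable_def by blast

text \<open>
  Holomorphy on each complex line in the direction \<open>e\<close>, with no regularity across these lines.
\<close>
definition slice_hol :: "(complex \<Rightarrow> 'a::real_normed_vector) \<Rightarrow> ('a \<Rightarrow> complex) \<Rightarrow> 'a set \<Rightarrow> bool" where
  "slice_hol e F U \<longleftrightarrow> (\<forall>z\<in>U. (\<lambda>t. F (z + e t)) field_differentiable (at 0))"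

lemma slice_has_derivative:
  assumes "bounded_linear e" "slice_hol e F U" "z + e t \<in> U"
  shows "((\<lambda>t. F (z + e t)) has_field_derivative dpd e F (z + e t)) (at t)"
proof -
  interpret bounded_linear e by fact
  have "((\<lambda>s. F ((z + e t) + e s)) has_field_derivative dpd e F (z + e t)) (at 0)"
    using assms(2,3) unfolding slice_hol_def dpd_def
    by (metis field_differentiable_derivI)
  then have "((\<lambda>s. F (z + e (s + t))) has_field_derivative dpd e F (z + e t)) (at 0)"
    by (simp add: add algebra_simps)
  then show ?thesis
    using DERIV_shift[of "\<lambda>s. F (z + e s)" "dpd e F (z + e t)" 0 t] by simp
qed

text \<open>
  The radius of the discs does not depend on their centre, so that Cauchy estimates at varying
  centres are comparable.
\<close>
lemma slice_room:
  fixes z0 :: "'a::real_normed_vector" and e :: "complex \<Rightarrow> 'a"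
  assumes "bounded_linear e" "open U" "z0 \<in> U"
  obtains r \<rho> where "r > 0" "\<rho> > 0" "\<And>z t. z \<in> ball z0 r \<Longrightarrow> t \<in> cball 0 \<rho> \<Longrightarrow> z + e t \<in> U"
proof -
  obtain R where R: "R > 0" "ball z0 R \<subseteq> U" using assms by (meson open_contains_ball)
  obtain K where K: "K > 0" "\<And>t. norm (e t) \<le> norm t * K"
    using bounded_linear.pos_bounded[OF assms(1)] by blast
  show ?thesis
  proof (rule that[of "R/2" "R/(2*K)"])
    fix z and t :: complex assume z: "z \<in> ball z0 (R/2)" and t: "t \<in> cball 0 (R/(2*K))"
    have "norm t * K \<le> R / (2*K) * K" using t K by (intro mult_right_mono) auto
    then have "norm (e t) \<le> R/2" using K(2)[of t] K(1) by simp
    moreover have "dist z0 (z + e t) \<le> dist z0 z + norm (e t)"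
      by (metis add_diff_cancel_left' dist_commute dist_norm dist_triangle)
    ultimately have "dist z0 (z + e t) < R" using z by simp
    then show "z + e t \<in> U" using R by auto
  qed (use R K in auto)
qed

text \<open>
  By the Cauchy estimate on a disc of fixed radius, the derivative at the centre is controlled by the
  values on the circle. By compactness of the disc these values vary continuously, uniformly on it,
  when the centre moves.
\<close>
lemma dpd_continuous:
  assumes e: "bounded_linear e" and U: "open U" and F: "continuous_on U F" and s: "slice_hol e F U"
  shows "continuous_on U (dpd e F)"
  unfolding continuous_on_eq_continuous_at[OF U]
proof
  fix z0 assume z0: "z0 \<in> U"
  interpret bounded_linear e by fact
  obtain r \<rho> where r: "r > 0" "\<rho> > 0" "\<And>z t. z \<in> ball z0 r \<Longrightarrow> t \<in> cball 0 \<rho> \<Longrightarrow> z + e t \<in> U"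
    using slice_room[OF e U z0] by metis
  show "isCont (dpd e F) z0"
    unfolding continuous_at_eps_delta
  proof (intro allI impI)
    fix \<epsilon> :: real assume \<epsilon>: "\<epsilon> > 0"
    have cF: "continuous_on (ball z0 r \<times> cball 0 \<rho>) (\<lambda>(z,t). F (z + e t))"
      unfolding split_beta
      by (rule continuous_on_compose2[OF F])
         (use r(3) in \<open>auto intro!: continuous_intros continuous_on\<close>)
    obtain X0 where X0: "z0 \<in> X0" "open X0"
      "\<forall>z\<in>X0 \<inter> ball z0 r. \<forall>t\<in>cball 0 \<rho>. dist (F (z + e t)) (F (z0 + e t)) \<le> \<epsilon>/2*\<rho>"
      using continuous_on_prod_compactE[OF cF compact_cball, of z0 "\<epsilon>/2*\<rho>"] r(1,2) \<epsilon>
      by (auto simp: split_beta)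
    obtain d where d: "d > 0" "ball z0 d \<subseteq> X0 \<inter> ball z0 r"
      using X0 r(1) by (metis IntI centre_in_ball open_Int open_ball open_contains_ball)
    have "dist (dpd e F z) (dpd e F z0) < \<epsilon>" if "dist z z0 < d" for z
    proof -
      have z: "z \<in> X0" "z \<in> ball z0 r" using d that by (auto simp: dist_commute)
      have zz: "z0 \<in> ball z0 r" using r by simp
      have D: "((\<lambda>t. F (w + e t)) has_field_derivative dpd e F (w + e t)) (at t)"
        if "t \<in> cball 0 \<rho>" "w \<in> ball z0 r" for t w
        using slice_has_derivative[OF e s] r(3) that by blast
      let ?g = "\<lambda>t. F (z + e t) - F (z0 + e t)"
      have Dg: "(?g has_field_derivative dpd e F (z + e t) - dpd e F (z0 + e t)) (at t)"
        if "t \<in> cball 0 \<rho>" for t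
        by (intro derivative_intros D that z zz)
      \<comment> \<open>Cauchy estimate for the difference of the two restrictions to the disc of radius \<open>\<rho>\<close>.\<close>
      have "norm ((deriv ^^ 1) ?g 0) \<le> fact 1 * (\<epsilon>/2*\<rho>) / \<rho> ^ 1"
      proof (rule Cauchy_inequality)
        show "?g holomorphic_on ball 0 \<rho>"
          unfolding holomorphic_on_def
        proof
          fix t :: complex assume "t \<in> ball 0 \<rho>"
          then show "?g field_differentiable (at t within ball 0 \<rho>)"
            by (intro field_differentiable_at_within[of ?g t "ball 0 \<rho>"] DERIV_imp_field_differentiable[OF Dg]) simp
        qed
        show "continuous_on (cball 0 \<rho>) ?g"
          by (rule DERIV_continuous_on, rule has_field_derivative_at_within, rule Dg)
        fix x :: complex assume "norm (0 - x) = \<rho>"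
        then show "norm (?g x) \<le> \<epsilon>/2*\<rho>" using X0(3) z by (auto simp: dist_norm)
      qed (use r in auto)
      moreover have "deriv ?g 0 = dpd e F z - dpd e F z0"
        using DERIV_imp_deriv[OF Dg[of 0]] r zero by simp
      ultimately show ?thesis using r \<epsilon> by (simp add: dist_norm)
    qed
    then show "\<exists>d>0. \<forall>x'. dist x' z0 < d \<longrightarrow> dist (dpd e F x') (dpd e F z0) < \<epsilon>"
      using d(1) by blast
  qed
qed

text \<open>
  The difference quotients of \<open>F\<close> in the direction \<open>e'\<close> converge locally uniformly on the discs in the
  direction \<open>e\<close>, because \<open>dpd e' F\<close> is continuous. By Weierstrass their derivatives in the direction
  \<open>e\<close> converge as well, and these are the difference quotients of \<open>dpd e F\<close>. This yields both the
  existence of the mixed derivative and the equality of the two orders.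
\<close>
lemma dpd_swap:
  assumes e: "bounded_linear e" and e': "bounded_linear e'" and U: "open U"
    and F: "continuous_on U F" and s: "slice_hol e F U" and s': "slice_hol e' F U" and z: "z \<in> U"
  shows "((\<lambda>h. dpd e F (z + e' h)) has_field_derivative dpd e (dpd e' F) z) (at 0)"
proof -
  interpret e: bounded_linear e by fact
  interpret e': bounded_linear e' by fact
  obtain r \<rho> where r: "r > 0" "\<rho> > 0" "\<And>z' t. z' \<in> ball z r \<Longrightarrow> t \<in> cball 0 \<rho> \<Longrightarrow> z' + e t \<in> U"
    using slice_room[OF e U z] by metis
  obtain r' \<sigma> where r': "r' > 0" "\<sigma> > 0" "\<And>z' t. z' \<in> ball z r' \<Longrightarrow> t \<in> cball 0 \<sigma> \<Longrightarrow> z' + e' t \<in> ball z r"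
    using slice_room[OF e' open_ball, of z z r] r(1) by auto
  have inU: "z + e' h + e t \<in> U" if "h \<in> cball 0 \<sigma>" "t \<in> cball 0 \<rho>" for h t
    using r(3) r'(3)[of z h] r'(1) that by auto
  have D: "((\<lambda>t. F (z + e' h + e t)) has_field_derivative dpd e F (z + e' h + e t)) (at t)"
    if "h \<in> cball 0 \<sigma>" "t \<in> cball 0 \<rho>" for h t
    using slice_has_derivative[OF e s] inU that by blast
  have D': "((\<lambda>h. F (z + e' h + e t)) has_field_derivative dpd e' F (z + e' h + e t)) (at h)"
    if "h \<in> cball 0 \<sigma>" "t \<in> cball 0 \<rho>" for h t
    using slice_has_derivative[OF e' s', of "z + e t" h] inU[OF that] by (simp add: algebra_simps)
  let ?G = "\<lambda>h t. (F (z + e' h + e t) - F (z + e t)) / h"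
  let ?g = "\<lambda>t. dpd e' F (z + e t)"
  have cF: "continuous_on (ball 0 \<sigma> \<times> cball 0 \<rho>) (\<lambda>(h,t). dpd e' F (z + e' h + e t))"
    unfolding split_beta
    by (rule continuous_on_compose2[OF dpd_continuous[OF e' U F s']])
       (use inU in \<open>auto intro!: continuous_intros e.continuous_on e'.continuous_on\<close>)
  have "((\<lambda>h. deriv (?G h) 0) \<longlongrightarrow> deriv ?g 0) (at 0)"
  proof (rule deriv_complex_uniform_limit)
    show "uniform_limit (ball 0 \<rho>) ?G ?g (at 0)"
      unfolding uniform_limit_iff
    proof (intro allI impI)
      fix \<epsilon> :: real assume \<epsilon>: "\<epsilon> > 0"
      obtain X0 where X0: "0 \<in> X0" "open X0"
        "\<forall>h\<in>X0 \<inter> ball 0 \<sigma>. \<forall>t\<in>cball 0 \<rho>. dist (dpd e' F (z + e' h + e t)) (dpd e' F (z + e t)) \<le> \<epsilon>/2"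
        using continuous_on_prod_compactE[OF cF compact_cball, of 0 "\<epsilon>/2"] r' \<epsilon>
        by (auto simp: split_beta e'.zero)
      obtain d where d: "d > 0" "ball 0 d \<subseteq> X0 \<inter> ball 0 \<sigma>"
        using X0 r'(2) by (metis IntI centre_in_ball open_Int open_ball open_contains_ball)
      have "dist (?G h t) (?g t) < \<epsilon>" if h: "h \<noteq> 0" "dist h 0 < d" and t: "t \<in> ball 0 \<rho>" for h t
      proof -
        have "norm ((F (z + e' h + e t) - h * ?g t) - (F (z + e' 0 + e t) - 0 * ?g t)) \<le> \<epsilon>/2 * norm (h - 0)"
        proof (rule field_differentiable_bound[OF convex_ball[of 0 d]])
          fix k assume k: "k \<in> ball (0::complex) d"
          show "((\<lambda>h. F (z + e' h + e t) - h * ?g t) has_field_derivative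
                  dpd e' F (z + e' k + e t) - ?g t) (at k within ball 0 d)"
            by (rule has_field_derivative_at_within, rule DERIV_diff[OF D'])
               (use k d t in \<open>auto intro!: derivative_eq_intros\<close>)
          show "norm (dpd e' F (z + e' k + e t) - ?g t) \<le> \<epsilon>/2"
            using X0(3)[rule_format, OF subsetD[OF d(2) k], of t] t by (simp add: dist_norm)
        qed (use h d in auto)
        moreover have "(F (z + e' h + e t) - h * ?g t) - (F (z + e' 0 + e t) - 0 * ?g t) = (?G h t - ?g t) * h"
          (is "_ = ?R")
        proof -
          have "?G h t * h = F (z + e' h + e t) - F (z + e t)" using h by simp
          then show ?thesis unfolding left_diff_distrib by (simp add: e'.zero)
        qed
        ultimately have "norm (?G h t - ?g t) * norm h \<le> \<epsilon>/2 * norm h"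
          by (simp only: norm_mult diff_zero)
        then have "norm (?G h t - ?g t) \<le> \<epsilon>/2" using h by simp
        then show ?thesis using \<epsilon> by (simp add: dist_norm)
      qed
      then show "\<forall>\<^sub>F h in at 0. \<forall>t\<in>ball 0 \<rho>. dist (?G h t) (?g t) < \<epsilon>"
        unfolding eventually_at using d(1) by blast
    qed
    have "?G h holomorphic_on ball 0 \<rho>" if h: "h \<in> cball 0 \<sigma>" for h
      unfolding holomorphic_on_def
    proof
      fix t :: complex assume t: "t \<in> ball 0 \<rho>"
      have t': "t \<in> cball 0 \<rho>" and h0: "0 \<in> cball (0::complex) \<sigma>" using t r' by auto
      have "(\<lambda>t. F (z + e' h + e t)) field_differentiable (at t)"
        "(\<lambda>t. F (z + e' 0 + e t)) field_differentiable (at t)"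
        unfolding field_differentiable_def using D[OF h t'] D[OF h0 t'] by blast+
      then have "(\<lambda>t. (F (z + e' h + e t) - F (z + e' 0 + e t)) * inverse h) field_differentiable (at t)"
        by (intro field_differentiable_mult field_differentiable_diff field_differentiable_const)
      then show "?G h field_differentiable (at t within ball 0 \<rho>)"
        using field_differentiable_at_within by (simp add: e'.zero divide_inverse)
    qed
    then show "\<forall>\<^sub>F h in at 0. ?G h holomorphic_on ball 0 \<rho>"
      unfolding eventually_at using r'(2) by (intro exI[of _ \<sigma>]) auto
  qed (use r in auto)
  moreover have "deriv (?G h) 0 = (dpd e F (z + e' h) - dpd e F z) / h" if h: "h \<in> cball 0 \<sigma>" for h
  proof -
    have 0: "0 \<in> cball (0::complex) \<rho>" "0 \<in> cball (0::complex) \<sigma>" using r r' by auto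
    have "((\<lambda>t. (F (z + e' h + e t) - F (z + e' 0 + e t)) / h) has_field_derivative
        (dpd e F (z + e' h + e 0) - dpd e F (z + e' 0 + e 0)) / h) (at 0)"
      by (rule DERIV_cdivide[OF DERIV_diff[OF D[OF h 0(1)] D[OF 0(2,1)]]])
    from DERIV_imp_deriv[OF this] show ?thesis by (simp add: e.zero e'.zero)
  qed
  then have "\<forall>\<^sub>F h in at 0. deriv (?G h) 0 = (dpd e F (z + e' h) - dpd e F z) / h"
    unfolding eventually_at using r'(2) by (intro exI[of _ \<sigma>]) auto
  ultimately have "((\<lambda>h. (dpd e F (z + e' h) - dpd e F z) / h) \<longlongrightarrow> deriv ?g 0) (at 0)"
    using Lim_transform_eventually by fast
  then show ?thesis
    unfolding DERIV_def dpd_def[of e "dpd e' F"] by (simp add: e'.zero)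
qed

lemma slice_hol_dpd:
  assumes "bounded_linear e" "bounded_linear e'" "open U" "continuous_on U F" "slice_hol e F U" "slice_hol e' F U"
  shows "slice_hol e' (dpd e F) U"
  using dpd_swap[OF assms] unfolding slice_hol_def field_differentiable_def by blast

lemma dpd_commute:
  assumes "bounded_linear e" "bounded_linear e'" "open U" "continuous_on U F" "slice_hol e F U" "slice_hol e' F U" "z \<in> U"
  shows "dpd e' (dpd e F) z = dpd e (dpd e' F) z"
  using dpd_swap[OF assms] unfolding dpd_def[of e'] by (rule DERIV_imp_deriv)

text \<open>
  Serves to adjoin one complex variable \<open>x\<close> at a time: differentiability in the variables \<open>y\<close> treated
  so far is the hypothesis on \<open>L\<close>, and continuity is asked only of the derivative in the new variable.
\<close>
lemma has_derivative_prodI: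
  fixes F :: "complex \<times> 'b::real_normed_vector \<Rightarrow> complex"
  assumes V: "open V" "(x0, y0) \<in> V"
    and L: "((\<lambda>y. F (x0, y)) has_derivative L) (at y0)"
    and a: "\<And>x y. (x, y) \<in> V \<Longrightarrow> ((\<lambda>x. F (x, y)) has_field_derivative a (x, y)) (at x)"
    and c: "isCont a (x0, y0)"
  shows "(F has_derivative (\<lambda>(h, k). a (x0, y0) * h + L k)) (at (x0, y0))"
proof -
  obtain A B where AB: "open A" "open B" "x0 \<in> A" "y0 \<in> B" "A \<times> B \<subseteq> V"
    using V open_prod_elim by (metis mem_Sigma_iff)
  obtain r where r: "r > 0" "ball x0 r \<subseteq> A" using AB by (meson open_contains_ball)
  have fy: "bounded_linear ((*) (a z))" for z by (rule bounded_linear_mult_right)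
  have 1: "((\<lambda>(y, x). F (x, y)) has_derivative (\<lambda>(k, h). L k + blinfun_mult_right (a (x0, y0)) h))
          (at (y0, x0) within B \<times> ball x0 r)"
  proof (rule has_derivative_partialsI[where fy = "\<lambda>y x. blinfun_mult_right (a (x, y))"])
    show "((\<lambda>y. F (x0, y)) has_derivative L) (at y0 within B)"
      using L has_derivative_at_withinI by blast
    fix y x assume "y \<in> B" "x \<in> ball x0 r"
    then have "((\<lambda>x. F (x, y)) has_field_derivative a (x, y)) (at x within ball x0 r)"
      using a AB r has_field_derivative_at_within by blast
    then show "((\<lambda>x. F (x, y)) has_derivative blinfun_apply (blinfun_mult_right (a (x, y)))) (at x within ball x0 r)"
      by (simp add: has_field_derivative_def)
  next
    have s: "isCont (\<lambda>z::'b \<times> complex. (snd z, fst z)) (y0, x0)" by (intro continuous_intros)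
    have "isCont (\<lambda>z. a (snd z, fst z)) (y0, x0)"
      using isCont_o2[OF s, of a] c by simp
    then have "isCont (\<lambda>(y,x). blinfun_mult_right (a (x, y))) (y0, x0)"
      unfolding split_beta by (intro bounded_linear.isCont[OF bounded_linear_blinfun_mult_right])
    then show "continuous (at (y0, x0) within B \<times> ball x0 r) (\<lambda>(y, x). blinfun_mult_right (a (x, y)))"
      using continuous_at_imp_continuous_at_within by blast
  qed (use r in auto)
  have 2: "at (y0, x0) within B \<times> ball x0 r = at (y0, x0)"
    by (rule at_within_open) (use AB r in \<open>auto intro: open_Times\<close>)
  have 3: "((\<lambda>z::complex \<times> 'b. (snd z, fst z)) has_derivative (\<lambda>z. (snd z, fst z))) (at (x0,y0))"
    by (intro bounded_linear_imp_has_derivative bounded_linear_intros)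
  have "((\<lambda>(y, x). F (x, y)) \<circ> (\<lambda>z. (snd z, fst z)) has_derivative
          (\<lambda>(k, h). L k + blinfun_mult_right (a (x0, y0)) h) \<circ> (\<lambda>z. (snd z, fst z))) (at (x0, y0))"
    by (rule diff_chain_at[OF 3]) (use 1 2 in simp)
  then show ?thesis by (simp add: o_def case_prod_unfold add.commute)
qed

section \<open>Holomorphic functions of jets\<close>

definition dir_x :: "complex \<Rightarrow> jet" where "dir_x t = (t, 0, 0, 0)"
definition dir_u :: "complex \<Rightarrow> jet" where "dir_u t = (0, t, 0, 0)"
definition dir_p :: "complex \<Rightarrow> jet" where "dir_p t = (0, 0, t, 0)"
definition dir_q :: "complex \<Rightarrow> jet" where "dir_q t = (0, 0, 0, t)"

lemmas dir_defs = dir_x_def dir_u_def dir_p_def dir_q_def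

lemma bounded_linear_dir: "bounded_linear dir_x" "bounded_linear dir_u" "bounded_linear dir_p" "bounded_linear dir_q"
  unfolding dir_defs zero_prod_def[symmetric]
  by (intro bounded_linear_Pair bounded_linear_zero bounded_linear_ident)+

lemma pd_eq_dpd: "pd_x = dpd dir_x" "pd_u = dpd dir_u" "pd_p = dpd dir_p" "pd_q = dpd dir_q"
proof -
  have 1: "deriv g x = deriv (\<lambda>t. g (x + t)) 0" for g and x :: complex
    by (subst deriv_shift_0) (simp only: o_def)
  show "pd_x = dpd dir_x" "pd_u = dpd dir_u" "pd_p = dpd dir_p" "pd_q = dpd dir_q"
    unfolding pd_x_def pd_u_def pd_p_def pd_q_def dpd_def dir_defs fun_eq_iff
    by (simp, intro allI, rule 1)+
qed

text \<open>
  The differential with its four complex coefficients, so that the rules of calculus can be stated for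
  all partial derivatives at once.
\<close>
definition jd :: "(jet \<Rightarrow> complex) \<Rightarrow> jet \<Rightarrow> complex \<Rightarrow> complex \<Rightarrow> complex \<Rightarrow> complex \<Rightarrow> bool" where
  "jd F z a b c d \<longleftrightarrow> (F has_derivative (\<lambda>(h, k, l, m). a * h + b * k + c * l + d * m)) (at z)"

lemma jd_slice:
  assumes "jd F z a b c d"
  shows "((\<lambda>t. F (z + dir_x t)) has_field_derivative a) (at 0)"
    "((\<lambda>t. F (z + dir_u t)) has_field_derivative b) (at 0)"
    "((\<lambda>t. F (z + dir_p t)) has_field_derivative c) (at 0)"
    "((\<lambda>t. F (z + dir_q t)) has_field_derivative d) (at 0)"
proof -
  have *: "((\<lambda>t. F (z + e t)) has_derivative (\<lambda>t. case e t of (h, k, l, m) \<Rightarrow> a * h + b * k + c * l + d * m)) (at 0)"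
    if e: "bounded_linear e" for e
  proof -
    have "((\<lambda>t. z + e t) has_derivative (\<lambda>t. 0 + e t)) (at 0)"
      by (intro derivative_intros bounded_linear_imp_has_derivative e)
    moreover have "z + e 0 = z" using linear_0[OF bounded_linear.linear[OF e]] by simp
    ultimately show ?thesis
      using has_derivative_compose[of "\<lambda>t. z + e t" e 0 UNIV F] assms
      unfolding jd_def by simp
  qed
  show "((\<lambda>t. F (z + dir_x t)) has_field_derivative a) (at 0)"
    "((\<lambda>t. F (z + dir_u t)) has_field_derivative b) (at 0)"
    "((\<lambda>t. F (z + dir_p t)) has_field_derivative c) (at 0)"
    "((\<lambda>t. F (z + dir_q t)) has_field_derivative d) (at 0)"
    using *[OF bounded_linear_dir(1)] *[OF bounded_linear_dir(2)] *[OF bounded_linear_dir(3)] *[OF bounded_linear_dir(4)]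
    by (simp_all add: dir_defs has_field_derivative_def mult_commute_abs)
qed

lemma jd_pd:
  assumes "jd F z a b c d"
  shows "pd_x F z = a" "pd_u F z = b" "pd_p F z = c" "pd_q F z = d"
  using jd_slice[OF assms] unfolding pd_eq_dpd dpd_def by (simp_all add: DERIV_imp_deriv)

lemma holomorphic_jet_jd:
  "holomorphic_jet F U \<longleftrightarrow> open U \<and> (\<forall>z\<in>U. jd F z (pd_x F z) (pd_u F z) (pd_p F z) (pd_q F z))"
proof -
  have "(\<exists>a b c d. jd F z a b c d) \<longleftrightarrow> jd F z (pd_x F z) (pd_u F z) (pd_p F z) (pd_q F z)" for z
    using jd_pd by metis
  then show ?thesis unfolding holomorphic_jet_def jd_def[symmetric] by simp
qed

lemma holomorphic_jet_continuous:
  assumes "holomorphic_jet F U" shows "continuous_on U F"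
proof (rule continuous_at_imp_continuous_on, rule ballI)
  fix z assume "z \<in> U"
  then have "jd F z (pd_x F z) (pd_u F z) (pd_p F z) (pd_q F z)"
    using assms unfolding holomorphic_jet_jd by blast
  then show "isCont F z" unfolding jd_def by (rule has_derivative_continuous)
qed

lemma holomorphic_jet_slice:
  assumes "holomorphic_jet F U"
  shows "slice_hol dir_x F U" "slice_hol dir_u F U" "slice_hol dir_p F U" "slice_hol dir_q F U"
proof -
  have "jd F z (pd_x F z) (pd_u F z) (pd_p F z) (pd_q F z)" if "z \<in> U" for z
    using that assms unfolding holomorphic_jet_jd by blast
  from jd_slice[OF this, THEN DERIV_imp_field_differentiable]
  show "slice_hol dir_x F U" "slice_hol dir_u F U" "slice_hol dir_p F U" "slice_hol dir_q F U"
    unfolding slice_hol_def by blast+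
qed

lemma slice_isCont:
  assumes "bounded_linear e" "open U" "continuous_on U F" "slice_hol e F U" "z \<in> U"
  shows "isCont (dpd e F) z"
  using dpd_continuous[OF assms(1-4)] assms(2,5) continuous_on_eq_continuous_at by blast

text \<open>
  The easy half of Hartogs' theorem (Osgood's lemma): by continuity the partial derivatives are
  continuous too, and adding the variables one after the other gives total differentiability.
\<close>
lemma holomorphic_jetI:
  assumes U: "open U" and F: "continuous_on U F"
    and s: "slice_hol dir_x F U" "slice_hol dir_u F U" "slice_hol dir_p F U" "slice_hol dir_q F U"
  shows "holomorphic_jet F U"
  unfolding holomorphic_jet_jd
proof (intro conjI U ballI)
  fix z assume z: "z \<in> U"
  obtain x u p q where [simp]: "z = (x, u, p, q)" by (cases z) auto
  have D: "((\<lambda>t. F (w + e t)) has_field_derivative dpd e F (w + e t)) (at t)"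
    if "bounded_linear e" "slice_hol e F U" "w + e t \<in> U" for e w t
    using slice_has_derivative that by blast
  have C: "isCont (dpd e F) w" if "bounded_linear e" "slice_hol e F U" "w \<in> U" for e w
    using slice_isCont[OF _ U F] that by blast
  \<comment> \<open>The variables are adjoined in the order \<open>q\<close>, \<open>p\<close>, \<open>u\<close>, \<open>x\<close>.\<close>
  have 1: "((\<lambda>q. F (x, u, p, q)) has_derivative (\<lambda>m. pd_q F z * m)) (at q)"
    using D[OF bounded_linear_dir(4) s(4), of "(x,u,p,0)" q] z
    by (simp add: dir_defs pd_eq_dpd has_field_derivative_def)
  have 2: "((\<lambda>y. F (x, u, y)) has_derivative (\<lambda>(l, m). pd_p F (x, u, p, q) * l + pd_q F z * m)) (at (p, q))"
  proof (rule has_derivative_prodI[where V = "(\<lambda>y. (x, u, y)) -` U" and a = "\<lambda>y. pd_p F (x, u, y)"])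
    show "open ((\<lambda>y. (x, u, y)) -` U)" by (intro open_vimage U continuous_intros)
    show "((\<lambda>p. F (x, u, p, q)) has_field_derivative pd_p F (x, u, p, q)) (at p)"
      if "(p, q) \<in> (\<lambda>y. (x, u, y)) -` U" for p q
      using D[OF bounded_linear_dir(3) s(3), of "(x,u,0,q)" p] that by (simp add: dir_defs pd_eq_dpd)
    show "isCont (\<lambda>y. pd_p F (x, u, y)) (p, q)"
      unfolding pd_eq_dpd
      by (rule isCont_o2[where g = "dpd dir_p F"]) (use z C[OF bounded_linear_dir(3) s(3)] in \<open>auto intro!: continuous_intros\<close>)
  qed (use 1 z in auto)
  have 3: "((\<lambda>y. F (x, y)) has_derivative (\<lambda>(k, y). pd_u F (x, u, p, q) * k + (\<lambda>(l, m). pd_p F z * l + pd_q F z * m) y)) (at (u, p, q))"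
  proof (rule has_derivative_prodI[where V = "(\<lambda>y. (x, y)) -` U" and a = "\<lambda>y. pd_u F (x, y)"])
    show "open ((\<lambda>y. (x, y)) -` U)" by (intro open_vimage U continuous_intros)
    show "((\<lambda>u. F (x, u, y)) has_field_derivative pd_u F (x, u, y)) (at u)"
      if "(u, y) \<in> (\<lambda>y. (x, y)) -` U" for u y
      using D[OF bounded_linear_dir(2) s(2), of "(x,0,y)" u] that by (cases y) (simp add: dir_defs pd_eq_dpd)
    show "isCont (\<lambda>y. pd_u F (x, y)) (u, p, q)"
      unfolding pd_eq_dpd
      by (rule isCont_o2[where g = "dpd dir_u F"]) (use z C[OF bounded_linear_dir(2) s(2)] in \<open>auto intro!: continuous_intros\<close>)
  qed (use 2 z in auto)
  have 4: "(F has_derivative (\<lambda>(h, y). pd_x F (x, u, p, q) * h + (\<lambda>(k, l, m). pd_u F z * k + (pd_p F z * l + pd_q F z * m)) y)) (at (x, u, p, q))"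
  proof (rule has_derivative_prodI[where V = U and a = "pd_x F"])
    show "((\<lambda>x. F (x, y)) has_field_derivative pd_x F (x, y)) (at x)"
      if "(x, y) \<in> U" for x y
      using D[OF bounded_linear_dir(1) s(1), of "(0,y)" x] that by (cases y) (simp add: dir_defs pd_eq_dpd)
    show "isCont (pd_x F) (x, u, p, q)"
      unfolding pd_eq_dpd using z C[OF bounded_linear_dir(1) s(1)] by simp
  qed (use 3 z U in \<open>auto simp: case_prod_unfold\<close>)
  show "jd F z (pd_x F z) (pd_u F z) (pd_p F z) (pd_q F z)"
    unfolding jd_def using 4 by (simp add: case_prod_unfold add.assoc)
qed

lemma holomorphic_jet_pd:
  assumes "holomorphic_jet F U"
  shows "holomorphic_jet (pd_x F) U" "holomorphic_jet (pd_u F) U" "holomorphic_jet (pd_p F) U" "holomorphic_jet (pd_q F) U"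
proof -
  have U: "open U" using assms unfolding holomorphic_jet_def by blast
  note F = holomorphic_jet_continuous[OF assms] and s = holomorphic_jet_slice[OF assms]
  note b = bounded_linear_dir
  have "holomorphic_jet (dpd e F) U" if "bounded_linear e" "slice_hol e F U" for e
    by (intro holomorphic_jetI dpd_continuous slice_hol_dpd U F b s that)
  then show "holomorphic_jet (pd_x F) U" "holomorphic_jet (pd_u F) U" "holomorphic_jet (pd_p F) U" "holomorphic_jet (pd_q F) U"
    unfolding pd_eq_dpd using b s by blast+
qed

lemma jd_const: "jd (\<lambda>z. k) z 0 0 0 0"
  unfolding jd_def by (rule has_derivative_eq_rhs, rule has_derivative_const) auto

lemma jd_jet_p: "jd jet_p z 0 0 1 0" and jd_jet_q: "jd jet_q z 0 0 0 1"
proof -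
  have "bounded_linear (\<lambda>z::jet. fst (snd (snd z)))" "bounded_linear (\<lambda>z::jet. snd (snd (snd z)))"
    by (intro bounded_linear_intros)+
  from this[THEN bounded_linear_imp_has_derivative]
  show "jd jet_p z 0 0 1 0" "jd jet_q z 0 0 0 1"
    unfolding jd_def jet_p_def jet_q_def case_prod_unfold by simp_all
qed

lemma jd_add:
  assumes "jd F z a b c d" "jd G z a' b' c' d'"
  shows "jd (\<lambda>z. F z + G z) z (a + a') (b + b') (c + c') (d + d')"
  using has_derivative_add[OF assms[unfolded jd_def]] unfolding jd_def
  by (simp add: case_prod_unfold algebra_simps)

lemma jd_minus:
  assumes "jd F z a b c d"
  shows "jd (\<lambda>z. - F z) z (- a) (- b) (- c) (- d)"
  using has_derivative_minus[OF assms[unfolded jd_def]] unfolding jd_def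
  by (simp add: case_prod_unfold algebra_simps)

lemma jd_mult:
  assumes "jd F z a b c d" "jd G z a' b' c' d'"
  shows "jd (\<lambda>z. F z * G z) z (a * G z + F z * a') (b * G z + F z * b') (c * G z + F z * c') (d * G z + F z * d')"
  using has_derivative_mult[OF assms[unfolded jd_def]] unfolding jd_def
  by (simp add: case_prod_unfold algebra_simps)

lemma jd_compose:
  assumes "jd F z a b c d" "(h has_field_derivative k) (at (F z))"
  shows "jd (\<lambda>z. h (F z)) z (k * a) (k * b) (k * c) (k * d)"
  using has_derivative_compose[OF assms(1)[unfolded jd_def], of h "(*) k"] assms(2) unfolding jd_def has_field_derivative_def
  by (simp add: case_prod_unfold algebra_simps)

lemma jd_cong:
  assumes "jd G z a b c d" "open N" "z \<in> N" "\<And>z. z \<in> N \<Longrightarrow> F z = G z"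
  shows "jd F z a b c d"
  unfolding jd_def
  by (rule has_derivative_transform_within_open[OF assms(1)[unfolded jd_def] assms(2,3)]) (simp add: assms(4))

section \<open>Holomorphic functions on the plane\<close>

definition dir_1 :: "complex \<Rightarrow> plane" where "dir_1 t = (t, 0)"
definition dir_2 :: "complex \<Rightarrow> plane" where "dir_2 t = (0, t)"

definition pl_x :: "(plane \<Rightarrow> complex) \<Rightarrow> plane \<Rightarrow> complex" where "pl_x = dpd dir_1"
definition pl_u :: "(plane \<Rightarrow> complex) \<Rightarrow> plane \<Rightarrow> complex" where "pl_u = dpd dir_2"

lemma bounded_linear_dir_plane: "bounded_linear dir_1" "bounded_linear dir_2"
  unfolding dir_1_def dir_2_def
  by (intro bounded_linear_Pair bounded_linear_zero bounded_linear_ident)+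

definition pld :: "(plane \<Rightarrow> complex) \<Rightarrow> plane \<Rightarrow> complex \<Rightarrow> complex \<Rightarrow> bool" where
  "pld F w a b \<longleftrightarrow> (F has_derivative (\<lambda>(h, k). a * h + b * k)) (at w)"

lemma pld_slice:
  assumes "pld F w a b"
  shows "((\<lambda>t. F (w + dir_1 t)) has_field_derivative a) (at 0)"
    "((\<lambda>t. F (w + dir_2 t)) has_field_derivative b) (at 0)"
proof -
  have *: "((\<lambda>t. F (w + e t)) has_derivative (\<lambda>t. case e t of (h, k) \<Rightarrow> a * h + b * k)) (at 0)"
    if e: "bounded_linear e" for e
  proof -
    have "((\<lambda>t. w + e t) has_derivative (\<lambda>t. 0 + e t)) (at 0)"
      by (intro derivative_intros bounded_linear_imp_has_derivative e)
    moreover have "w + e 0 = w" using linear_0[OF bounded_linear.linear[OF e]] by simp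
    ultimately show ?thesis
      using has_derivative_compose[of "\<lambda>t. w + e t" e 0 UNIV F] assms
      unfolding pld_def by simp
  qed
  show "((\<lambda>t. F (w + dir_1 t)) has_field_derivative a) (at 0)"
    "((\<lambda>t. F (w + dir_2 t)) has_field_derivative b) (at 0)"
    using *[OF bounded_linear_dir_plane(1)] *[OF bounded_linear_dir_plane(2)]
    by (simp_all add: dir_1_def dir_2_def has_field_derivative_def mult_commute_abs)
qed

lemma pld_pl:
  assumes "pld F w a b" shows "pl_x F w = a" "pl_u F w = b"
  using pld_slice[OF assms] unfolding pl_x_def pl_u_def dpd_def by (simp_all add: DERIV_imp_deriv)

lemma holomorphic_plane_pld:
  "holomorphic_plane F D \<longleftrightarrow> open D \<and> (\<forall>w\<in>D. pld F w (pl_x F w) (pl_u F w))"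
proof -
  have "(\<exists>a b. pld F w a b) \<longleftrightarrow> pld F w (pl_x F w) (pl_u F w)" for w
    using pld_pl by metis
  then show ?thesis unfolding holomorphic_plane_def pld_def[symmetric] by simp
qed

lemma holomorphic_planeD:
  assumes "holomorphic_plane F D"
  shows "open D" "w \<in> D \<Longrightarrow> pld F w (pl_x F w) (pl_u F w)"
  using assms unfolding holomorphic_plane_pld by blast+

lemma holomorphic_plane_continuous:
  assumes "holomorphic_plane F D" shows "continuous_on D F"
proof (rule continuous_at_imp_continuous_on, rule ballI)
  fix w assume "w \<in> D"
  from holomorphic_planeD(2)[OF assms this]
  show "isCont F w" unfolding pld_def by (rule has_derivative_continuous)
qed

lemma holomorphic_plane_slice:
  assumes "holomorphic_plane F D"
  shows "slice_hol dir_1 F D" "slice_hol dir_2 F D"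
  using pld_slice[OF holomorphic_planeD(2)[OF assms], THEN DERIV_imp_field_differentiable]
  unfolding slice_hol_def by blast+

lemma holomorphic_planeI:
  assumes D: "open D" and F: "continuous_on D F"
    and s: "slice_hol dir_1 F D" "slice_hol dir_2 F D"
  shows "holomorphic_plane F D"
  unfolding holomorphic_plane_pld
proof (intro conjI D ballI)
  fix w assume w: "w \<in> D"
  obtain x u where [simp]: "w = (x, u)" by (cases w) auto
  have "((\<lambda>u. F (x, u)) has_field_derivative pl_u F w) (at u)"
    using slice_has_derivative[OF bounded_linear_dir_plane(2) s(2), of "(x,0)" u] w
    by (simp add: dir_2_def pl_u_def)
  then have 1: "((\<lambda>u. F (x, u)) has_derivative (\<lambda>m. pl_u F w * m)) (at u)"
    by (simp add: has_field_derivative_def)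
  have 2: "(F has_derivative (\<lambda>(h, k). pl_x F (x, u) * h + pl_u F w * k)) (at (x, u))"
  proof (rule has_derivative_prodI[where V = D and a = "pl_x F"])
    show "((\<lambda>x. F (x, y)) has_field_derivative pl_x F (x, y)) (at x)"
      if "(x, y) \<in> D" for x y
      using slice_has_derivative[OF bounded_linear_dir_plane(1) s(1), of "(0,y)" x] that
      by (simp add: dir_1_def pl_x_def)
    show "isCont (pl_x F) (x, u)"
      unfolding pl_x_def using w slice_isCont[OF bounded_linear_dir_plane(1) D F s(1)] by simp
  qed (use 1 w D in auto)
  then show "pld F w (pl_x F w) (pl_u F w)" unfolding pld_def by simp
qed

lemma holomorphic_plane_pl:
  assumes "holomorphic_plane F D"
  shows "holomorphic_plane (pl_x F) D" "holomorphic_plane (pl_u F) D"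
proof -
  note D = holomorphic_planeD(1)[OF assms]
  note F = holomorphic_plane_continuous[OF assms] and s = holomorphic_plane_slice[OF assms]
  note b = bounded_linear_dir_plane
  have "holomorphic_plane (dpd e F) D" if "bounded_linear e" "slice_hol e F D" for e
    by (intro holomorphic_planeI dpd_continuous slice_hol_dpd D F b s that)
  then show "holomorphic_plane (pl_x F) D" "holomorphic_plane (pl_u F) D"
    unfolding pl_x_def pl_u_def using b s by blast+
qed

lemma jd_on_jets:
  assumes "pld F (x, u) a b" shows "jd (on_jets F) (x, u, p, q) a b 0 0"
proof -
  have "((\<lambda>z::jet. (fst z, fst (snd z))) has_derivative (\<lambda>z. (fst z, fst (snd z)))) (at (x, u, p, q))"
    by (intro bounded_linear_imp_has_derivative bounded_linear_intros)
  from has_derivative_compose[OF this, of F "\<lambda>(h, k). a * h + b * k"] assms show ?thesis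
    unfolding jd_def pld_def on_jets_def by (simp add: case_prod_unfold)
qed

lemma holomorphic_jet_on_jets:
  assumes "holomorphic_plane F D" "open N" "\<And>z. z \<in> N \<Longrightarrow> (fst z, fst (snd z)) \<in> D"
  shows "holomorphic_jet (on_jets F) N"
  unfolding holomorphic_jet_jd
proof (intro conjI assms(2) ballI)
  fix z assume "z \<in> N"
  from jd_on_jets[OF holomorphic_planeD(2)[OF assms(1) assms(3)[OF this]], of "fst (snd (snd z))" "snd (snd (snd z))"]
  have "jd (on_jets F) z (pl_x F (fst z, fst (snd z))) (pl_u F (fst z, fst (snd z))) 0 0"
    by simp
  with jd_pd[OF this] show "jd (on_jets F) z (pd_x (on_jets F) z) (pd_u (on_jets F) z) (pd_p (on_jets F) z) (pd_q (on_jets F) z)"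
    by simp
qed

lemma pd_on_jets:
  "pd_x (on_jets F) = on_jets (pl_x F)" "pd_u (on_jets F) = on_jets (pl_u F)"
  "pd_p (on_jets F) = (\<lambda>z. 0)" "pd_q (on_jets F) = (\<lambda>z. 0)"
  unfolding pd_eq_dpd pl_x_def pl_u_def dpd_def dir_defs dir_1_def dir_2_def on_jets_def
  by (auto simp: fun_eq_iff)

section \<open>Calculus on an open set of jets\<close>

locale jet_region =
  fixes N :: "jet set"
  assumes open_N: "open N"
begin

abbreviation hol :: "(jet \<Rightarrow> complex) \<Rightarrow> bool" where "hol F \<equiv> holomorphic_jet F N"

lemma hol_jd: "hol F \<Longrightarrow> z \<in> N \<Longrightarrow> jd F z (pd_x F z) (pd_u F z) (pd_p F z) (pd_q F z)"
  unfolding holomorphic_jet_jd by blast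

lemma holI:
  assumes "\<And>z. z \<in> N \<Longrightarrow> jd F z (a z) (b z) (c z) (d z)"
  shows "hol F"
  unfolding holomorphic_jet_jd using open_N assms jd_pd[OF assms] by simp

lemma hol_const [simp, intro]: "hol (\<lambda>z. k)"
  and hol_jet_p [simp, intro]: "hol jet_p"
  and hol_jet_q [simp, intro]: "hol jet_q"
  by (rule holI, rule jd_const jd_jet_p jd_jet_q)+

lemma pd_const [simp]: "pd_x (\<lambda>z. k) z = 0" "pd_u (\<lambda>z. k) z = 0" "pd_p (\<lambda>z. k) z = 0" "pd_q (\<lambda>z. k) z = 0"
  using jd_pd[OF jd_const[of k]] by blast+

lemma pd_jet_p [simp]: "pd_x jet_p z = 0" "pd_u jet_p z = 0" "pd_p jet_p z = 1" "pd_q jet_p z = 0"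
  using jd_pd[OF jd_jet_p] by blast+

lemma pd_jet_q [simp]: "pd_x jet_q z = 0" "pd_u jet_q z = 0" "pd_p jet_q z = 0" "pd_q jet_q z = 1"
  using jd_pd[OF jd_jet_q] by blast+

lemma hol_pd [simp, intro]:
  assumes "hol F" shows "hol (pd_x F)" "hol (pd_u F)" "hol (pd_p F)" "hol (pd_q F)"
  using holomorphic_jet_pd[OF assms] by blast+

context
  fixes F G assumes F: "hol F" and G: "hol G"
begin

lemma hol_add [simp, intro]: "hol (\<lambda>z. F z + G z)"
  by (rule holI, rule jd_add; erule hol_jd[OF F] hol_jd[OF G])

lemma hol_mult [simp, intro]: "hol (\<lambda>z. F z * G z)"
  by (rule holI, rule jd_mult; erule hol_jd[OF F] hol_jd[OF G])

lemma pd_add: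
  assumes "z \<in> N"
  shows "pd_x (\<lambda>z. F z + G z) z = pd_x F z + pd_x G z" "pd_u (\<lambda>z. F z + G z) z = pd_u F z + pd_u G z"
    "pd_p (\<lambda>z. F z + G z) z = pd_p F z + pd_p G z" "pd_q (\<lambda>z. F z + G z) z = pd_q F z + pd_q G z"
  using jd_pd[OF jd_add[OF hol_jd[OF F assms] hol_jd[OF G assms]]] by simp_all

lemma pd_mult:
  assumes "z \<in> N"
  shows "pd_x (\<lambda>z. F z * G z) z = pd_x F z * G z + F z * pd_x G z"
    "pd_u (\<lambda>z. F z * G z) z = pd_u F z * G z + F z * pd_u G z"
    "pd_p (\<lambda>z. F z * G z) z = pd_p F z * G z + F z * pd_p G z"
    "pd_q (\<lambda>z. F z * G z) z = pd_q F z * G z + F z * pd_q G z"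
  using jd_pd[OF jd_mult[OF hol_jd[OF F assms] hol_jd[OF G assms]]] by simp_all

end

context
  fixes F :: "jet \<Rightarrow> complex" and h h' :: "complex \<Rightarrow> complex"
  assumes F: "hol F" and h: "\<And>z. z \<in> N \<Longrightarrow> (h has_field_derivative h' (F z)) (at (F z))"
begin

lemma hol_compose: "hol (\<lambda>z. h (F z))"
  by (rule holI, rule jd_compose; (erule hol_jd[OF F] h))

lemma pd_compose:
  assumes "z \<in> N"
  shows "pd_x (\<lambda>z. h (F z)) z = h' (F z) * pd_x F z" "pd_u (\<lambda>z. h (F z)) z = h' (F z) * pd_u F z"
    "pd_p (\<lambda>z. h (F z)) z = h' (F z) * pd_p F z" "pd_q (\<lambda>z. h (F z)) z = h' (F z) * pd_q F z"
  using jd_pd[OF jd_compose[OF hol_jd[OF F assms] h[OF assms]]] by simp_all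

end

context
  fixes F assumes F: "hol F"
begin

lemma hol_minus [simp, intro]: "hol (\<lambda>z. - F z)"
  by (rule holI, rule jd_minus; erule hol_jd[OF F])

lemma pd_minus:
  assumes "z \<in> N"
  shows "pd_x (\<lambda>z. - F z) z = - pd_x F z" "pd_u (\<lambda>z. - F z) z = - pd_u F z"
    "pd_p (\<lambda>z. - F z) z = - pd_p F z" "pd_q (\<lambda>z. - F z) z = - pd_q F z"
  using jd_pd[OF jd_minus[OF hol_jd[OF F assms]]] by simp_all

lemma DERIV_nat_power: "((\<lambda>w::complex. w ^ n) has_field_derivative of_nat n * w ^ (n - 1)) (at w)"
  by (auto intro!: derivative_eq_intros)

lemma hol_power [simp, intro]: "hol (\<lambda>z. F z ^ n)"
  using hol_compose[OF F DERIV_nat_power] .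

lemma pd_power:
  assumes "z \<in> N"
  shows "pd_x (\<lambda>z. F z ^ n) z = of_nat n * F z ^ (n - 1) * pd_x F z"
    "pd_u (\<lambda>z. F z ^ n) z = of_nat n * F z ^ (n - 1) * pd_u F z"
    "pd_p (\<lambda>z. F z ^ n) z = of_nat n * F z ^ (n - 1) * pd_p F z"
    "pd_q (\<lambda>z. F z ^ n) z = of_nat n * F z ^ (n - 1) * pd_q F z"
  using pd_compose[OF F DERIV_nat_power[of n] assms] by blast+

lemma hol_inverse:
  assumes nz: "\<And>z. z \<in> N \<Longrightarrow> F z \<noteq> 0"
  shows "hol (\<lambda>z. inverse (F z))"
  by (rule hol_compose[OF F, where h' = "\<lambda>w. - inverse (w ^ 2)"])
     (auto intro!: derivative_eq_intros simp: nz field_simps power2_eq_square)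

lemma pd_inverse:
  assumes nz: "\<And>z. z \<in> N \<Longrightarrow> F z \<noteq> 0" and z: "z \<in> N"
  shows "pd_x (\<lambda>z. inverse (F z)) z = - inverse ((F z)^2) * pd_x F z"
    "pd_u (\<lambda>z. inverse (F z)) z = - inverse ((F z)^2) * pd_u F z"
    "pd_p (\<lambda>z. inverse (F z)) z = - inverse ((F z)^2) * pd_p F z"
    "pd_q (\<lambda>z. inverse (F z)) z = - inverse ((F z)^2) * pd_q F z"
  by (rule pd_compose[OF F _ z, where h' = "\<lambda>w. - inverse (w ^ 2)"];
      auto intro!: derivative_eq_intros simp: nz field_simps power2_eq_square)+

end

context
  fixes F G assumes F: "hol F" and G: "hol G"
begin

lemma hol_diff [simp, intro]: "hol (\<lambda>z. F z - G z)"
  unfolding diff_conv_add_uminus by (intro hol_add hol_minus F G)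

lemma pd_diff:
  assumes "z \<in> N"
  shows "pd_x (\<lambda>z. F z - G z) z = pd_x F z - pd_x G z" "pd_u (\<lambda>z. F z - G z) z = pd_u F z - pd_u G z"
    "pd_p (\<lambda>z. F z - G z) z = pd_p F z - pd_p G z" "pd_q (\<lambda>z. F z - G z) z = pd_q F z - pd_q G z"
  using pd_add[OF F hol_minus[OF G] assms] by (simp_all add: pd_minus G assms)

lemma hol_divide [simp, intro]:
  assumes "\<And>z. z \<in> N \<Longrightarrow> G z \<noteq> 0" shows "hol (\<lambda>z. F z / G z)"
  unfolding divide_inverse by (intro hol_mult hol_inverse F G assms)

lemma pd_divide:
  assumes nz: "\<And>z. z \<in> N \<Longrightarrow> G z \<noteq> 0" and z: "z \<in> N"
  shows "pd_x (\<lambda>z. F z / G z) z = pd_x F z / G z - F z * pd_x G z / (G z)^2"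
    "pd_u (\<lambda>z. F z / G z) z = pd_u F z / G z - F z * pd_u G z / (G z)^2"
    "pd_p (\<lambda>z. F z / G z) z = pd_p F z / G z - F z * pd_p G z / (G z)^2"
    "pd_q (\<lambda>z. F z / G z) z = pd_q F z / G z - F z * pd_q G z / (G z)^2"
  unfolding divide_inverse
  by (simp_all add: pd_mult F hol_inverse[OF G nz] z pd_inverse[OF G nz z])

end

lemma hol_divide_const [simp, intro]: "hol F \<Longrightarrow> hol (\<lambda>z. F z / k)"
  unfolding divide_inverse by (intro hol_mult hol_const)

lemma pd_divide_const:
  assumes "hol F" "z \<in> N"
  shows "pd_x (\<lambda>z. F z / k) z = pd_x F z / k" "pd_u (\<lambda>z. F z / k) z = pd_u F z / k"
    "pd_p (\<lambda>z. F z / k) z = pd_p F z / k" "pd_q (\<lambda>z. F z / k) z = pd_q F z / k"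
  unfolding divide_inverse using pd_mult[OF assms(1) hol_const assms(2)] by simp_all

lemma hol_cong:
  assumes "\<And>z. z \<in> N \<Longrightarrow> F z = G z" "hol G" shows "hol F"
  by (rule holI, rule jd_cong[OF hol_jd[OF assms(2)] open_N _ assms(1)])

lemma pd_cong:
  assumes "\<And>z. z \<in> N \<Longrightarrow> F z = G z" "hol G" "z \<in> N"
  shows "pd_x F z = pd_x G z" "pd_u F z = pd_u G z" "pd_p F z = pd_p G z" "pd_q F z = pd_q G z"
  using jd_pd[OF jd_cong[OF hol_jd[OF assms(2,3)] open_N assms(3,1)]] by blast+

lemma pd_zero:
  assumes "\<And>z. z \<in> N \<Longrightarrow> F z = 0" "z \<in> N"
  shows "pd_x F z = 0" "pd_u F z = 0" "pd_p F z = 0" "pd_q F z = 0"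
  using pd_cong[of F "\<lambda>z. 0" z] assms by simp_all

lemma pd_commute:
  assumes F: "hol F" and z: "z \<in> N"
  shows "pd_u (pd_x F) z = pd_x (pd_u F) z" "pd_p (pd_x F) z = pd_x (pd_p F) z" "pd_q (pd_x F) z = pd_x (pd_q F) z"
    "pd_p (pd_u F) z = pd_u (pd_p F) z" "pd_q (pd_u F) z = pd_u (pd_q F) z" "pd_q (pd_p F) z = pd_p (pd_q F) z"
  unfolding pd_eq_dpd
  by (rule dpd_commute[OF bounded_linear_dir(1) bounded_linear_dir(2) open_N holomorphic_jet_continuous[OF F] holomorphic_jet_slice(1)[OF F] holomorphic_jet_slice(2)[OF F] z]
    dpd_commute[OF bounded_linear_dir(1) bounded_linear_dir(3) open_N holomorphic_jet_continuous[OF F] holomorphic_jet_slice(1)[OF F] holomorphic_jet_slice(3)[OF F] z]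
    dpd_commute[OF bounded_linear_dir(1) bounded_linear_dir(4) open_N holomorphic_jet_continuous[OF F] holomorphic_jet_slice(1)[OF F] holomorphic_jet_slice(4)[OF F] z]
    dpd_commute[OF bounded_linear_dir(2) bounded_linear_dir(3) open_N holomorphic_jet_continuous[OF F] holomorphic_jet_slice(2)[OF F] holomorphic_jet_slice(3)[OF F] z]
    dpd_commute[OF bounded_linear_dir(2) bounded_linear_dir(4) open_N holomorphic_jet_continuous[OF F] holomorphic_jet_slice(2)[OF F] holomorphic_jet_slice(4)[OF F] z]
    dpd_commute[OF bounded_linear_dir(3) bounded_linear_dir(4) open_N holomorphic_jet_continuous[OF F] holomorphic_jet_slice(3)[OF F] holomorphic_jet_slice(4)[OF F] z])+

lemmas pd_rules = pd_add pd_diff pd_mult pd_minus pd_power pd_divide_const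

end

locale jet_ode = jet_region +
  fixes f :: "jet \<Rightarrow> complex"
  assumes hol_f [simp, intro]: "hol f"
begin

abbreviation D :: "(jet \<Rightarrow> complex) \<Rightarrow> jet \<Rightarrow> complex" where "D \<equiv> Dhat f"

lemma D_eq: "D F = (\<lambda>z. pd_x F z + jet_p z * pd_u F z + jet_q z * pd_p F z + f z * pd_q F z)"
  by (simp add: fun_eq_iff Dhat_def total_deriv_def)

lemma hol_D [simp, intro]: "hol F \<Longrightarrow> hol (D F)"
  unfolding D_eq by simp

lemma D_const [simp]: "D (\<lambda>z. k) z = 0"
  unfolding D_eq by simp

lemma D_rules:
  assumes "z \<in> N"
  shows "hol F \<Longrightarrow> hol G \<Longrightarrow> D (\<lambda>z. F z + G z) z = D F z + D G z"
    "hol F \<Longrightarrow> hol G \<Longrightarrow> D (\<lambda>z. F z - G z) z = D F z - D G z"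
    "hol F \<Longrightarrow> hol G \<Longrightarrow> D (\<lambda>z. F z * G z) z = D F z * G z + F z * D G z"
    "hol F \<Longrightarrow> D (\<lambda>z. - F z) z = - D F z"
    "hol F \<Longrightarrow> D (\<lambda>z. F z ^ n) z = of_nat n * F z ^ (n - 1) * D F z"
    "hol F \<Longrightarrow> D (\<lambda>z. F z / k) z = D F z / k"
  using assms unfolding D_eq by (simp_all add: pd_rules algebra_simps add_divide_distrib)

lemma D_divide:
  assumes "hol F" "hol G" "\<And>z. z \<in> N \<Longrightarrow> G z \<noteq> 0" "z \<in> N"
  shows "D (\<lambda>z. F z / G z) z = D F z / G z - F z * D G z / (G z)^2"
  unfolding D_eq by (simp only: pd_divide[OF assms]) (simp add: algebra_simps add_divide_distrib)

lemma D_compose: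
  assumes "hol F" "\<And>z. z \<in> N \<Longrightarrow> (h has_field_derivative h' (F z)) (at (F z))" "z \<in> N"
  shows "D (\<lambda>z. h (F z)) z = h' (F z) * D F z"
  unfolding D_eq by (simp only: pd_compose[OF assms]) (simp add: algebra_simps)

lemma D_cong:
  assumes "\<And>z. z \<in> N \<Longrightarrow> F z = G z" "hol G" "z \<in> N"
  shows "D F z = D G z"
  unfolding D_eq by (simp only: pd_cong[OF assms])

lemma D_zero: "(\<And>z. z \<in> N \<Longrightarrow> F z = 0) \<Longrightarrow> z \<in> N \<Longrightarrow> D F z = 0"
  using D_cong[of F "\<lambda>z. 0" z] by simp

text \<open>
  The commutators of the vertical fields with \<open>D = \<partial>\<^sub>x + p \<partial>\<^sub>u + q \<partial>\<^sub>p + f \<partial>\<^sub>q\<close>: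
  \<open>[\<partial>\<^sub>q, D] = \<partial>\<^sub>p + f\<^sub>q \<partial>\<^sub>q\<close>, \<open>[\<partial>\<^sub>p, D] = \<partial>\<^sub>u + f\<^sub>p \<partial>\<^sub>q\<close>, \<open>[\<partial>\<^sub>u, D] = f\<^sub>u \<partial>\<^sub>q\<close>. All later computations
  with the invariants reduce to these three relations.
\<close>
lemma pd_D:
  assumes F: "hol F" and z: "z \<in> N"
  shows "pd_q (D F) z = D (pd_q F) z + pd_p F z + pd_q f z * pd_q F z"
    "pd_p (D F) z = D (pd_p F) z + pd_u F z + pd_p f z * pd_q F z"
    "pd_u (D F) z = D (pd_u F) z + pd_u f z * pd_q F z"
  unfolding D_eq using F z by (simp_all add: pd_rules pd_commute algebra_simps)

end

section \<open>The Schwarzian derivative along solutions\<close>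

text \<open>
  For a function \<open>\<omega>\<close> of \<open>(x, u)\<close> one has \<open>\<partial>\<^sub>p (D \<omega>) = \<omega>\<^sub>u\<close>; hence \<open>ld_p\<close> and \<open>ld_D\<close> are the
  logarithmic derivatives of the speed \<open>D \<omega>\<close> with respect to \<open>p\<close> and along solutions, and \<open>schwarzian\<close> is
  the Schwarzian derivative of \<open>\<omega>\<close> along solutions.
\<close>
definition ld_p :: "(jet \<Rightarrow> complex) \<Rightarrow> (jet \<Rightarrow> complex) \<Rightarrow> jet \<Rightarrow> complex" where
  "ld_p f \<omega> z = pd_u \<omega> z / Dhat f \<omega> z"
definition ld_D :: "(jet \<Rightarrow> complex) \<Rightarrow> (jet \<Rightarrow> complex) \<Rightarrow> jet \<Rightarrow> complex" where
  "ld_D f \<omega> z = Dhat f (Dhat f \<omega>) z / Dhat f \<omega> z"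
definition schwarzian :: "(jet \<Rightarrow> complex) \<Rightarrow> (jet \<Rightarrow> complex) \<Rightarrow> jet \<Rightarrow> complex" where
  "schwarzian f \<omega> z = Dhat f (ld_D f \<omega>) z - (ld_D f \<omega> z)^2 / 2"

locale jet_coordinate = jet_ode +
  fixes \<omega> :: "jet \<Rightarrow> complex"
  assumes hol_omega [simp, intro]: "hol \<omega>"
    and omega_p: "\<And>z. z \<in> N \<Longrightarrow> pd_p \<omega> z = 0" and omega_q: "\<And>z. z \<in> N \<Longrightarrow> pd_q \<omega> z = 0"
    and speed_nonzero: "\<And>z. z \<in> N \<Longrightarrow> D \<omega> z \<noteq> 0"
begin

abbreviation "B \<equiv> D \<omega>"
abbreviation "\<beta> \<equiv> ld_p f \<omega>"
abbreviation "Y \<equiv> ld_D f \<omega>"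
abbreviation "s \<equiv> schwarzian f \<omega>"

lemma beta_eq: "\<beta> = (\<lambda>z. pd_u \<omega> z / B z)" and Y_eq: "Y = (\<lambda>z. D B z / B z)"
  and s_eq: "s = (\<lambda>z. D Y z - (Y z)^2 / 2)"
  by (simp_all add: fun_eq_iff ld_p_def ld_D_def schwarzian_def)

lemma hol_coord [simp, intro]: "hol \<beta>" "hol Y" "hol s"
proof -
  show b: "hol \<beta>" "hol Y" unfolding beta_eq Y_eq by (simp_all add: speed_nonzero)
  then show "hol s" unfolding s_eq by simp
qed

lemma pd_omega_u:
  assumes "z \<in> N"
  shows "pd_p (pd_u \<omega>) z = 0" "pd_q (pd_u \<omega>) z = 0"
  using pd_commute[OF hol_omega assms] pd_zero(2)[OF omega_p assms] pd_zero(2)[OF omega_q assms] by simp_all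

lemma pd_speed:
  assumes "z \<in> N"
  shows "pd_q B z = 0" "pd_p B z = pd_u \<omega> z" "pd_u B z = D (pd_u \<omega>) z"
  using pd_D[OF hol_omega assms] D_zero[OF omega_p assms] D_zero[OF omega_q assms] omega_p omega_q assms by simp_all

lemma D_pd_speed:
  assumes "z \<in> N"
  shows "D (pd_q B) z = 0" "D (pd_p B) z = pd_u B z"
  using D_zero[OF pd_speed(1) assms] D_cong[OF pd_speed(2) _ assms] pd_speed(3)[OF assms] by simp_all

text \<open>
  Both sides are \<open>D \<omega>\<^sub>u / D \<omega>\<close>: on the left \<open>\<partial>\<^sub>u\<close> commutes past \<open>D\<close> as \<open>\<omega>\<^sub>q = 0\<close>, on the right
  \<open>\<omega>\<^sub>u = \<beta> D \<omega>\<close>.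
\<close>
lemma pd_u_speed: "z \<in> N \<Longrightarrow> pd_u B z / B z = D \<beta> z + \<beta> z * Y z"
  unfolding beta_eq Y_eq
  by (simp add: D_divide speed_nonzero pd_speed power2_eq_square)

lemma pd_beta:
  assumes "z \<in> N"
  shows "pd_q \<beta> z = 0" "pd_p \<beta> z = - ((\<beta> z)^2)"
  unfolding beta_eq
  using assms by (simp_all add: pd_divide speed_nonzero pd_speed pd_omega_u power2_eq_square)

lemma pd_Y:
  assumes z: "z \<in> N"
  shows "pd_q Y z = \<beta> z" "pd_p Y z = 2 * D \<beta> z + \<beta> z * Y z"
    "pd_u Y z = D (D \<beta>) z + D \<beta> z * Y z + \<beta> z * D Y z"
proof -
  have BB: "pd_q (D B) z = pd_u \<omega> z" "pd_p (D B) z = 2 * pd_u B z" "pd_u (D B) z = D (pd_u B) z"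
    using pd_D[of B z] z by (simp_all add: pd_speed D_pd_speed)
  show "pd_q Y z = \<beta> z"
    unfolding Y_eq beta_eq using z by (simp add: pd_divide speed_nonzero BB pd_speed)
  have "pd_p Y z = 2 * (pd_u B z / B z) - \<beta> z * Y z"
    unfolding Y_eq beta_eq using z by (simp add: pd_divide speed_nonzero BB pd_speed power2_eq_square)
  then show "pd_p Y z = 2 * D \<beta> z + \<beta> z * Y z" using z by (simp add: pd_u_speed)
  have "pd_u Y z = D (\<lambda>z. pd_u B z / B z) z"
    unfolding Y_eq using z by (simp add: pd_divide D_divide speed_nonzero BB)
  also have "\<dots> = D (\<lambda>z. D \<beta> z + \<beta> z * Y z) z"
    by (rule D_cong[OF pd_u_speed _ z]) auto
  finally show "pd_u Y z = D (D \<beta>) z + D \<beta> z * Y z + \<beta> z * D Y z"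
    using z by (simp add: D_rules)
qed

text \<open>
  An infinitesimal displacement \<open>v\<close> of a solution changes \<open>\<omega>\<close> along it by \<open>\<omega>\<^sub>u v = \<beta> v D\<omega>\<close>, and
  hence its Schwarzian derivative by \<open>(\<beta> v)''' + 2 s (\<beta> v)' + s' \<beta> v\<close>. When \<open>v'''\<close> is replaced
  according to the linearised equation \<open>v''' = f\<^sub>q v'' + f\<^sub>p v' + f\<^sub>u v\<close>, the coefficients of
  \<open>v''\<close>, \<open>v'\<close>, \<open>v\<close> are the derivatives of \<open>s\<close> in \<open>q\<close>, \<open>p\<close>, \<open>u\<close>.
\<close>
lemma pd_schwarzian:
  assumes z: "z \<in> N"
  shows "pd_q s z = 3 * D \<beta> z + pd_q f z * \<beta> z"
    "pd_p s z = 3 * D (D \<beta>) z + 2 * s z * \<beta> z + pd_p f z * \<beta> z"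
    "pd_u s z = D (D (D \<beta>)) z + 2 * s z * D \<beta> z + D s z * \<beta> z + pd_u f z * \<beta> z"
proof -
  have D1: "D (pd_q Y) z = D \<beta> z"
    by (rule D_cong[OF pd_Y(1) _ z]) auto
  have D2: "D (pd_p Y) z = 2 * D (D \<beta>) z + D \<beta> z * Y z + \<beta> z * D Y z"
    using D_cong[OF pd_Y(2) _ z] z by (simp add: D_rules)
  have D3: "D (pd_u Y) z = D (D (D \<beta>)) z + D (D \<beta>) z * Y z + 2 * D \<beta> z * D Y z + \<beta> z * D (D Y) z"
    using D_cong[OF pd_Y(3) _ z] z by (simp add: D_rules)
  have s2: "pd_q (\<lambda>z. D Y z - (Y z)^2 / 2) z = pd_q (D Y) z - Y z * pd_q Y z"
    "pd_p (\<lambda>z. D Y z - (Y z)^2 / 2) z = pd_p (D Y) z - Y z * pd_p Y z"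
    "pd_u (\<lambda>z. D Y z - (Y z)^2 / 2) z = pd_u (D Y) z - Y z * pd_u Y z"
    "D (\<lambda>z. D Y z - (Y z)^2 / 2) z = D (D Y) z - Y z * D Y z"
    using z by (simp_all add: pd_rules pd_divide D_rules D_divide)
  show "pd_q s z = 3 * D \<beta> z + pd_q f z * \<beta> z"
    unfolding s_eq s2 using pd_D(1)[of Y z] z by (simp add: D1 pd_Y algebra_simps)
  show "pd_p s z = 3 * D (D \<beta>) z + 2 * s z * \<beta> z + pd_p f z * \<beta> z"
    unfolding s_eq s2 using pd_D(2)[of Y z] z by (simp add: D2 pd_Y algebra_simps power2_eq_square)
  show "pd_u s z = D (D (D \<beta>)) z + 2 * s z * D \<beta> z + D s z * \<beta> z + pd_u f z * \<beta> z"
    unfolding s_eq s2 using pd_D(3)[of Y z] z by (simp add: D3 pd_Y algebra_simps power2_eq_square)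
qed

end

section \<open>Pairs of coordinates and their prolongation\<close>

locale coordinate_pair = jet_ode N f + first: jet_coordinate N f \<phi> + second: jet_coordinate N f \<psi>
  for N f \<phi> \<psi> +
  assumes jacobian_nonzero:
    "\<And>z. z \<in> N \<Longrightarrow> pd_x \<phi> z * pd_u \<psi> z - pd_u \<phi> z * pd_x \<psi> z \<noteq> 0"
begin

abbreviation "A \<equiv> D \<phi>"
abbreviation "B \<equiv> D \<psi>"
abbreviation "\<alpha> \<equiv> ld_p f \<phi>"
abbreviation "\<beta> \<equiv> ld_p f \<psi>"
definition "\<delta> z = \<beta> z - \<alpha> z"
definition "\<gamma> z = \<alpha> z + \<beta> z"

lemma delta_eq: "\<delta> = (\<lambda>z. \<beta> z - \<alpha> z)" and gamma_eq: "\<gamma> = (\<lambda>z. \<alpha> z + \<beta> z)"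
  by (simp_all add: fun_eq_iff \<delta>_def \<gamma>_def)

lemma hol_delta [simp, intro]: "hol \<delta>" and hol_gamma [simp, intro]: "hol \<gamma>"
  unfolding delta_eq gamma_eq by simp_all

lemma speed_eq:
  assumes "z \<in> N"
  shows "A z = pd_x \<phi> z + jet_p z * pd_u \<phi> z" "B z = pd_x \<psi> z + jet_p z * pd_u \<psi> z"
  using assms by (simp_all add: D_eq first.omega_p first.omega_q second.omega_p second.omega_q)

text \<open>
  The determinant of the two linear functions \<open>A\<close> and \<open>B\<close> of \<open>p\<close> is the Jacobian.
\<close>
lemma delta_jacobian:
  assumes "z \<in> N"
  shows "\<delta> z = (pd_x \<phi> z * pd_u \<psi> z - pd_u \<phi> z * pd_x \<psi> z) / (A z * B z)"
proof -
  have "\<delta> z = (pd_u \<psi> z * A z - pd_u \<phi> z * B z) / (A z * B z)"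
    using first.speed_nonzero[OF assms] second.speed_nonzero[OF assms]
    by (simp add: \<delta>_def ld_p_def field_simps)
  also have "pd_u \<psi> z * A z - pd_u \<phi> z * B z = pd_x \<phi> z * pd_u \<psi> z - pd_u \<phi> z * pd_x \<psi> z"
    by (simp add: speed_eq assms algebra_simps)
  finally show ?thesis .
qed

lemma delta_nonzero: "z \<in> N \<Longrightarrow> \<delta> z \<noteq> 0"
  using delta_jacobian jacobian_nonzero first.speed_nonzero second.speed_nonzero by simp

lemma pd_delta:
  assumes "z \<in> N"
  shows "pd_q \<delta> z = 0" "pd_p \<delta> z = - \<gamma> z * \<delta> z"
  using assms unfolding delta_eq gamma_eq
  by (simp_all add: pd_rules first.pd_beta second.pd_beta power2_eq_square algebra_simps)

lemma pd_gamma: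
  assumes "z \<in> N"
  shows "pd_q \<gamma> z = 0" "pd_p \<gamma> z = - ((\<alpha> z)^2 + (\<beta> z)^2)"
  using assms unfolding delta_eq gamma_eq
  by (simp_all add: pd_rules first.pd_beta second.pd_beta power2_eq_square algebra_simps)

lemma D_delta:
  assumes "z \<in> N"
  shows "D \<delta> z = D \<beta> z - D \<alpha> z" "D (D \<delta>) z = D (D \<beta>) z - D (D \<alpha>) z"
    "D (D (D \<delta>)) z = D (D (D \<beta>)) z - D (D (D \<alpha>)) z"
proof -
  have 1: "D \<delta> z = D \<beta> z - D \<alpha> z" if "z \<in> N" for z
    unfolding delta_eq using that by (simp add: D_rules)
  have 2: "D (D \<delta>) z = D (D \<beta>) z - D (D \<alpha>) z" if "z \<in> N" for z
    using D_cong[OF 1 _ that] that by (simp add: D_rules)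
  have 3: "D (D (D \<delta>)) z = D (D (D \<beta>)) z - D (D (D \<alpha>)) z" if "z \<in> N" for z
    using D_cong[OF 2 _ that] that by (simp add: D_rules)
  show "D \<delta> z = D \<beta> z - D \<alpha> z" "D (D \<delta>) z = D (D \<beta>) z - D (D \<alpha>) z"
    "D (D (D \<delta>)) z = D (D (D \<beta>)) z - D (D (D \<alpha>)) z"
    using 1 2 3 assms by blast+
qed

text \<open>
  \<open>P\<close> and \<open>Q\<close> are the transformed first and second derivatives \<open>d\<psi> / d\<phi>\<close> and \<open>d\<^sup>2\<psi> / d\<phi>\<^sup>2\<close>.
\<close>
definition "P z = B z / A z"
lemma P_eq: "P = (\<lambda>z. B z / A z)" by (simp add: fun_eq_iff P_def)
lemma hol_P [simp, intro]: "hol P" unfolding P_eq by (simp add: first.speed_nonzero)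
lemma P_nonzero: "z \<in> N \<Longrightarrow> P z \<noteq> 0" by (simp add: P_def first.speed_nonzero second.speed_nonzero)

lemma D_P: "z \<in> N \<Longrightarrow> D P z = P z * (ld_D f \<psi> z - ld_D f \<phi> z)"
  unfolding P_eq by (simp add: D_divide first.speed_nonzero second.speed_nonzero ld_D_def power2_eq_square field_simps)

lemma total_deriv_low_q: "pd_q F z = 0 \<Longrightarrow> total_deriv_low F z = D F z"
  by (simp add: total_deriv_low_def D_eq)

lemma pd_q_P: "z \<in> N \<Longrightarrow> pd_q P z = 0"
  unfolding P_eq by (simp add: pd_divide first.speed_nonzero first.pd_speed second.pd_speed)

definition "Q z = D P z / A z"
lemma Q_eq: "z \<in> N \<Longrightarrow> Q z = P z * (ld_D f \<psi> z - ld_D f \<phi> z) / A z"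
  by (simp add: Q_def D_P)

lemma hol_Q [simp, intro]: "hol Q"
  by (rule hol_cong[OF Q_eq]) (auto simp: first.speed_nonzero)

lemma DA: "z \<in> N \<Longrightarrow> D A z = ld_D f \<phi> z * A z" by (simp add: ld_D_def first.speed_nonzero)

lemma D_Q:
  assumes z: "z \<in> N"
  shows "D Q z = P z / A z * ((ld_D f \<psi> z - ld_D f \<phi> z)^2 + (D (ld_D f \<psi>) z - D (ld_D f \<phi>) z)
     - ld_D f \<phi> z * (ld_D f \<psi> z - ld_D f \<phi> z))"
proof -
  have "D Q z = D (\<lambda>z. P z * (ld_D f \<psi> z - ld_D f \<phi> z) / A z) z"
    by (rule D_cong[OF Q_eq _ z]) (auto simp: first.speed_nonzero)
  also have "\<dots> = P z / A z * ((ld_D f \<psi> z - ld_D f \<phi> z)^2 + (D (ld_D f \<psi>) z - D (ld_D f \<phi>) z)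
     - ld_D f \<phi> z * (ld_D f \<psi> z - ld_D f \<phi> z))"
    using z first.speed_nonzero[OF z]
    by (simp add: D_divide D_rules first.speed_nonzero D_P DA power2_eq_square field_simps)
  finally show ?thesis .
qed

lemma pd_q_Q:
  assumes z: "z \<in> N"
  shows "pd_q Q z = P z * \<delta> z / A z"
proof -
  have "pd_q Q z = pd_q (\<lambda>z. P z * (ld_D f \<psi> z - ld_D f \<phi> z) / A z) z"
    by (rule pd_cong[OF Q_eq _ z]) (auto simp: first.speed_nonzero)
  also have "\<dots> = P z * \<delta> z / A z"
    using z first.speed_nonzero[OF z]
    by (simp add: pd_divide pd_rules first.speed_nonzero first.pd_speed second.pd_speed pd_q_P first.pd_Y second.pd_Y \<delta>_def)
  finally show ?thesis .
qed

text \<open>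
  The chain rule for Schwarzian derivatives, \<open>{\<psi>, \<phi>} (D\<phi>)\<^sup>2 = S(\<psi>) - S(\<phi>)\<close>: the quantity on the
  left of the second equation is the transformed \<open>u'''\<close> minus \<open>3/2 Q\<^sup>2 / P\<close>, that is
  \<open>P {\<psi>, \<phi>}\<close>. The last summand is the dependence of \<open>S(\<psi>) - S(\<phi>)\<close> on the third derivative, which is kept free as \<open>r\<close>.
\<close>
lemma prolongation:
  assumes \<phi>: "\<phi> = on_jets \<phi>0" and \<psi>: "\<psi> = on_jets \<psi>0" and z: "z \<in> N"
  shows "prol_jet \<phi>0 \<psi>0 z = (\<phi> z, \<psi> z, P z, Q z)"
    "prol_r \<phi>0 \<psi>0 z r - canonical_rhs (prol_jet \<phi>0 \<psi>0 z)
       = P z / (A z)^2 * (schwarzian f \<psi> z - schwarzian f \<phi> z + (r - f z) * \<delta> z)"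
proof -
  have low: "total_deriv_low \<phi> z = A z" "total_deriv_low \<psi> z = B z" if "z \<in> N" for z
    using that by (auto intro!: total_deriv_low_q simp: first.omega_q second.omega_q)
  have p: "prol_p \<phi>0 \<psi>0 z = P z" if "z \<in> N" for z
    using low[OF that] unfolding prol_p_def by (simp add: P_def \<phi>[symmetric] \<psi>[symmetric])
  have q: "prol_q \<phi>0 \<psi>0 z = Q z" if z: "z \<in> N" for z
  proof -
    have "total_deriv_low (prol_p \<phi>0 \<psi>0) z = total_deriv_low P z"
      unfolding total_deriv_low_def using pd_cong[OF p _ z] by simp
    then show ?thesis
      using low[OF z] unfolding prol_q_def Q_def by (simp add: total_deriv_low_q pd_q_P z \<phi>[symmetric])
  qed
  show j: "prol_jet \<phi>0 \<psi>0 z = (\<phi> z, \<psi> z, P z, Q z)"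
    using p q z by (simp add: prol_jet_def \<phi>[symmetric] \<psi>[symmetric])
  have "total_deriv r (prol_q \<phi>0 \<psi>0) z = D Q z + (r - f z) * pd_q Q z"
    unfolding total_deriv_def D_eq using pd_cong[OF q _ z] by (simp add: algebra_simps)
  then have "prol_r \<phi>0 \<psi>0 z r = (D Q z + (r - f z) * pd_q Q z) / A z"
    using low[OF z] by (simp add: prol_r_def \<phi>[symmetric])
  moreover have "canonical_rhs (prol_jet \<phi>0 \<psi>0 z) = 3/2 * (Q z)^2 / P z"
    unfolding j canonical_rhs_def by (simp add: jet_p_def jet_q_def)
  moreover have "(p / a * (w^2 + e - x * w) + t * (p * d / a)) / a - 3/2 * (p * w / a)^2 / p
      = p / a^2 * (e - x * w - w^2 / 2 + t * d)" if "a \<noteq> 0" "p \<noteq> 0" for p a w e x t d :: complex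
    using that by (simp add: power2_eq_square field_simps)
  note this[OF first.speed_nonzero[OF z] P_nonzero[OF z]]
  ultimately have "prol_r \<phi>0 \<psi>0 z r - canonical_rhs (prol_jet \<phi>0 \<psi>0 z)
       = P z / (A z)^2 * ((D (ld_D f \<psi>) z - D (ld_D f \<phi>) z) - ld_D f \<phi> z * (ld_D f \<psi> z - ld_D f \<phi> z)
          - (ld_D f \<psi> z - ld_D f \<phi> z)^2 / 2 + (r - f z) * \<delta> z)"
    by (simp only: D_Q[OF z] pd_q_Q[OF z] Q_eq[OF z])
  moreover have "(D (ld_D f \<psi>) z - D (ld_D f \<phi>) z) - ld_D f \<phi> z * (ld_D f \<psi> z - ld_D f \<phi> z)
          - (ld_D f \<psi> z - ld_D f \<phi> z)^2 / 2 = schwarzian f \<psi> z - schwarzian f \<phi> z"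
    by (simp add: schwarzian_def power2_eq_square field_simps)
  ultimately show "prol_r \<phi>0 \<psi>0 z r - canonical_rhs (prol_jet \<phi>0 \<psi>0 z)
       = P z / (A z)^2 * (schwarzian f \<psi> z - schwarzian f \<phi> z + (r - f z) * \<delta> z)"
    by simp
qed

lemma prolongation_iff:
  assumes "\<phi> = on_jets \<phi>0" "\<psi> = on_jets \<psi>0" "z \<in> N"
  shows "(\<forall>r. r = f z \<longleftrightarrow> prol_r \<phi>0 \<psi>0 z r = canonical_rhs (prol_jet \<phi>0 \<psi>0 z))
     \<longleftrightarrow> schwarzian f \<psi> z = schwarzian f \<phi> z"
proof -
  have c: "P z / (A z)^2 \<noteq> 0" using P_nonzero first.speed_nonzero assms(3) by simp
  have e: "prol_r \<phi>0 \<psi>0 z r = canonical_rhs (prol_jet \<phi>0 \<psi>0 z)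
      \<longleftrightarrow> schwarzian f \<psi> z - schwarzian f \<phi> z + (r - f z) * \<delta> z = 0" for r
    using prolongation(2)[OF assms, of r] c by (metis mult_eq_0_iff right_minus_eq)
  show ?thesis
    unfolding e
  proof
    assume "\<forall>r. r = f z \<longleftrightarrow> schwarzian f \<psi> z - schwarzian f \<phi> z + (r - f z) * \<delta> z = 0"
    from this[rule_format, of "f z"] show "schwarzian f \<psi> z = schwarzian f \<phi> z" by simp
  next
    assume "schwarzian f \<psi> z = schwarzian f \<phi> z"
    then show "\<forall>r. r = f z \<longleftrightarrow> schwarzian f \<psi> z - schwarzian f \<phi> z + (r - f z) * \<delta> z = 0"
      using delta_nonzero[OF assms(3)] by simp
  qed
qed

end

section \<open>The defect of two Schwarzian derivatives\<close>

context coordinate_pair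
begin

abbreviation "sA \<equiv> schwarzian f \<phi>"
abbreviation "sB \<equiv> schwarzian f \<psi>"
text \<open>
  \<open>K\<close> is the obstruction to \<open>(\<phi>, \<psi>)\<close> being a transformation into canonical form. Together with the
  mean \<open>s\<close> it turns the difference of the two linear formulas for \<open>S(\<phi>)\<close> and \<open>S(\<psi>)\<close> into linear
  formulas for \<open>\<delta>\<close>.
\<close>
definition "K z = sB z - sA z"
definition "s z = (sA z + sB z) / 2"
definition "\<rho> z = D \<delta> z / \<delta> z"

lemma eqs: "K = (\<lambda>z. sB z - sA z)" "s = (\<lambda>z. (sA z + sB z) / 2)" "\<rho> = (\<lambda>z. D \<delta> z / \<delta> z)"
  by (simp_all add: fun_eq_iff K_def s_def \<rho>_def)

lemma hol_K [simp, intro]: "hol K" "hol s" "hol \<rho>"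
  unfolding eqs by (simp_all add: delta_nonzero)

lemma rho_delta: "z \<in> N \<Longrightarrow> D \<delta> z = \<rho> z * \<delta> z" by (simp add: \<rho>_def delta_nonzero)

lemma K_q_eq:
  assumes z: "z \<in> N"
  shows "pd_q K z = 3 * D \<delta> z + pd_q f z * \<delta> z"
  unfolding D_delta[OF z] eqs(1) pd_diff(4)[OF second.hol_coord(3) first.hol_coord(3) z] first.pd_schwarzian[OF z] second.pd_schwarzian[OF z]
  by (simp add: \<delta>_def algebra_simps)

lemma K_p:
  assumes z: "z \<in> N"
  shows "pd_p K z = 3 * D (D \<delta>) z + 2 * s z * \<delta> z + K z * \<gamma> z + pd_p f z * \<delta> z"
  unfolding D_delta[OF z] eqs(1) pd_diff(3)[OF second.hol_coord(3) first.hol_coord(3) z] first.pd_schwarzian[OF z] second.pd_schwarzian[OF z]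
  by (simp add: s_def \<delta>_def \<gamma>_def algebra_simps add_divide_distrib)

lemma D_K:
  assumes z: "z \<in> N"
  shows "D K z = D sB z - D sA z" "D s z = (D sA z + D sB z) / 2" "D \<gamma> z = D \<alpha> z + D \<beta> z"
  unfolding eqs gamma_eq using z by (simp_all add: D_rules)

lemma K_u:
  assumes z: "z \<in> N"
  shows "pd_u K z = D (D (D \<delta>)) z + 2 * s z * D \<delta> z + K z * D \<gamma> z + D s z * \<delta> z + D K z * \<gamma> z / 2 + pd_u f z * \<delta> z"
proof -
  have u: "pd_u K z = pd_u sB z - pd_u sA z" unfolding eqs(1) by (simp add: pd_rules z)
  show ?thesis
    unfolding u D_delta[OF z] D_K[OF z] first.pd_schwarzian[OF z] second.pd_schwarzian[OF z]
    by (simp add: K_def s_def \<delta>_def \<gamma>_def field_simps)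
qed

text \<open>
  The part of \<open>f\<^sub>p\<close>, and hence of \<open>I\<^sub>2\<close>, that stems from the defect, up to sign.
\<close>
definition "h z = (K z * \<gamma> z - pd_p K z) / \<delta> z"
lemma h_eq: "h = (\<lambda>z. (K z * \<gamma> z - pd_p K z) / \<delta> z)" by (simp add: fun_eq_iff h_def)
lemma hol_h [simp, intro]: "hol h" unfolding h_eq by (simp add: delta_nonzero)

lemma D_rho: "z \<in> N \<Longrightarrow> D \<rho> z = D (D \<delta>) z / \<delta> z - (\<rho> z)^2"
  unfolding eqs by (simp add: D_divide delta_nonzero power2_eq_square)

end

text \<open>
  A defect independent of \<open>q\<close> is the common ground of both directions: it vanishes for an
  equivalence, and for coordinates adapted to the invariants it is at first only known to be free
  of \<open>q\<close>.
\<close>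
locale q_free_defect = coordinate_pair +
  assumes K_q: "\<And>z. z \<in> N \<Longrightarrow> pd_q K z = 0"
begin

lemma I1_eq: "z \<in> N \<Longrightarrow> I1 f z = 3 * \<rho> z"
proof -
  assume z: "z \<in> N"
  have "(3 * \<rho> z + pd_q f z) * \<delta> z = 0"
    using K_q_eq[OF z] K_q[OF z] by (simp add: rho_delta z algebra_simps)
  then have "3 * \<rho> z + pd_q f z = 0" using delta_nonzero[OF z] by simp
  then show "I1 f z = 3 * \<rho> z" by (simp add: I1_def neg_eq_iff_add_eq_0 add.commute)
qed

lemma I2_eq:
  assumes z: "z \<in> N"
  shows "I2 f z = 2 * (D (D \<delta>) z / \<delta> z) - (\<rho> z)^2 + 2 * s z + h z"
proof -
  have p: "pd_p f z = - 3 * (D (D \<delta>) z / \<delta> z) - 2 * s z - h z"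
    using K_p[OF z] delta_nonzero[OF z] by (simp add: h_def field_simps)
  have d: "D (I1 f) z = 3 * (D (D \<delta>) z / \<delta> z - (\<rho> z)^2)"
    using D_cong[of "I1 f", OF I1_eq _ z] z by (simp add: D_rules D_rho)
  show ?thesis
    unfolding I2_def p d I1_eq[OF z] by (simp add: power2_eq_square algebra_simps)
qed

text \<open>
  When \<open>f\<^sub>q\<close>, \<open>f\<^sub>p\<close>, \<open>f\<^sub>u\<close> are eliminated by means of the formulas for the derivatives of \<open>K\<close>, all
  terms in \<open>\<delta>\<close> and \<open>s\<close> alone cancel and the rest is linear in \<open>K\<close>. Thus \<open>K = 0\<close> gives
  \<open>I\<^sub>4 = 0\<close>, and for \<open>I\<^sub>4 = 0\<close> this is a linear differential equation for \<open>K\<close>.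
\<close>
lemma I4_defect:
  assumes z: "z \<in> N"
  shows "- 2 * \<delta> z * I4 f z = \<rho> z * (K z * \<gamma> z - pd_p K z) - K z * D \<gamma> z - D (pd_p K) z + 2 * pd_u K z"
proof -
  have 1: "D (I2 f) z = 2 * (D (D (D \<delta>)) z / \<delta> z - D (D \<delta>) z * D \<delta> z / (\<delta> z)^2)
      - 2 * \<rho> z * (D (D \<delta>) z / \<delta> z - (\<rho> z)^2) + 2 * D s z + D h z"
    using D_cong[OF I2_eq _ z] z by (simp add: D_rules D_divide delta_nonzero D_rho)
  have 2: "D (D \<delta>) z * D \<delta> z / (\<delta> z)^2 = D (D \<delta>) z / \<delta> z * \<rho> z"
    by (simp add: \<rho>_def power2_eq_square)
  have "D h z = (D K z * \<gamma> z + K z * D \<gamma> z - D (pd_p K) z) / \<delta> z - (K z * \<gamma> z - pd_p K z) * D \<delta> z / (\<delta> z)^2"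
    unfolding h_eq using z by (simp add: D_divide D_rules delta_nonzero)
  also have "(K z * \<gamma> z - pd_p K z) * D \<delta> z / (\<delta> z)^2 = h z * \<rho> z"
    by (simp add: h_def \<rho>_def power2_eq_square)
  finally have 3: "D h z = (D K z * \<gamma> z + K z * D \<gamma> z - D (pd_p K) z) / \<delta> z - h z * \<rho> z" .
  have 4: "pd_u f z = (pd_u K z - K z * D \<gamma> z - D K z * \<gamma> z / 2) / \<delta> z - D (D (D \<delta>)) z / \<delta> z - 2 * s z * \<rho> z - D s z"
    using K_u[OF z] delta_nonzero[OF z] by (simp add: rho_delta z field_simps)
  have 5: "I4 f z = - (\<rho> z * h z) / 2 - (pd_u K z - K z * D \<gamma> z - D K z * \<gamma> z / 2) / \<delta> z
      - (D K z * \<gamma> z + K z * D \<gamma> z - D (pd_p K) z) / \<delta> z / 2"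
    unfolding I4_def 1 2 3 4 I1_eq[OF z] I2_eq[OF z]
    by (simp add: algebra_simps power2_eq_square add_divide_distrib diff_divide_distrib)
  show ?thesis
    unfolding 5 using delta_nonzero[OF z] by (simp add: h_def field_simps)
qed

lemma pd_q_D_delta: "z \<in> N \<Longrightarrow> pd_q (D \<delta>) z = - \<gamma> z * \<delta> z"
  using pd_D(1)[OF hol_delta] D_zero[OF pd_delta(1)] pd_delta by simp

lemma pd_q_rho: "z \<in> N \<Longrightarrow> pd_q \<rho> z = - \<gamma> z"
  unfolding eqs by (simp add: pd_divide delta_nonzero pd_delta pd_q_D_delta)

lemma I3_eq: 
  assumes z: "z \<in> N" shows "I3 f z = \<gamma> z / 2"
proof -
  have "pd_q (I1 f) z = - 3 * \<gamma> z"
    using pd_cong(4)[OF I1_eq _ z] z by (simp add: pd_rules pd_q_rho)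
  then show ?thesis unfolding I3_def by simp
qed

lemma I5_eq:
  assumes z: "z \<in> N" shows "I5 f z = (\<delta> z)^2 / 4"
proof -
  have "pd_p (I3 f) z = pd_p (\<lambda>z. \<gamma> z / 2) z"
    by (rule pd_cong(3)[OF _ _ z]) (auto simp: I3_eq)
  also have "\<dots> = - ((\<alpha> z)^2 + (\<beta> z)^2) / 2"
    unfolding pd_divide_const(3)[OF hol_gamma z] pd_gamma(2)[OF z] ..
  finally have pd: "pd_p (I3 f) z = - ((\<alpha> z)^2 + (\<beta> z)^2) / 2" .
  show ?thesis
    unfolding I5_def I3_eq[OF z] pd by (simp add: \<gamma>_def \<delta>_def power2_eq_square field_simps)
qed

lemma I6_zero:
  assumes z: "z \<in> N" shows "I6 f z = 0"
proof -
  have "pd_q (I3 f) z = pd_q (\<lambda>z. \<gamma> z / 2) z"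
    by (rule pd_cong(4)[OF _ _ z]) (auto simp: I3_eq)
  then show ?thesis
    unfolding I6_def using z by (simp add: pd_rules pd_gamma)
qed

text \<open>
  As \<open>\<delta>\<^sub>q = 0\<close> and \<open>\<delta>\<^sub>p = - \<gamma> \<delta>\<close>, the expression \<open>I\<^sub>7\<close> for a constant multiple of \<open>\<delta>\<close> is that
  multiple of \<open>I\<^sub>1 \<delta> / 3 - D\<delta>\<close>.
\<close>
lemma I7_zero:
  assumes z: "z \<in> N" shows "I7 f (\<lambda>z. \<i> / 2 * \<delta> z) z = 0"
proof -
  define j where "j = (\<lambda>z. \<i> / 2 * \<delta> z)"
  have "D \<delta> z = pd_x \<delta> z + jet_p z * pd_u \<delta> z - jet_q z * \<gamma> z * \<delta> z"
    unfolding D_eq by (simp add: pd_delta z)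
  moreover have "D \<delta> z = \<rho> z * \<delta> z" by (simp add: \<rho>_def delta_nonzero z)
  ultimately have x: "pd_x \<delta> z = \<rho> z * \<delta> z - jet_p z * pd_u \<delta> z + jet_q z * \<gamma> z * \<delta> z" by simp
  have j: "pd_x j z = \<i> / 2 * pd_x \<delta> z" "pd_u j z = \<i> / 2 * pd_u \<delta> z" "j z = \<i> / 2 * \<delta> z"
    unfolding j_def pd_mult[OF hol_const hol_delta z] pd_const by simp_all
  have "I7 f j z = 0"
    unfolding I7_def j x I1_eq[OF z] I3_eq[OF z] by (simp add: algebra_simps)
  then show ?thesis unfolding j_def .
qed

text \<open>
  The factor \<open>\<i> / 2\<close> turns \<open>\<delta>\<close> into a square root of \<open>- I\<^sub>5\<close>.
\<close>
theorem invariants: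
  assumes K: "\<And>z. z \<in> N \<Longrightarrow> K z = 0" and z: "z \<in> N"
  shows "(\<i> / 2 * \<delta> z)^2 = - I5 f z \<and> I4 f z = 0 \<and> I5 f z \<noteq> 0 \<and> I6 f z = 0 \<and> I7 f (\<lambda>z. \<i> / 2 * \<delta> z) z = 0"
proof -
  have "D (pd_p K) z = 0" by (rule D_zero[OF pd_zero(3)[of K, OF K] z])
  then have "I4 f z = 0"
    using I4_defect[OF z] K[OF z] pd_zero[of K, OF K z] delta_nonzero[OF z] by simp
  then show ?thesis
    using z I6_zero I7_zero delta_nonzero by (simp add: I5_eq power_mult_distrib power_divide)
qed

end

lemma necessity:
  assumes f: "holomorphic_jet f U" and eq: "point_equivalent_near f U z0 canonical_rhs canonical_domain"
  shows "\<exists>N J. open N \<and> z0 \<in> N \<and> N \<subseteq> U \<and> holomorphic_jet J N \<and>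
     (\<forall>z\<in>N. (J z)^2 = - I5 f z \<and> I4 f z = 0 \<and> I5 f z \<noteq> 0 \<and> I6 f z = 0 \<and> I7 f J z = 0)"
proof -
  obtain \<phi> \<psi> W N where h: "holomorphic_plane \<phi> W" "holomorphic_plane \<psi> W" and N: "open N" "z0 \<in> N" "N \<subseteq> U"
    and H: "\<And>z. z \<in> N \<Longrightarrow> (fst z, fst (snd z)) \<in> W"
     "\<And>z. z \<in> N \<Longrightarrow> pd_x (on_jets \<phi>) z * pd_u (on_jets \<psi>) z - pd_u (on_jets \<phi>) z * pd_x (on_jets \<psi>) z \<noteq> 0"
     "\<And>z. z \<in> N \<Longrightarrow> total_deriv_low (on_jets \<phi>) z \<noteq> 0"
     "\<And>z. z \<in> N \<Longrightarrow> prol_jet \<phi> \<psi> z \<in> canonical_domain"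
     "\<And>z. z \<in> N \<Longrightarrow> \<forall>r. r = f z \<longleftrightarrow> prol_r \<phi> \<psi> z r = canonical_rhs (prol_jet \<phi> \<psi> z)"
    using eq unfolding point_equivalent_near_def by blast
  have fN: "holomorphic_jet f N"
    using f N unfolding holomorphic_jet_def by blast
  note hj = h[THEN holomorphic_jet_on_jets, OF N(1) H(1)]
  have low: "total_deriv_low (on_jets F) z = Dhat f (on_jets F) z" for F z
    by (simp add: total_deriv_low_def Dhat_def total_deriv_def pd_on_jets)
  have "total_deriv_low (on_jets \<psi>) z \<noteq> 0" if "z \<in> N" for z
    using H(4)[OF that] by (auto simp: canonical_domain_def prol_jet_def jet_p_def prol_p_def)
  with H(3) interpret coordinate_pair N f "on_jets \<phi>" "on_jets \<psi>"
    using fN hj H(2) N(1) by unfold_locales (auto simp: pd_on_jets low)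
  have K: "K z = 0" if "z \<in> N" for z
    using prolongation_iff[OF refl refl that] H(5)[OF that] by (simp add: K_def)
  interpret q_free_defect N f "on_jets \<phi>" "on_jets \<psi>"
    by unfold_locales (rule pd_zero(4)[of K, OF K])
  define J where "J = (\<lambda>z. \<i> / 2 * \<delta> z)"
  have J: "holomorphic_jet J N" unfolding J_def by (intro hol_mult hol_const hol_delta)
  have inv: "\<forall>z\<in>N. (J z)^2 = - I5 f z \<and> I4 f z = 0 \<and> I5 f z \<noteq> 0 \<and> I6 f z = 0 \<and> I7 f J z = 0"
    unfolding J_def by (rule ballI, rule invariants[OF K])
  show ?thesis
    by (rule exI[of _ N], rule exI[of _ J], intro conjI N J inv)
qed

text \<open>
  The situation reached by the coordinates adapted to the invariants.
\<close>
locale schwarzian_defect = q_free_defect +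
  assumes I4_0: "\<And>z. z \<in> N \<Longrightarrow> I4 f z = 0"
begin

lemma defect_equation:
  assumes z: "z \<in> N"
  shows "\<rho> z * (K z * \<gamma> z - pd_p K z) - K z * D \<gamma> z - D (pd_p K) z + 2 * pd_u K z = 0"
  using I4_defect[OF z] I4_0[OF z] by simp

lemma K_pq: assumes z: "z \<in> N"
  shows "pd_q (pd_p K) z = 0" "pd_q (pd_u K) z = 0"
  using pd_commute[OF hol_K(1) z] pd_zero[of "pd_q K", OF K_q z] by simp_all

text \<open>
  In the equation for the defect, \<open>q\<close> occurs linearly; this is its coefficient. The functions \<open>A\<^sup>2\<close> and
  \<open>B\<^sup>2\<close> solve this second-order linear equation in \<open>p\<close>, since \<open>\<partial>\<^sub>p A = \<alpha> A\<close> and \<open>\<partial>\<^sub>p B = \<beta> B\<close>.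
\<close>
lemma K_pp:
  assumes z: "z \<in> N"
  shows "pd_p (pd_p K) z = \<gamma> z * pd_p K z - 2 * \<alpha> z * \<beta> z * K z"
proof -
  have a: "pd_q (D \<gamma>) z = - ((\<alpha> z)^2 + (\<beta> z)^2)"
    using pd_D(1)[OF hol_gamma z] D_zero[of "pd_q \<gamma>", OF pd_gamma(1) z] pd_gamma[OF z] by simp
  have b: "pd_q (D (pd_p K)) z = pd_p (pd_p K) z"
    using pd_D(1)[OF hol_pd(3)[OF hol_K(1)] z] D_zero[of "pd_q (pd_p K)", OF K_pq(1) z] K_pq[OF z] by simp
  have "pd_q (\<lambda>z. \<rho> z * (K z * \<gamma> z - pd_p K z) - K z * D \<gamma> z - D (pd_p K) z + 2 * pd_u K z) z = 0"
    by (rule pd_zero[OF defect_equation z])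
  moreover have "pd_q (\<lambda>z. \<rho> z * (K z * \<gamma> z - pd_p K z) - K z * D \<gamma> z - D (pd_p K) z + 2 * pd_u K z) z
     = - \<gamma> z * (K z * \<gamma> z - pd_p K z) + K z * ((\<alpha> z)^2 + (\<beta> z)^2) - pd_p (pd_p K) z"
    by (simp add: pd_rules z a b K_q K_pq pd_q_rho pd_gamma algebra_simps)
  ultimately have "- \<gamma> z * (K z * \<gamma> z - pd_p K z) + K z * ((\<alpha> z)^2 + (\<beta> z)^2) = pd_p (pd_p K) z"
    by simp
  from this[symmetric] show ?thesis by (simp add: \<gamma>_def algebra_simps power2_eq_square)
qed

text \<open>
  Variation of constants: the solution of the linear system \<open>K = k B\<^sup>2 + l A\<^sup>2\<close>,
  \<open>K\<^sub>p = 2 (k \<beta> B\<^sup>2 + l \<alpha> A\<^sup>2)\<close>.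
\<close>
definition "k z = (pd_p K z - 2 * \<alpha> z * K z) / (2 * (B z)^2 * \<delta> z)"
definition "l z = - (pd_p K z - 2 * \<beta> z * K z) / (2 * (A z)^2 * \<delta> z)"

lemma kl_eq: "k = (\<lambda>z. (pd_p K z - 2 * \<alpha> z * K z) / (2 * (B z)^2 * \<delta> z))"
  "l = (\<lambda>z. - (pd_p K z - 2 * \<beta> z * K z) / (2 * (A z)^2 * \<delta> z))"
  by (simp_all add: fun_eq_iff k_def l_def)

lemma AB_nonzero: "z \<in> N \<Longrightarrow> A z \<noteq> 0" "z \<in> N \<Longrightarrow> B z \<noteq> 0"
  using first.speed_nonzero second.speed_nonzero by auto

lemma hol_kl [simp, intro]: "hol k" "hol l"
  unfolding kl_eq
  by (intro hol_divide hol_diff hol_minus hol_mult hol_const hol_pd hol_K hol_power hol_D first.hol_coord second.hol_coord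
      first.hol_omega second.hol_omega hol_delta; simp add: AB_nonzero delta_nonzero)+

lemma omega_u:
  assumes "z \<in> N" shows "pd_u \<phi> z = \<alpha> z * A z" "pd_u \<psi> z = \<beta> z * B z"
  using AB_nonzero[OF assms] by (simp_all add: ld_p_def)

lemma pd_kl:
  assumes z: "z \<in> N"
  shows "pd_q k z = 0" "pd_p k z = 0" "pd_q l z = 0" "pd_p l z = 0"
proof -
  \<comment> \<open>Numerator and denominator of \<open>k\<close>, and those of \<open>l\<close>, have the same logarithmic \<open>p\<close>-derivative.\<close>
  have ratio: "pd_p (\<lambda>z. n z / m z) z = 0 \<and> pd_q (\<lambda>z. n z / m z) z = 0"
    if "hol n" "hol m" "\<And>z. z \<in> N \<Longrightarrow> m z \<noteq> 0" "pd_p n z = c * n z" "pd_p m z = c * m z" "pd_q n z = 0" "pd_q m z = 0" for n m c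
    using that z by (simp add: pd_divide power2_eq_square)
  have n: "pd_p (\<lambda>z. pd_p K z - 2 * \<alpha> z * K z) z = \<delta> z * (pd_p K z - 2 * \<alpha> z * K z)"
    "pd_p (\<lambda>z. - (pd_p K z - 2 * \<beta> z * K z)) z = - \<delta> z * (- (pd_p K z - 2 * \<beta> z * K z))"
    "pd_q (\<lambda>z. pd_p K z - 2 * \<alpha> z * K z) z = 0"
    "pd_q (\<lambda>z. - (pd_p K z - 2 * \<beta> z * K z)) z = 0"
    by (simp_all add: pd_rules z K_pp K_pq K_q first.pd_beta second.pd_beta)
       (simp_all add: \<gamma>_def \<delta>_def algebra_simps power2_eq_square)
  have m: "pd_p (\<lambda>z. 2 * (B z)^2 * \<delta> z) z = \<delta> z * (2 * (B z)^2 * \<delta> z)"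
    "pd_p (\<lambda>z. 2 * (A z)^2 * \<delta> z) z = - \<delta> z * (2 * (A z)^2 * \<delta> z)"
    "pd_q (\<lambda>z. 2 * (B z)^2 * \<delta> z) z = 0" "pd_q (\<lambda>z. 2 * (A z)^2 * \<delta> z) z = 0"
    by (simp_all add: pd_rules z first.pd_speed second.pd_speed pd_delta omega_u)
       (simp_all add: \<gamma>_def \<delta>_def algebra_simps power2_eq_square)
  have "hol (\<lambda>z. pd_p K z - 2 * \<alpha> z * K z)" "hol (\<lambda>z. - (pd_p K z - 2 * \<beta> z * K z))"
    "hol (\<lambda>z. 2 * (B z)^2 * \<delta> z)" "hol (\<lambda>z. 2 * (A z)^2 * \<delta> z)" by simp_all
  note ratio[OF this(1,3) _ n(1) m(1) n(3) m(3)] ratio[OF this(2,4) _ n(2) m(2) n(4) m(4)]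
  then show "pd_q k z = 0" "pd_p k z = 0" "pd_q l z = 0" "pd_p l z = 0"
    unfolding kl_eq by (simp_all add: AB_nonzero delta_nonzero)
qed

lemma K_kl:
  assumes z: "z \<in> N"
  shows "K z = k z * (B z)^2 + l z * (A z)^2"
    "pd_p K z = 2 * (k z * \<beta> z * (B z)^2 + l z * \<alpha> z * (A z)^2)"
proof -
  have 1: "k z * (B z)^2 = (pd_p K z - 2 * \<alpha> z * K z) / (2 * \<delta> z)"
    "l z * (A z)^2 = - (pd_p K z - 2 * \<beta> z * K z) / (2 * \<delta> z)"
    using AB_nonzero[OF z] by (simp_all add: k_def l_def)
  have d: "2 * \<delta> z \<noteq> 0" using delta_nonzero[OF z] by simp
  have "k z * (B z)^2 + l z * (A z)^2 = (2 * \<delta> z * K z) / (2 * \<delta> z)"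
    unfolding 1 add_divide_distrib[symmetric] by (simp add: \<delta>_def algebra_simps)
  then show "K z = k z * (B z)^2 + l z * (A z)^2" using d by simp
  have "2 * (\<beta> z * (k z * (B z)^2) + \<alpha> z * (l z * (A z)^2)) = (2 * \<delta> z * pd_p K z) / (2 * \<delta> z)"
    unfolding 1 times_divide_eq_right add_divide_distrib[symmetric] by (simp add: \<delta>_def algebra_simps)
  then show "pd_p K z = 2 * (k z * \<beta> z * (B z)^2 + l z * \<alpha> z * (A z)^2)"
    using d by (simp add: ac_simps)
qed

lemma D_speed: "z \<in> N \<Longrightarrow> D A z = ld_D f \<phi> z * A z" "z \<in> N \<Longrightarrow> D B z = ld_D f \<psi> z * B z"
  by (simp_all add: ld_D_def AB_nonzero)

lemma pd_u_speed:
  assumes z: "z \<in> N"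
  shows "pd_u A z = (D \<alpha> z + \<alpha> z * ld_D f \<phi> z) * A z" "pd_u B z = (D \<beta> z + \<beta> z * ld_D f \<psi> z) * B z"
  using first.pd_u_speed[OF z] second.pd_u_speed[OF z] AB_nonzero[OF z] by (simp_all add: field_simps)

text \<open>
  The Jacobians of \<open>(k, \<psi>)\<close> and \<open>(l, \<phi>)\<close> vanish: substituting \<open>K = k B\<^sup>2 + l A\<^sup>2\<close> into the equation
  for the defect leaves \<open>a B + b A = 0\<close>, where \<open>a\<close> and \<open>b\<close> are these Jacobians. They do not depend
  on \<open>p\<close>, while \<open>A\<close> and \<open>B\<close> are linearly independent polynomials in \<open>p\<close>.
\<close>
lemma kl_transport:
  assumes z: "z \<in> N"
  shows "pd_u k z * pd_x \<psi> z = pd_u \<psi> z * pd_x k z" "pd_u l z * pd_x \<phi> z = pd_u \<phi> z * pd_x l z"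
proof -
  define a where "a z = pd_u k z * pd_x \<psi> z - pd_u \<psi> z * pd_x k z" for z
  define b where "b z = pd_u l z * pd_x \<phi> z - pd_u \<phi> z * pd_x l z" for z
  have eq: "B z * a z + A z * b z = 0" if z: "z \<in> N" for z
  proof -
    have Ku: "pd_u K z = pd_u k z * (B z)^2 + 2 * k z * (B z)^2 * (D \<beta> z + \<beta> z * ld_D f \<psi> z)
        + pd_u l z * (A z)^2 + 2 * l z * (A z)^2 * (D \<alpha> z + \<alpha> z * ld_D f \<phi> z)"
      unfolding pd_cong(2)[OF K_kl(1) _ z, simplified]
      using pd_cong(2)[OF K_kl(1) _ z] z
      by (simp add: pd_rules pd_u_speed) (simp add: algebra_simps power2_eq_square)
    have Kp: "D (pd_p K) z = 2 * (D k z * \<beta> z * (B z)^2 + k z * D \<beta> z * (B z)^2 + 2 * k z * \<beta> z * (B z)^2 * ld_D f \<psi> z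
        + D l z * \<alpha> z * (A z)^2 + l z * D \<alpha> z * (A z)^2 + 2 * l z * \<alpha> z * (A z)^2 * ld_D f \<phi> z)"
      using D_cong[OF K_kl(2) _ z] z
      by (simp add: D_rules D_speed) (simp add: algebra_simps power2_eq_square)
    have r: "\<rho> z * \<delta> z = D \<beta> z - D \<alpha> z" using D_delta[OF z] rho_delta[OF z] by simp
    have "K z * \<gamma> z - pd_p K z = \<delta> z * (l z * (A z)^2 - k z * (B z)^2)"
      unfolding K_kl[OF z] by (simp add: \<gamma>_def \<delta>_def algebra_simps)
    then have rK: "\<rho> z * (K z * \<gamma> z - pd_p K z) = (D \<beta> z - D \<alpha> z) * (l z * (A z)^2 - k z * (B z)^2)"
      unfolding r[symmetric] by simp
    have alg: "(b' - a') * (l * a2 - k * b2) - (k * b2 + l * a2) * (a' + b')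
        - 2 * (k' * b * b2 + k * b' * b2 + 2 * k * b * b2 * y + l' * a * a2 + l * a' * a2 + 2 * l * a * a2 * x)
        + 2 * (ku * b2 + 2 * k * b2 * (b' + b * y) + lu * a2 + 2 * l * a2 * (a' + a * x))
        = 2 * ((ku - b * k') * b2 + (lu - a * l') * a2)"
      for a b a' b' k l k' l' ku lu a2 b2 x y :: complex
      by (simp add: algebra_simps)
    have e0: "(D \<beta> z - D \<alpha> z) * (l z * (A z)^2 - k z * (B z)^2) - K z * D \<gamma> z - D (pd_p K) z + 2 * pd_u K z = 0"
      using defect_equation[OF z] unfolding rK .
    have "2 * ((pd_u k z - \<beta> z * D k z) * (B z)^2 + (pd_u l z - \<alpha> z * D l z) * (A z)^2) = 0"
    proof -
      have e1: "(D \<beta> z - D \<alpha> z) * (l z * (A z)^2 - k z * (B z)^2) - (k z * (B z)^2 + l z * (A z)^2) * (D \<alpha> z + D \<beta> z) - D (pd_p K) z + 2 * pd_u K z = 0"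
        using e0 unfolding D_K(3)[OF z] K_kl(1)[OF z] .
      have e2: "2 * ((pd_u k z - \<beta> z * D k z) * (B z)^2 + (pd_u l z - \<alpha> z * D l z) * (A z)^2)
        = (D \<beta> z - D \<alpha> z) * (l z * (A z)^2 - k z * (B z)^2) - (k z * (B z)^2 + l z * (A z)^2) * (D \<alpha> z + D \<beta> z) - D (pd_p K) z + 2 * pd_u K z"
        apply (subst Ku)
        apply (subst Kp)
        apply (rule alg[symmetric])
        done
      show ?thesis unfolding e2 e1 ..
    qed
    moreover have Dkl: "D k z = pd_x k z + jet_p z * pd_u k z" "D l z = pd_x l z + jet_p z * pd_u l z"
      by (simp_all add: D_eq pd_kl z)
    have "pd_u k z * B z - pd_u \<psi> z * D k z = a z" "pd_u l z * A z - pd_u \<phi> z * D l z = b z"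
      unfolding speed_eq[OF z] Dkl a_def b_def by (simp_all add: algebra_simps)
    then have ab: "a z = pd_u k z * B z - \<beta> z * B z * D k z" "b z = pd_u l z * A z - \<alpha> z * A z * D l z"
      by (simp_all add: omega_u z)
    have "(pd_u k z - \<beta> z * D k z) * (B z)^2 = B z * a z" "(pd_u l z - \<alpha> z * D l z) * (A z)^2 = A z * b z"
      unfolding ab by (simp_all add: power2_eq_square algebra_simps)
    ultimately have "2 * (B z * a z + A z * b z) = 0" by (simp only:)
    then show ?thesis by (simp del: distrib_left_numeral)
  qed
  have ab: "a = (\<lambda>z. pd_u k z * pd_x \<psi> z - pd_u \<psi> z * pd_x k z)" "b = (\<lambda>z. pd_u l z * pd_x \<phi> z - pd_u \<phi> z * pd_x l z)"
    by (auto simp: a_def b_def)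
  have hab: "hol a" "hol b" unfolding ab by simp_all
  have base: "pd_p (pd_u F) z = 0 \<and> pd_p (pd_x F) z = 0" if "hol F" "\<And>z. z \<in> N \<Longrightarrow> pd_p F z = 0" for F
    using pd_commute(2,4)[OF that(1) z] pd_zero(1,2)[of "pd_p F", OF that(2) z] by simp
  have ap: "pd_p a z = 0" "pd_p b z = 0"
    unfolding ab
    using base[OF hol_kl(1) pd_kl(2)] base[OF hol_kl(2) pd_kl(4)]
      base[OF first.hol_omega first.omega_p] base[OF second.hol_omega second.omega_p]
    by (simp_all add: pd_rules z)
  \<comment> \<open>The \<open>p\<close>-derivative is a second linear equation for \<open>a\<close> and \<open>b\<close>, of determinant \<open>\<delta> A B\<close>.\<close>
  have "pd_p (\<lambda>z. B z * a z + A z * b z) z = 0" by (rule pd_zero[OF eq z])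
  then have "pd_u \<psi> z * a z + pd_u \<phi> z * b z = 0"
    using z hab by (simp add: pd_rules ap first.pd_speed second.pd_speed)
  then have e: "\<beta> z * (B z * a z) + \<alpha> z * (A z * b z) = 0" by (simp add: omega_u z mult.assoc)
  have "\<delta> z * (B z * a z) = 0" "\<delta> z * (A z * b z) = 0"
    using e eq[OF z] unfolding \<delta>_def by (algebra, algebra)
  then have "a z = 0" "b z = 0" using delta_nonzero[OF z] AB_nonzero[OF z] by simp_all
  then show "pd_u k z * pd_x \<psi> z = pd_u \<psi> z * pd_x k z" "pd_u l z * pd_x \<phi> z = pd_u \<phi> z * pd_x l z"
    by (simp_all add: a_def b_def)
qed

end

section \<open>Consequences of the conditions on the invariants\<close>

locale canonical_invariants = jet_ode +
  fixes J :: "jet \<Rightarrow> complex"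
  assumes hol_J [simp, intro]: "hol J"
    and J_square: "\<And>z. z \<in> N \<Longrightarrow> (J z)^2 = - I5 f z"
    and I4_0: "\<And>z. z \<in> N \<Longrightarrow> I4 f z = 0"
    and I5_nonzero: "\<And>z. z \<in> N \<Longrightarrow> I5 f z \<noteq> 0"
    and I6_0: "\<And>z. z \<in> N \<Longrightarrow> I6 f z = 0"
    and I7_0: "\<And>z. z \<in> N \<Longrightarrow> I7 f J z = 0"
begin

abbreviation "i1 \<equiv> I1 f"
abbreviation "i2 \<equiv> I2 f"
abbreviation "i3 \<equiv> I3 f"

lemma J_nonzero: "z \<in> N \<Longrightarrow> J z \<noteq> 0"
  using J_square I5_nonzero by fastforce

lemma I_eqs: "i1 = (\<lambda>z. - pd_q f z)" "i2 = (\<lambda>z. - (2/9) * (i1 z)^2 - pd_p f z - (1/3) * D i1 z)"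
  "i3 = (\<lambda>z. - (1/6) * pd_q i1 z)" "I4 f = (\<lambda>z. - (1/3) * i1 z * i2 z - pd_u f z - (1/2) * D i2 z)"
  by (auto simp: fun_eq_iff I1_def I2_def I3_def I4_def)

lemma hol_I [simp, intro]: "hol i1" "hol i2" "hol i3"
proof -
  show 1: "hol i1" unfolding I_eqs(1) by simp
  show "hol i2" unfolding I_eqs(2) using 1 by (intro hol_diff hol_mult hol_const hol_power hol_pd hol_D hol_f)
  show "hol i3" unfolding I_eqs(3) using 1 by (intro hol_mult hol_const hol_pd)
qed

lemma pd_q_f: "pd_q f z = - i1 z" by (simp add: I1_def)

lemma I3_q: "z \<in> N \<Longrightarrow> pd_q i3 z = 0"
  using I6_0 by (simp add: I6_def)

lemma I1_q: "pd_q i1 z = -6 * i3 z" by (simp add: I3_def)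

lemma I1_q_fun: "pd_q i1 = (\<lambda>z. -6 * i3 z)" and pd_q_f_fun: "pd_q f = (\<lambda>z. - i1 z)"
  by (simp_all add: fun_eq_iff I1_q pd_q_f)

lemma pd_q_pd:
  assumes "z \<in> N"
  shows "pd_q (pd_p f) z = - pd_p i1 z" "pd_q (pd_u f) z = - pd_u i1 z"
    "pd_q (pd_p i1) z = -6 * pd_p i3 z" "pd_q (pd_u i1) z = -6 * pd_u i3 z"
    "pd_q (pd_p i3) z = 0" "pd_q (pd_u i3) z = 0"
  unfolding pd_commute[OF hol_f assms] pd_commute[OF hol_I(1) assms] pd_commute[OF hol_I(3) assms] I1_q_fun pd_q_f_fun
  using assms pd_zero[of "pd_q i3", OF I3_q assms] by (simp_all add: pd_rules)

lemma I2_q: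
  assumes z: "z \<in> N"
  shows "pd_q i2 z = (2/3) * (i1 z * i3 z) + (2/3) * pd_p i1 z + 2 * D i3 z"
proof -
  have "D (pd_q i1) z = -6 * D i3 z"
    unfolding I1_q_fun by (simp add: D_rules z)
  then have a: "pd_q (D i1) z = -6 * D i3 z + pd_p i1 z + 6 * i1 z * i3 z"
    using pd_D(1)[OF hol_I(1) z] by (simp add: I1_q pd_q_f)
  have b: "pd_q i2 z = - (2/9) * (2 * i1 z * pd_q i1 z) - pd_q (pd_p f) z - (1/3) * pd_q (D i1) z"
    unfolding I_eqs(2)
    by (simp add: pd_rules z)
  show ?thesis unfolding b a I1_q pd_q_pd(1)[OF z] by (simp add: field_simps)
qed

text \<open>
  The second \<open>q\<close>-derivative of \<open>I\<^sub>2\<close>; it equals \<open>- 2 (I\<^sub>3\<^sup>2 + J\<^sup>2)\<close>.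
\<close>
definition "i2qq z = - 4 * (i3 z)^2 - 2 * pd_p i3 z"
lemma i2qq_eq: "i2qq = (\<lambda>z. - 4 * (i3 z)^2 - 2 * pd_p i3 z)" by (simp add: fun_eq_iff i2qq_def)
lemma hol_i2qq [simp, intro]: "hol i2qq"
  unfolding i2qq_eq by (intro hol_diff hol_mult hol_const hol_power hol_pd hol_I)

lemma I2_qq:
  assumes z: "z \<in> N" shows "pd_q (pd_q i2) z = i2qq z"
proof -
  have "pd_q (D i3) z = pd_p i3 z"
    using pd_D(1)[OF hol_I(3) z] D_zero[OF I3_q z] I3_q[OF z] by simp
  moreover have "pd_q (pd_q i2) z = pd_q (\<lambda>z. (2/3) * (i1 z * i3 z) + (2/3) * pd_p i1 z + 2 * D i3 z) z"
    by (rule pd_cong[OF I2_q _ z]) simp_all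
  ultimately show ?thesis
    using z by (simp add: pd_rules I1_q I3_q pd_q_pd i2qq_def power2_eq_square)
qed

lemma i2qq_q: "z \<in> N \<Longrightarrow> pd_q i2qq z = 0"
  unfolding i2qq_eq by (simp add: pd_rules I3_q pd_q_pd)

text \<open>
  The third \<open>q\<close>-derivative of \<open>I\<^sub>4 = 0\<close>. Each \<open>\<partial>\<^sub>q\<close> acts on \<open>D I\<^sub>2\<close> through the commutator
  \<open>[\<partial>\<^sub>q, D]\<close>; after three of them only \<open>I\<^sub>3\<close> and its \<open>p\<close>-derivatives
  are left.
\<close>
lemma pd_p_i2qq:
  assumes z: "z \<in> N" shows "pd_p i2qq z = - 2 * i3 z * i2qq z"
proof -
  have i4_q: "pd_q (I4 f) z = 2 * (i3 z * i2 z) + (1/6) * (i1 z * pd_q i2 z) + pd_u i1 z - (1/2) * D (pd_q i2) z - (1/2) * pd_p i2 z"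
    if z: "z \<in> N" for z
  proof -
    have "pd_q (I4 f) z = - (1/3) * (pd_q i1 z * i2 z + i1 z * pd_q i2 z) - pd_q (pd_u f) z - (1/2) * pd_q (D i2) z"
      unfolding I_eqs(4) by (simp add: pd_rules z)
    then show ?thesis
      by (simp add: pd_D(1)[OF hol_I(2) z] pd_q_f I1_q pd_q_pd z algebra_simps)
  qed
  have i4_qq: "pd_q (pd_q (I4 f)) z = i3 z * pd_q i2 z + (2/3) * (i1 z * i2qq z) - 6 * pd_u i3 z - (1/2) * D i2qq z - pd_p (pd_q i2) z"
    if z: "z \<in> N" for z
  proof -
    have a: "pd_q (\<lambda>z. i3 z * i2 z) z = i3 z * pd_q i2 z"
      using pd_mult(4)[OF hol_I(3) hol_I(2) z] I3_q[OF z] by simp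
    have b: "pd_q (\<lambda>z. i1 z * pd_q i2 z) z = -6 * i3 z * pd_q i2 z + i1 z * i2qq z"
      using pd_mult(4)[OF hol_I(1) hol_pd(4)[OF hol_I(2)] z] I1_q I2_qq[OF z] by simp
    have c: "pd_q (D (pd_q i2)) z = D i2qq z + pd_p (pd_q i2) z - i1 z * i2qq z"
      using pd_D(1)[OF hol_pd(4)[OF hol_I(2)] z] D_cong[OF I2_qq hol_i2qq z] I2_qq[OF z] by (simp add: pd_q_f)
    have d: "pd_q (pd_p i2) z = pd_p (pd_q i2) z" by (simp add: pd_commute z)
    have "pd_q (pd_q (I4 f)) z = pd_q (\<lambda>z. 2 * (i3 z * i2 z) + (1/6) * (i1 z * pd_q i2 z) + pd_u i1 z - (1/2) * D (pd_q i2) z - (1/2) * pd_p i2 z) z"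
      by (rule pd_cong[OF i4_q _ z]) simp_all
    also have "\<dots> = 2 * pd_q (\<lambda>z. i3 z * i2 z) z + (1/6) * pd_q (\<lambda>z. i1 z * pd_q i2 z) z + pd_q (pd_u i1) z
       - (1/2) * pd_q (D (pd_q i2)) z - (1/2) * pd_q (pd_p i2) z"
      by (simp add: pd_rules z)
    finally show ?thesis unfolding a b c d pd_q_pd(4)[OF z] by (simp add: algebra_simps)
  qed
  have "pd_q (pd_q (pd_q (I4 f))) z = i3 z * i2qq z + (2/3) * (-6 * i3 z * i2qq z) - (1/2) * pd_p i2qq z - pd_p i2qq z"
  proof -
    have a: "pd_q (\<lambda>z. i3 z * pd_q i2 z) z = i3 z * i2qq z"
      using pd_mult(4)[OF hol_I(3) hol_pd(4)[OF hol_I(2)] z] I3_q[OF z] I2_qq[OF z] by simp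
    have b: "pd_q (\<lambda>z. i1 z * i2qq z) z = -6 * i3 z * i2qq z"
      using pd_mult(4)[OF hol_I(1) hol_i2qq z] I1_q i2qq_q[OF z] by simp
    have c: "pd_q (D i2qq) z = pd_p i2qq z"
      using pd_D(1)[OF hol_i2qq z] D_zero[OF i2qq_q z] i2qq_q[OF z] by simp
    have d: "pd_q (pd_p (pd_q i2)) z = pd_p i2qq z"
      using pd_commute(6)[OF hol_pd(4)[OF hol_I(2)] z] pd_cong(3)[OF I2_qq hol_i2qq z] by simp
    have "pd_q (pd_q (pd_q (I4 f))) z = pd_q (\<lambda>z. i3 z * pd_q i2 z + (2/3) * (i1 z * i2qq z) - 6 * pd_u i3 z - (1/2) * D i2qq z - pd_p (pd_q i2) z) z"
      by (rule pd_cong[OF i4_qq _ z]) simp_all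
    also have "\<dots> = pd_q (\<lambda>z. i3 z * pd_q i2 z) z + (2/3) * pd_q (\<lambda>z. i1 z * i2qq z) z - 6 * pd_q (pd_u i3) z
       - (1/2) * pd_q (D i2qq) z - pd_q (pd_p (pd_q i2)) z"
      by (simp add: pd_rules z)
    finally show ?thesis unfolding a b c d pd_q_pd(6)[OF z] by simp
  qed
  moreover have "pd_q (pd_q (pd_q (I4 f))) z = 0"
    by (intro pd_zero z I4_0)
  ultimately show ?thesis by (simp add: field_simps)
qed

lemma J_square': "z \<in> N \<Longrightarrow> pd_p i3 z = (J z)^2 - (i3 z)^2"
  using J_square[of z] by (simp add: I5_def)

text \<open>
  Differentiate \<open>i2qq = - 2 (I\<^sub>3\<^sup>2 + J\<^sup>2)\<close> and use \<open>I\<^sub>3\<^sub>p = J\<^sup>2 - I\<^sub>3\<^sup>2\<close>.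
\<close>
lemma pd_J:
  assumes z: "z \<in> N"
  shows "pd_q J z = 0" "pd_p J z = - 2 * i3 z * J z"
proof -
  have e: "i2qq z = - 2 * ((i3 z)^2 + (J z)^2)" if "z \<in> N" for z
    unfolding i2qq_def J_square'[OF that] by simp
  have "pd_q i2qq z = pd_q (\<lambda>z. - 2 * ((i3 z)^2 + (J z)^2)) z" "pd_p i2qq z = pd_p (\<lambda>z. - 2 * ((i3 z)^2 + (J z)^2)) z"
    by (rule pd_cong[OF e _ z]; simp)+
  then have 1: "pd_q i2qq z = - 2 * (2 * i3 z * pd_q i3 z + 2 * J z * pd_q J z)"
    "pd_p i2qq z = - 2 * (2 * i3 z * pd_p i3 z + 2 * J z * pd_p J z)"
    using z by (simp_all add: pd_rules)
  show "pd_q J z = 0" using 1(1) i2qq_q[OF z] I3_q[OF z] J_nonzero[OF z] by simp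
  have "4 * (J z * (pd_p J z + 2 * i3 z * J z)) = 0"
    using 1(2) unfolding pd_p_i2qq[OF z] e[OF z] J_square'[OF z] by (simp add: algebra_simps power2_eq_square)
  then show "pd_p J z = - 2 * i3 z * J z"
    using J_nonzero[OF z] by (simp add: add_eq_0_iff2)
qed

text \<open>
  With the derivatives of \<open>J\<close> in \<open>p\<close> and \<open>q\<close> known, \<open>I\<^sub>7\<close> is \<open>I\<^sub>1 J / 3 - D J\<close>.
\<close>
lemma I1_J:
  assumes z: "z \<in> N" shows "i1 z * J z = 3 * D J z"
proof -
  have "(1/3) * i1 z * J z - D J z = 0"
    using I7_0[OF z] unfolding I7_def D_eq pd_J[OF z] by (simp add: algebra_simps)
  then show ?thesis by (simp add: field_simps)
qed

text \<open>
  For an equation with vanishing defect, \<open>1 / J\<close> is a multiple of \<open>A B\<close> by a function of \<open>(x, u)\<close>.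
  The conditions on the invariants imply conversely that \<open>w = 1 / J\<close> is a quadratic polynomial \<open>w\<^sub>0 + w\<^sub>1 p + w\<^sub>2 p\<^sup>2\<close>;
  its coefficients are the Taylor coefficients at the jet itself, shifted to \<open>p = 0\<close>.
\<close>
definition "w z = inverse (J z)"
definition "w2 z = pd_p (pd_p w) z / 2"
definition "w1 z = pd_p w z - jet_p z * pd_p (pd_p w) z"
definition "w0 z = w z - jet_p z * pd_p w z + (jet_p z)^2 * pd_p (pd_p w) z / 2"

lemma w_eqs: "w = (\<lambda>z. inverse (J z))" "w2 = (\<lambda>z. pd_p (pd_p w) z / 2)"
  "w1 = (\<lambda>z. pd_p w z - jet_p z * pd_p (pd_p w) z)"
  "w0 = (\<lambda>z. w z - jet_p z * pd_p w z + (jet_p z)^2 * pd_p (pd_p w) z / 2)"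
  by (simp_all add: fun_eq_iff w_def w0_def w1_def w2_def)

lemma hol_w [simp, intro]: "hol w" "hol w0" "hol w1" "hol w2"
proof -
  show 1: "hol w" unfolding w_eqs(1) by (intro hol_inverse hol_J J_nonzero)
  show "hol w0" "hol w1" "hol w2"
    unfolding w_eqs(2-4) by (intro hol_add hol_diff hol_mult hol_divide_const hol_power hol_pd hol_jet_p 1)+
qed

lemma Jw: "z \<in> N \<Longrightarrow> J z * w z = 1" by (simp add: w_def J_nonzero)

lemma pd_w:
  assumes z: "z \<in> N"
  shows "pd_q w z = 0" "pd_p w z = 2 * (i3 z * w z)"
  unfolding w_eqs(1) using z by (simp_all add: pd_inverse J_nonzero pd_J power2_eq_square)

lemma pd_w':
  assumes z: "z \<in> N"
  shows "pd_q (pd_p w) z = 0" "pd_p (pd_p w) z = 2 * J z + 2 * ((i3 z)^2 * w z)"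
proof -
  show "pd_q (pd_p w) z = 0"
    using pd_commute(6)[OF hol_w(1) z] pd_zero(3)[OF pd_w(1) z] by simp
  have "pd_p (pd_p w) z = pd_p (\<lambda>z. 2 * (i3 z * w z)) z"
    by (rule pd_cong[OF pd_w(2) _ z]) simp_all
  also have "\<dots> = 2 * (pd_p i3 z * w z + i3 z * pd_p w z)"
    by (simp add: pd_rules z)
  also have "\<dots> = 2 * J z * (J z * w z) + 2 * ((i3 z)^2 * w z)"
    unfolding J_square'[OF z] pd_w[OF z] by (simp add: algebra_simps power2_eq_square)
  finally show "pd_p (pd_p w) z = 2 * J z + 2 * ((i3 z)^2 * w z)" by (simp add: Jw z)
qed

text \<open>
  \<open>w\<^sub>p\<^sub>p = 2 J + 2 I\<^sub>3\<^sup>2 w\<close> has the \<open>p\<close>-derivative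
  \<open>- 4 I\<^sub>3 J + 4 I\<^sub>3 (J\<^sup>2 - I\<^sub>3\<^sup>2) w + 4 I\<^sub>3\<^sup>3 w\<close>, which vanishes because \<open>J w = 1\<close>.
\<close>
lemma pd_w'':
  assumes z: "z \<in> N"
  shows "pd_q (pd_p (pd_p w)) z = 0" "pd_p (pd_p (pd_p w)) z = 0"
proof -
  show "pd_q (pd_p (pd_p w)) z = 0"
    using pd_commute(6)[OF hol_pd(3)[OF hol_w(1)] z] pd_zero(3)[OF pd_w'(1) z] by simp
  have "pd_p (pd_p (pd_p w)) z = pd_p (\<lambda>z. 2 * J z + 2 * ((i3 z)^2 * w z)) z"
    by (rule pd_cong[OF pd_w'(2) _ z]) simp_all
  also have "\<dots> = 2 * pd_p J z + 2 * (2 * i3 z * pd_p i3 z * w z + (i3 z)^2 * pd_p w z)"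
    by (simp add: pd_rules z)
  also have "\<dots> = 4 * i3 z * J z * (J z * w z - 1)"
    unfolding J_square'[OF z] pd_w[OF z] pd_J[OF z] by (simp add: algebra_simps power2_eq_square)
  finally show "pd_p (pd_p (pd_p w)) z = 0" by (simp add: Jw z)
qed

lemma pd_w012:
  assumes z: "z \<in> N"
  shows "pd_q w0 z = 0" "pd_p w0 z = 0" "pd_q w1 z = 0" "pd_p w1 z = 0" "pd_q w2 z = 0" "pd_p w2 z = 0"
  unfolding w_eqs(2-4)
  by (simp_all add: pd_rules z pd_w(1) pd_w'(1) pd_w'' hol_divide_const hol_mult)

lemma w_quadratic:
  shows "w z = w0 z + w1 z * jet_p z + w2 z * (jet_p z)^2"
  by (simp add: w0_def w1_def w2_def power2_eq_square field_simps)

text \<open>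
  The discriminant is \<open>w\<^sub>p\<^sup>2 - 2 w w\<^sub>p\<^sub>p\<close> at every \<open>p\<close>.
\<close>
lemma w_discriminant:
  assumes z: "z \<in> N" shows "(w1 z)^2 - 4 * w0 z * w2 z = - 4"
proof -
  have "(w1 z)^2 - 4 * w0 z * w2 z = (pd_p w z)^2 - 2 * w z * pd_p (pd_p w) z"
    by (simp add: w0_def w1_def w2_def power2_eq_square field_simps)
  also have "\<dots> = - 4 * (J z * w z)"
    unfolding pd_w'[OF z] pd_w[OF z] by (simp add: power2_eq_square algebra_simps)
  finally show ?thesis by (simp add: Jw z)
qed

end

section \<open>Calculus in the plane\<close>

lemma pld_compose:
  assumes F: "pld F (a w, b w) A B" and a: "pld a w a1 a2" and b: "pld b w b1 b2"
  shows "pld (\<lambda>w. F (a w, b w)) w (A * a1 + B * b1) (A * a2 + B * b2)"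
proof -
  have "((\<lambda>w. (a w, b w)) has_derivative (\<lambda>h. ((\<lambda>(h, k). a1 * h + a2 * k) h, (\<lambda>(h, k). b1 * h + b2 * k) h))) (at w)"
    using a b unfolding pld_def by (intro has_derivative_Pair)
  from has_derivative_compose[OF this, of F "\<lambda>(h, k). A * h + B * k"] F
  show ?thesis unfolding pld_def by (simp add: case_prod_unfold algebra_simps)
qed

lemma pld_const: "pld (\<lambda>w. c) w 0 0"
  unfolding pld_def by (rule has_derivative_eq_rhs, rule has_derivative_const) auto

lemma pld_fst: "pld fst w 1 0" and pld_snd: "pld snd w 0 1"
  unfolding pld_def
  by (rule has_derivative_eq_rhs, rule bounded_linear_imp_has_derivative, rule bounded_linear_fst bounded_linear_snd, force)+

lemma pld_add:
  assumes "pld F w a b" "pld G w a' b'" shows "pld (\<lambda>w. F w + G w) w (a + a') (b + b')"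
  using has_derivative_add[OF assms[unfolded pld_def]] unfolding pld_def
  by (simp add: case_prod_unfold algebra_simps)

lemma pld_mult:
  assumes "pld F w a b" "pld G w a' b'"
  shows "pld (\<lambda>w. F w * G w) w (a * G w + F w * a') (b * G w + F w * b')"
  using has_derivative_mult[OF assms[unfolded pld_def]] unfolding pld_def
  by (simp add: case_prod_unfold algebra_simps)

lemma pld_DERIV:
  assumes "pld F w a b" "(h has_field_derivative k) (at (F w))"
  shows "pld (\<lambda>w. h (F w)) w (k * a) (k * b)"
  using has_derivative_compose[OF assms(1)[unfolded pld_def], of h "(*) k"] assms(2)
  unfolding pld_def has_field_derivative_def by (simp add: case_prod_unfold algebra_simps)

lemma DERIV_pld:
  assumes "pld F (a t, b t) A B" "(a has_field_derivative a') (at t)" "(b has_field_derivative b') (at t)"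
  shows "((\<lambda>t. F (a t, b t)) has_field_derivative A * a' + B * b') (at t)"
proof -
  have "((\<lambda>t. (a t, b t)) has_derivative (\<lambda>h. (a' * h, b' * h))) (at t)"
    using assms(2,3) unfolding has_field_derivative_def by (intro has_derivative_Pair)
  from has_derivative_compose[OF this, of F "\<lambda>(h, k). A * h + B * k"] assms(1)
  have "((\<lambda>t. F (a t, b t)) has_derivative (\<lambda>h. A * (a' * h) + B * (b' * h))) (at t)"
    unfolding pld_def by simp
  moreover have "(\<lambda>h. A * (a' * h) + B * (b' * h)) = (*) (A * a' + B * b')"
    by (simp add: fun_eq_iff algebra_simps)
  ultimately show ?thesis unfolding has_field_derivative_def by simp
qed

lemma holomorphic_plane_pldI:
  assumes "open D" "\<And>w. w \<in> D \<Longrightarrow> pld F w (a w) (b w)"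
  shows "holomorphic_plane F D"
  unfolding holomorphic_plane_pld using assms pld_pl[OF assms(2)] by simp

lemma holomorphic_plane_compose:
  assumes F: "holomorphic_plane F P" and a: "holomorphic_plane a W" and b: "holomorphic_plane b W"
    and sub: "\<And>w. w \<in> W \<Longrightarrow> (a w, b w) \<in> P"
  shows "holomorphic_plane (\<lambda>w. F (a w, b w)) W"
  by (rule holomorphic_plane_pldI[OF holomorphic_planeD(1)[OF a]])
     (rule pld_compose[OF holomorphic_planeD(2)[OF F sub] holomorphic_planeD(2)[OF a] holomorphic_planeD(2)[OF b]])

lemma holomorphic_plane_subset:
  "holomorphic_plane F D \<Longrightarrow> open E \<Longrightarrow> E \<subseteq> D \<Longrightarrow> holomorphic_plane F E"
  unfolding holomorphic_plane_def by blast

section \<open>Integrals and uniform limits of holomorphic functions\<close>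

text \<open>
  Regard the integration variable as a further real coordinate. Then \<open>dpd_continuous\<close>, applied to
  \<open>plane \<times> real\<close>, says that the derivative in the direction \<open>e\<close> is continuous jointly in point and
  parameter, which is what differentiation under the integral sign requires.
\<close>
lemma slice_hol_integral:
  fixes g :: "plane \<times> real \<Rightarrow> complex"
  assumes e: "bounded_linear e" and W: "open W" and g: "continuous_on (W \<times> UNIV) g"
    and s: "\<And>\<theta>. slice_hol e (\<lambda>w. g (w, \<theta>)) W"
  shows "slice_hol e (\<lambda>w. integral (cbox 0 1) (\<lambda>\<theta>. g (w, \<theta>))) W"
  unfolding slice_hol_def
proof
  fix w assume w: "w \<in> W"
  define E :: "complex \<Rightarrow> plane \<times> real" where "E = (\<lambda>t. (e t, 0))"
  have E: "bounded_linear E" unfolding E_def by (intro bounded_linear_Pair e bounded_linear_zero)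
  have WU: "open (W \<times> (UNIV :: real set))" using W by (intro open_Times open_UNIV)
  have sE: "slice_hol E g (W \<times> UNIV)"
    using s unfolding slice_hol_def E_def by auto
  obtain r \<rho> where r: "r > 0" "\<rho> > 0" "\<And>w' t. w' \<in> ball w r \<Longrightarrow> t \<in> cball 0 \<rho> \<Longrightarrow> w' + e t \<in> W"
    using slice_room[OF e W w] by metis
  have in_W: "w + e t \<in> W" if "t \<in> ball 0 \<rho>" for t using r(3)[of w t] r(1) that by auto
  note ec = bounded_linear.continuous_on[OF e]
  have "(\<lambda>t. integral (cbox 0 1) (\<lambda>\<theta>. g (w + e t, \<theta>))) field_differentiable at 0 within ball 0 \<rho>"
  proof (rule leibniz_rule_field_differentiable[where fx = "\<lambda>t \<theta>. dpd E g (w + e t, \<theta>)"])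
    fix t :: complex and \<theta> :: real assume t: "t \<in> ball 0 \<rho>"
    have "((\<lambda>t. g ((w, \<theta>) + E t)) has_field_derivative dpd E g ((w, \<theta>) + E t)) (at t)"
      by (rule slice_has_derivative[OF E sE]) (use in_W[OF t] in \<open>simp add: E_def\<close>)
    then show "((\<lambda>t. g (w + e t, \<theta>)) has_field_derivative dpd E g (w + e t, \<theta>)) (at t within ball 0 \<rho>)"
      by (simp add: E_def has_field_derivative_at_within)
  next
    fix t :: complex assume t: "t \<in> ball 0 \<rho>"
    have "continuous_on (cbox 0 1) (\<lambda>\<theta>. g (w + e t, \<theta>))"
      by (rule continuous_on_compose2[OF g]) (use in_W[OF t] in \<open>auto intro!: continuous_intros\<close>)
    then show "(\<lambda>\<theta>. g (w + e t, \<theta>)) integrable_on cbox 0 1" by (rule integrable_continuous)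
  next
    show "continuous_on (ball 0 \<rho> \<times> cbox 0 1) (\<lambda>(t, \<theta>). dpd E g (w + e t, \<theta>))"
      unfolding case_prod_unfold
      by (rule continuous_on_compose2[OF dpd_continuous[OF E WU g sE]])
         (use in_W in \<open>auto intro!: continuous_intros ec\<close>)
  qed (use r in auto)
  then show "(\<lambda>t. integral (cbox 0 1) (\<lambda>\<theta>. g (w + e t, \<theta>))) field_differentiable at 0"
    using r(2) by (simp add: at_within_open[of 0 "ball 0 \<rho>"])
qed

text \<open>
  The parameter is clamped to the unit interval by \<open>c\<close>, so that the integrand becomes continuous on
  the open set \<open>W \<times> UNIV\<close>.
\<close>
lemma holomorphic_plane_integral:
  fixes g :: "plane \<times> real \<Rightarrow> complex"
  assumes W: "open W" and g: "continuous_on (W \<times> {0..1}) g"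
    and h: "\<And>\<theta>. \<theta> \<in> {0..1} \<Longrightarrow> holomorphic_plane (\<lambda>w. g (w, \<theta>)) W"
  shows "holomorphic_plane (\<lambda>w. integral {0..1} (\<lambda>\<theta>. g (w, \<theta>))) W"
proof -
  define c where "c \<theta> = max 0 (min 1 \<theta>)" for \<theta> :: real
  define G where "G z = g (fst z, c (snd z))" for z
  have c: "c \<theta> \<in> {0..1}" "\<theta> \<in> {0..1} \<Longrightarrow> c \<theta> = \<theta>" for \<theta> by (auto simp: c_def)
  have cc: "continuous_on UNIV c" unfolding c_def by (intro continuous_intros)
  have G: "continuous_on (W \<times> UNIV) G"
    unfolding G_def
    by (rule continuous_on_compose2[OF g])
       (use c in \<open>auto intro!: continuous_intros continuous_on_compose2[OF cc]\<close>)
  have int: "integral {0..1} (\<lambda>\<theta>. g (w, \<theta>)) = integral (cbox 0 1) (\<lambda>\<theta>. G (w, \<theta>))" for w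
    unfolding cbox_interval by (rule integral_cong) (simp add: G_def c)
  have sl: "slice_hol dir_1 (\<lambda>w. G (w, \<theta>)) W" "slice_hol dir_2 (\<lambda>w. G (w, \<theta>)) W" for \<theta>
    using holomorphic_plane_slice[OF h[OF c(1)[of \<theta>]]] by (simp_all add: G_def)
  have "continuous_on W (\<lambda>w. integral (cbox 0 1) (\<lambda>\<theta>. G (w, \<theta>)))"
    by (rule integral_continuous_on_param)
       (use continuous_on_subset[OF G, of "W \<times> cbox 0 1"] in \<open>auto simp: case_prod_unfold\<close>)
  then show ?thesis
    unfolding int
    by (intro holomorphic_planeI W slice_hol_integral[OF bounded_linear_dir_plane(1) W G sl(1)]
        slice_hol_integral[OF bounded_linear_dir_plane(2) W G sl(2)])
qed

lemma slice_hol_uniform_limit: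
  assumes e: "bounded_linear e" and W: "open W"
    and s: "\<And>n. slice_hol e (F n) W" and lim: "uniform_limit W F G sequentially"
  shows "slice_hol e G W"
  unfolding slice_hol_def
proof
  fix w assume w: "w \<in> W"
  obtain r \<rho> where r: "r > 0" "\<rho> > 0" "\<And>w' t. w' \<in> ball w r \<Longrightarrow> t \<in> cball 0 \<rho> \<Longrightarrow> w' + e t \<in> W"
    using slice_room[OF e W w] by metis
  have in_W: "w + e t \<in> W" if "t \<in> ball 0 \<rho>" for t using r(3)[of w t] r(1) that by auto
  have "(\<lambda>t. G (w + e t)) holomorphic_on ball 0 \<rho>"
  proof (rule holomorphic_uniform_sequence[where f = "\<lambda>n t. F n (w + e t)"])
    show "(\<lambda>t. F n (w + e t)) holomorphic_on ball 0 \<rho>" for n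
      unfolding holomorphic_on_def
    proof
      fix t :: complex assume "t \<in> ball 0 \<rho>"
      from slice_has_derivative[OF e s in_W[OF this]]
      show "(\<lambda>t. F n (w + e t)) field_differentiable at t within ball 0 \<rho>"
        by (rule field_differentiable_at_within[OF DERIV_imp_field_differentiable])
    qed
    fix t :: complex assume "t \<in> ball 0 \<rho>"
    then obtain d where d: "d > 0" "cball t d \<subseteq> ball 0 \<rho>" by (meson open_ball open_contains_cball)
    have "uniform_limit (cball t d) (\<lambda>n t. F n (w + e t)) (\<lambda>t. G (w + e t)) sequentially"
      using lim d(2) in_W unfolding uniform_limit_iff
      by (smt (verit, best) eventually_mono subsetD)
    with d show "\<exists>d>0. cball t d \<subseteq> ball 0 \<rho> \<and> uniform_limit (cball t d) (\<lambda>n t. F n (w + e t)) (\<lambda>t. G (w + e t)) sequentially"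
      by blast
  qed auto
  then show "(\<lambda>t. G (w + e t)) field_differentiable at 0"
    using r(2) by (auto intro: holomorphic_on_imp_differentiable_at)
qed

lemma holomorphic_plane_uniform_limit:
  assumes h: "\<And>n::nat. holomorphic_plane (F n) W" and lim: "uniform_limit W F G sequentially"
  shows "holomorphic_plane G W"
proof -
  have W: "open W" using h holomorphic_planeD(1) by blast
  have "continuous_on W G"
    by (rule uniform_limit_theorem[OF always_eventually lim])
       (auto intro: holomorphic_plane_continuous[OF h])
  then show ?thesis
    by (intro holomorphic_planeI W slice_hol_uniform_limit[OF bounded_linear_dir_plane(1) W _ lim]
      slice_hol_uniform_limit[OF bounded_linear_dir_plane(2) W _ lim] holomorphic_plane_slice[OF h])
qed

section \<open>Holomorphic dependence of flows on initial values\<close>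

text \<open>
  The equation \<open>y' = \<kappa>(x, y)\<close> with initial value \<open>y(x0) = v\<close>. The box of radius \<open>R\<close> carries the bounds
  on \<open>\<kappa>\<close>; the radius \<open>r\<close> for time and initial value is so small that the iteration maps into this
  box and contracts by \<open>1/2\<close>. The unknown is a function of both time and initial value.
\<close>
locale picard =
  fixes \<kappa> :: "plane \<Rightarrow> complex" and P :: "plane set" and x0 u0 :: complex and R r M L :: real
  assumes kappa: "holomorphic_plane \<kappa> P"
    and box: "cball x0 R \<times> cball u0 R \<subseteq> P"
    and bound: "\<And>w. w \<in> cball x0 R \<times> cball u0 R \<Longrightarrow> norm (\<kappa> w) \<le> M"
    and lipschitz: "\<And>w. w \<in> cball x0 R \<times> cball u0 R \<Longrightarrow> norm (pl_u \<kappa> w) \<le> L"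
    and r: "0 < r" "r \<le> R / 2" "r * M \<le> R / 2" "r * L \<le> 1 / 2" and L: "0 \<le> L"
begin

text \<open>
  The integral equation is written along the segment from \<open>x0\<close> to \<open>t\<close>, parametrised over the unit
  interval: the domain of integration is then independent of \<open>t\<close>, and holomorphy of the integral is
  differentiation under the integral sign.
\<close>
definition "W = ball x0 r \<times> ball u0 r"
definition seg :: "complex \<Rightarrow> real \<Rightarrow> complex" where "seg t \<theta> = x0 + of_real \<theta> * (t - x0)"
definition rhs :: "(plane \<Rightarrow> complex) \<Rightarrow> plane \<Rightarrow> real \<Rightarrow> complex" where
  "rhs Y w \<theta> = \<kappa> (seg (fst w) \<theta>, Y (seg (fst w) \<theta>, snd w))"
definition T :: "(plane \<Rightarrow> complex) \<Rightarrow> plane \<Rightarrow> complex" where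
  "T Y w = snd w + (fst w - x0) * integral {0..1} (rhs Y w)"
definition admissible :: "(plane \<Rightarrow> complex) \<Rightarrow> bool" where
  "admissible Y \<longleftrightarrow> holomorphic_plane Y W \<and> (\<forall>w\<in>W. Y w \<in> cball u0 R)"

lemma W: "open W" "(x0, u0) \<in> W" unfolding W_def using r by (auto intro: open_Times)

lemma seg_ball: assumes "t \<in> ball x0 r" "\<theta> \<in> {0..1}" shows "seg t \<theta> \<in> ball x0 r"
proof -
  have "norm (of_real \<theta> * (t - x0)) \<le> 1 * norm (t - x0)"
    unfolding norm_mult using assms(2) by (intro mult_right_mono) auto
  then show ?thesis using assms(1) by (simp add: seg_def dist_norm norm_minus_commute)
qed

lemma seg_in:
  assumes "admissible Y" "w \<in> W" "\<theta> \<in> {0..1}"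
  shows "(seg (fst w) \<theta>, snd w) \<in> W" "(seg (fst w) \<theta>, Y (seg (fst w) \<theta>, snd w)) \<in> cball x0 R \<times> cball u0 R"
proof -
  show 1: "(seg (fst w) \<theta>, snd w) \<in> W"
    using seg_ball assms(2,3) by (auto simp: W_def)
  then have "Y (seg (fst w) \<theta>, snd w) \<in> cball u0 R" using assms(1) by (auto simp: admissible_def)
  moreover have "seg (fst w) \<theta> \<in> cball x0 R" using 1 r by (auto simp: W_def)
  ultimately show "(seg (fst w) \<theta>, Y (seg (fst w) \<theta>, snd w)) \<in> cball x0 R \<times> cball u0 R" by simp
qed

lemma integrand:
  assumes Y: "admissible Y"
  shows "continuous_on (W \<times> {0..1}) (\<lambda>(w, \<theta>). rhs Y w \<theta>)"
    "\<theta> \<in> {0..1} \<Longrightarrow> holomorphic_plane (\<lambda>w. rhs Y w \<theta>) W"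
proof -
  have hY: "holomorphic_plane Y W" using Y by (simp add: admissible_def)
  have cs: "continuous_on (W \<times> {0..1}) (\<lambda>z. (seg (fst (fst z)) (snd z), snd (fst z)))"
    unfolding seg_def by (intro continuous_intros)
  have "continuous_on (W \<times> {0..1}) (\<lambda>z. (seg (fst (fst z)) (snd z), Y (seg (fst (fst z)) (snd z), snd (fst z))))"
    by (intro continuous_on_Pair continuous_on_compose2[OF holomorphic_plane_continuous[OF hY] cs])
       (use seg_in(1)[OF Y] in \<open>auto simp: seg_def intro!: continuous_intros\<close>)
  then show "continuous_on (W \<times> {0..1}) (\<lambda>(w, \<theta>). rhs Y w \<theta>)"
    unfolding rhs_def case_prod_unfold
    by (rule continuous_on_compose2[OF holomorphic_plane_continuous[OF kappa]])
       (use seg_in(2)[OF Y] box in force)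
  assume t: "\<theta> \<in> {0..1}"
  have hseg: "holomorphic_plane (\<lambda>w. seg (fst w) \<theta>) W"
  proof (rule holomorphic_plane_pldI[OF W(1)])
    fix w assume "w \<in> W"
    show "pld (\<lambda>w. seg (fst w) \<theta>) w (of_real \<theta> * 1) (of_real \<theta> * 0)"
      unfolding seg_def
      by (rule pld_DERIV[OF pld_fst, where h = "\<lambda>t. x0 + of_real \<theta> * (t - x0)"])
         (auto intro!: derivative_eq_intros)
  qed
  have hsnd: "holomorphic_plane snd W" by (rule holomorphic_plane_pldI[OF W(1) pld_snd])
  have hYs: "holomorphic_plane (\<lambda>w. Y (seg (fst w) \<theta>, snd w)) W"
    by (rule holomorphic_plane_compose[OF hY hseg hsnd]) (rule seg_in(1)[OF Y _ t])
  show "holomorphic_plane (\<lambda>w. rhs Y w \<theta>) W"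
    unfolding rhs_def by (rule holomorphic_plane_compose[OF kappa hseg hYs]) (use seg_in(2)[OF Y _ t] box in blast)
qed

lemma integrand_continuous:
  assumes Y: "admissible Y" and w: "w \<in> W"
  shows "continuous_on {0..1} (rhs Y w)"
proof -
  have "continuous_on {0..1} (\<lambda>\<theta>. (\<lambda>(w, \<theta>). rhs Y w \<theta>) (w, \<theta>))"
    by (rule continuous_on_compose2[OF integrand(1)[OF Y]]) (use w in \<open>auto intro!: continuous_intros\<close>)
  then show ?thesis by simp
qed

lemma T_admissible:
  assumes Y: "admissible Y" shows "admissible (T Y)"
  unfolding admissible_def
proof
  have I: "holomorphic_plane (\<lambda>w. integral {0..1} (rhs Y w)) W"
  proof -
    have "holomorphic_plane (\<lambda>w. integral {0..1} (\<lambda>\<theta>. (\<lambda>(w, \<theta>). rhs Y w \<theta>) (w, \<theta>))) W"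
      by (rule holomorphic_plane_integral[OF W(1) integrand(1)[OF Y]]) (use integrand(2)[OF Y] in simp)
    then show ?thesis by simp
  qed
  show "holomorphic_plane (T Y) W"
    unfolding holomorphic_plane_def pld_def[symmetric]
  proof (intro conjI W ballI)
    fix w assume w: "w \<in> W"
    have fx: "pld (\<lambda>w. fst w - x0) w (1 * 1) (1 * 0)"
      by (rule pld_DERIV[OF pld_fst, where h = "\<lambda>t. t - x0"]) (auto intro!: derivative_eq_intros)
    from pld_add[OF pld_snd pld_mult[OF fx holomorphic_planeD(2)[OF I w]]]
    show "\<exists>a b. pld (T Y) w a b" unfolding T_def by blast
  qed
  show "\<forall>w\<in>W. T Y w \<in> cball u0 R"
  proof
    fix w assume w: "w \<in> W"
    have "norm (integral {0..1} (rhs Y w)) \<le> M * (1 - 0)"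
      by (rule integral_bound[OF _ integrand_continuous[OF Y w]]) (use bound[OF seg_in(2)[OF Y w]] in \<open>auto simp: rhs_def\<close>)
    moreover have "norm (fst w - x0) \<le> r" "norm (snd w - u0) \<le> r"
      using w by (auto simp: W_def dist_norm norm_minus_commute)
    ultimately have "norm (fst w - x0) * norm (integral {0..1} (rhs Y w)) \<le> r * M"
      using r by (intro mult_mono) auto
    then have "norm (T Y w - snd w) \<le> R / 2" using r by (simp add: T_def norm_mult)
    moreover have "norm (T Y w - u0) \<le> norm (T Y w - snd w) + norm (snd w - u0)"
      by (metis diff_add_cancel diff_diff_eq2 add_diff_eq norm_triangle_ineq)
    ultimately have "norm (T Y w - u0) \<le> R" using \<open>norm (snd w - u0) \<le> r\<close> r by linarith
    then show "T Y w \<in> cball u0 R" by (simp add: dist_norm norm_minus_commute)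
  qed
qed

lemma kappa_lipschitz:
  assumes "x \<in> cball x0 R" "u \<in> cball u0 R" "u' \<in> cball u0 R"
  shows "norm (\<kappa> (x, u) - \<kappa> (x, u')) \<le> L * norm (u - u')"
proof (rule field_differentiable_bound[OF convex_cball])
  fix v assume v: "v \<in> cball u0 R"
  then have xv: "(x, v) \<in> cball x0 R \<times> cball u0 R" using assms by simp
  have "pld \<kappa> (x, v) (pl_x \<kappa> (x, v)) (pl_u \<kappa> (x, v))"
    by (rule holomorphic_planeD(2)[OF kappa]) (use xv box in blast)
  from DERIV_pld[of \<kappa> "\<lambda>_. x" v "\<lambda>v. v", OF this DERIV_const DERIV_ident]
  show "((\<lambda>v. \<kappa> (x, v)) has_field_derivative pl_u \<kappa> (x, v)) (at v within cball u0 R)"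
    by (simp add: has_field_derivative_at_within)
  show "norm (pl_u \<kappa> (x, v)) \<le> L" by (rule lipschitz[OF xv])
qed (use assms in auto)

text \<open>
  The integrands differ by at most \<open>L C\<close>, the segment has length at most \<open>r\<close>, and \<open>r L \<le> 1/2\<close>.
\<close>
lemma T_contraction:
  assumes Y: "admissible Y" and Z: "admissible Z" and C: "\<And>w. w \<in> W \<Longrightarrow> norm (Y w - Z w) \<le> C" and w: "w \<in> W"
  shows "norm (T Y w - T Z w) \<le> C / 2"
proof -
  have c: "continuous_on {0..1} (rhs Y w)" "continuous_on {0..1} (rhs Z w)"
    by (rule integrand_continuous[OF Y w] integrand_continuous[OF Z w])+
  have b: "norm (rhs Y w \<theta> - rhs Z w \<theta>) \<le> L * C" if "\<theta> \<in> {0..1}" for \<theta>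
  proof -
    have "norm (rhs Y w \<theta> - rhs Z w \<theta>) \<le> L * norm (Y (seg (fst w) \<theta>, snd w) - Z (seg (fst w) \<theta>, snd w))"
      unfolding rhs_def using seg_in(2)[OF Y w that] seg_in(2)[OF Z w that] by (intro kappa_lipschitz) auto
    also have "\<dots> \<le> L * C" by (intro mult_left_mono C L seg_in(1)[OF Y w that])
    finally show ?thesis .
  qed
  have C0: "0 \<le> C" using C[OF w] norm_ge_zero by (rule order_trans[rotated])
  have "norm (integral {0..1} (\<lambda>\<theta>. rhs Y w \<theta> - rhs Z w \<theta>)) \<le> L * C * (1 - 0)"
    by (rule integral_bound) (auto intro!: continuous_intros c b)
  moreover have "integral {0..1} (\<lambda>\<theta>. rhs Y w \<theta> - rhs Z w \<theta>) = integral {0..1} (rhs Y w) - integral {0..1} (rhs Z w)"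
    by (intro integral_diff integrable_continuous_real c)
  moreover have "T Y w - T Z w = (fst w - x0) * (integral {0..1} (rhs Y w) - integral {0..1} (rhs Z w))"
    unfolding T_def by (simp add: algebra_simps)
  ultimately have "norm (T Y w - T Z w) \<le> norm (fst w - x0) * (L * C)"
    by (simp add: norm_mult mult_left_mono)
  also have "\<dots> \<le> r * (L * C)"
    using w L C0 by (intro mult_right_mono) (auto simp: W_def dist_norm norm_minus_commute)
  also have "\<dots> = (r * L) * C" by simp
  also have "\<dots> \<le> (1/2) * C" by (intro mult_right_mono r C0)
  finally show ?thesis by simp
qed

text \<open>
  The constant flow \<open>(t, v) \<mapsto> v\<close> is the initial guess.
\<close>
definition iter :: "nat \<Rightarrow> plane \<Rightarrow> complex" where "iter n = (T ^^ n) snd"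

lemma iter_Suc: "iter (Suc n) = T (iter n)" and iter_0: "iter 0 = snd" by (simp_all add: iter_def)

lemma iter_admissible: "admissible (iter n)"
proof (induction n)
  case 0
  have "holomorphic_plane snd W" by (rule holomorphic_plane_pldI[OF W(1) pld_snd])
  moreover have "\<forall>w\<in>W. snd w \<in> cball u0 R" using r by (auto simp: W_def)
  ultimately show ?case by (simp add: admissible_def iter_0)
qed (simp add: iter_Suc T_admissible)

lemma iter_step: "w \<in> W \<Longrightarrow> norm (iter (Suc n) w - iter n w) \<le> 2 * R * (1/2)^n"
proof (induction n arbitrary: w)
  case 0
  have "iter 1 w \<in> cball u0 R" "iter 0 w \<in> cball u0 R"
    using iter_admissible 0 by (auto simp: admissible_def)
  then have "dist (iter 1 w) (iter 0 w) \<le> R + R"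
    by (metis dist_commute dist_triangle_le add_mono mem_cball)
  then show ?case by (simp add: dist_norm)
next
  case (Suc n)
  have "norm (T (iter (Suc n)) w - T (iter n) w) \<le> 2 * R * (1/2)^n / 2"
    by (rule T_contraction[OF iter_admissible iter_admissible Suc.IH Suc.prems])
  then show ?case by (simp add: iter_Suc)
qed

lemma iter_limit:
  obtains Y where "uniform_limit W iter Y sequentially"
proof -
  have "uniform_limit W (\<lambda>n w. \<Sum>i<n. iter (Suc i) w - iter i w) (\<lambda>w. \<Sum>i. iter (Suc i) w - iter i w) sequentially"
    by (rule Weierstrass_m_test[where M = "\<lambda>n. 2 * R * (1/2)^n"])
       (auto intro!: iter_step summable_mult summable_geometric)
  then have "uniform_limit W (\<lambda>n w. iter n w - snd w) (\<lambda>w. \<Sum>i. iter (Suc i) w - iter i w) sequentially"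
    by (simp only: sum_lessThan_telescope[of "\<lambda>i. iter i w" for w] iter_0)
  moreover have "uniform_limit W (\<lambda>n. snd) snd sequentially" by (simp add: uniform_limit_iff)
  ultimately have "uniform_limit W (\<lambda>n w. iter n w - snd w + snd w) (\<lambda>w. (\<Sum>i. iter (Suc i) w - iter i w) + snd w) sequentially"
    by (rule uniform_limit_add)
  then show ?thesis using that by simp
qed

lemma fixed_point:
  obtains Y where "admissible Y" "\<And>w. w \<in> W \<Longrightarrow> T Y w = Y w"
proof -
  obtain Y where Y: "uniform_limit W iter Y sequentially" using iter_limit .
  have lim: "(\<lambda>n. iter n w) \<longlonglongrightarrow> Y w" if "w \<in> W" for w
    using tendsto_uniform_limitI[OF Y that] .
  have hY: "holomorphic_plane Y W"
    by (rule holomorphic_plane_uniform_limit[OF _ Y]) (use iter_admissible in \<open>simp add: admissible_def\<close>)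
  have adm: "admissible Y"
    unfolding admissible_def
  proof (intro conjI hY ballI)
    fix w assume w: "w \<in> W"
    show "Y w \<in> cball u0 R"
      by (rule Lim_in_closed_set[OF closed_cball _ _ lim[OF w]])
         (use iter_admissible w in \<open>auto simp: admissible_def\<close>)
  qed
  have "T Y w = Y w" if w: "w \<in> W" for w
  proof (rule LIMSEQ_unique)
    show "(\<lambda>n. iter (Suc n) w) \<longlonglongrightarrow> Y w" using lim[OF w] by (rule LIMSEQ_Suc)
    show "(\<lambda>n. iter (Suc n) w) \<longlonglongrightarrow> T Y w"
    proof (rule tendstoI)
      fix e :: real assume e: "e > 0"
      then have "\<forall>\<^sub>F n in sequentially. \<forall>w\<in>W. dist (iter n w) (Y w) < e"
        using Y unfolding uniform_limit_iff by blast
      then show "\<forall>\<^sub>F n in sequentially. dist (iter (Suc n) w) (T Y w) < e"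
      proof eventually_elim
        case (elim n)
        have "norm (T (iter n) w - T Y w) \<le> e / 2"
          by (rule T_contraction[OF iter_admissible adm _ w]) (use elim in \<open>auto simp: dist_norm less_imp_le\<close>)
        then show ?case using e by (simp add: iter_Suc dist_norm)
      qed
    qed
  qed
  with adm show ?thesis using that by blast
qed

text \<open>
  For fixed initial value the integrand is holomorphic in \<open>t\<close>, hence has a primitive on the disc; the
  integral equation then says that the solution is this primitive up to a constant.
\<close>
lemma solution:
  obtains Y where "holomorphic_plane Y W" "\<And>w. w \<in> W \<Longrightarrow> Y w \<in> cball u0 R"
    "\<And>v. v \<in> ball u0 r \<Longrightarrow> Y (x0, v) = v"
    "\<And>t v. t \<in> ball x0 r \<Longrightarrow> v \<in> ball u0 r \<Longrightarrow> ((\<lambda>t. Y (t, v)) has_field_derivative \<kappa> (t, Y (t, v))) (at t)"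
proof -
  obtain Y where Y: "admissible Y" "\<And>w. w \<in> W \<Longrightarrow> T Y w = Y w" using fixed_point by blast
  have hY: "holomorphic_plane Y W" using Y by (simp add: admissible_def)
  have x0: "x0 \<in> ball x0 r" using r by simp
  show ?thesis
  proof (rule that[OF hY])
    show "Y w \<in> cball u0 R" if "w \<in> W" for w using Y that by (simp add: admissible_def)
    show "Y (x0, v) = v" if "v \<in> ball u0 r" for v
      using Y(2)[of "(x0, v)"] that r by (simp add: W_def T_def)
    fix t v assume t: "t \<in> ball x0 r" and v: "v \<in> ball u0 r"
    define h where "h s = \<kappa> (s, Y (s, v))" for s
    have Dh: "h field_differentiable (at s)" if s: "s \<in> ball x0 r" for s
    proof -
      have w: "(s, v) \<in> W" using s v by (simp add: W_def)
      then have "(s, Y (s, v)) \<in> P"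
        using Y(1) box s r by (force simp: admissible_def W_def)
      from holomorphic_planeD(2)[OF kappa this]
      show ?thesis
        unfolding h_def
        using DERIV_pld[of \<kappa> "\<lambda>s. s" s "\<lambda>s. Y (s, v)", OF _ DERIV_ident
          DERIV_pld[of Y "\<lambda>s. s" s "\<lambda>_. v", OF holomorphic_planeD(2)[OF hY w] DERIV_ident DERIV_const]]
        by (blast intro: DERIV_imp_field_differentiable)
    qed
    have "h holomorphic_on ball x0 r"
      unfolding holomorphic_on_def using Dh field_differentiable_at_within by blast
    then obtain H where H: "\<And>s. s \<in> ball x0 r \<Longrightarrow> (H has_field_derivative h s) (at s within ball x0 r)"
      using holomorphic_convex_primitive'[OF convex_ball open_ball] by blast
    have H': "(H has_field_derivative h s) (at s)" if "s \<in> ball x0 r" for s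
      using H[OF that] at_within_open[OF that open_ball] by simp
    have YH: "Y (s, v) = v + (H s - H x0)" if s: "s \<in> ball x0 r" for s
    proof -
      have w: "(s, v) \<in> W" using s v by (simp add: W_def)
      have "((\<lambda>\<theta>. (s - x0) * h (seg s \<theta>)) has_integral (H (seg s 1) - H (seg s 0))) {0..1}"
      proof (rule fundamental_theorem_of_calculus)
        fix \<theta> :: real assume th: "\<theta> \<in> {0..1}"
        have "(seg s has_vector_derivative (s - x0)) (at \<theta> within {0..1})"
          unfolding seg_def by (auto intro!: derivative_eq_intros)
        from field_vector_diff_chain_within[OF this has_field_derivative_at_within[OF H'[OF seg_ball[OF s th]]]]
        show "((\<lambda>\<theta>. H (seg s \<theta>)) has_vector_derivative (s - x0) * h (seg s \<theta>)) (at \<theta> within {0..1})"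
          by (simp add: o_def)
      qed simp
      then have "(s - x0) * integral {0..1} (\<lambda>\<theta>. h (seg s \<theta>)) = H s - H x0"
        by (simp add: integral_unique seg_def flip: integral_mult_right)
      then show ?thesis using Y(2)[OF w] by (simp add: T_def rhs_def[abs_def] h_def)
    qed
    have "((\<lambda>s. v + (H s - H x0)) has_field_derivative h t) (at t)"
      by (auto intro!: derivative_eq_intros H'[OF t])
    then have "((\<lambda>s. Y (s, v)) has_field_derivative h t) (at t)"
      by (rule has_field_derivative_transform_within_open[OF _ open_ball t]) (simp add: YH)
    then show "((\<lambda>t. Y (t, v)) has_field_derivative \<kappa> (t, Y (t, v))) (at t)" by (simp add: h_def)
  qed
qed

end

text \<open>
  Near each point of the domain a compact box supplies bounds on \<open>\<kappa>\<close> and its \<open>u\<close>-derivative, and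
  these determine a radius for the Picard iteration.
\<close>
lemma holomorphic_flow:
  assumes kappa: "holomorphic_plane \<kappa> P" and w0: "(x0, u0) \<in> P"
  obtains r Y where "r > 0" "holomorphic_plane Y (ball x0 r \<times> ball u0 r)"
    "\<And>t v. t \<in> ball x0 r \<Longrightarrow> v \<in> ball u0 r \<Longrightarrow> (t, Y (t, v)) \<in> P"
    "\<And>v. v \<in> ball u0 r \<Longrightarrow> Y (x0, v) = v"
    "\<And>t v. t \<in> ball x0 r \<Longrightarrow> v \<in> ball u0 r \<Longrightarrow> ((\<lambda>t. Y (t, v)) has_field_derivative \<kappa> (t, Y (t, v))) (at t)"
proof -
  obtain A B where AB: "open A" "open B" "x0 \<in> A" "u0 \<in> B" "A \<times> B \<subseteq> P"
    using holomorphic_planeD(1)[OF kappa] w0 open_prod_elim by (metis mem_Sigma_iff)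
  obtain R1 where R1: "R1 > 0" "cball x0 R1 \<subseteq> A" using AB by (meson open_contains_cball)
  obtain R2 where R2: "R2 > 0" "cball u0 R2 \<subseteq> B" using AB by (meson open_contains_cball)
  define R where "R = min R1 R2"
  have R: "R > 0" using R1 R2 by (simp add: R_def)
  have box: "cball x0 R \<times> cball u0 R \<subseteq> P"
    using R1 R2 AB subset_cball[of R R1 x0] subset_cball[of R R2 u0] by (force simp: R_def)
  have cpt: "compact (cball x0 R \<times> cball u0 R)" by (intro compact_Times compact_cball)
  have bdd: "\<exists>M>0. \<forall>w\<in>cball x0 R \<times> cball u0 R. norm (F w) \<le> M" if "holomorphic_plane F P" for F
  proof -
    have "bounded (F ` (cball x0 R \<times> cball u0 R))"
      by (intro compact_imp_bounded compact_continuous_image cpt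
          continuous_on_subset[OF holomorphic_plane_continuous[OF that] box])
    then show ?thesis unfolding bounded_pos by auto
  qed
  obtain M where M: "M > 0" "\<forall>w\<in>cball x0 R \<times> cball u0 R. norm (\<kappa> w) \<le> M" using bdd[OF kappa] by blast
  obtain L where L: "L > 0" "\<forall>w\<in>cball x0 R \<times> cball u0 R. norm (pl_u \<kappa> w) \<le> L"
    using bdd[OF holomorphic_plane_pl(2)[OF kappa]] by blast
  define r where "r = min (R / 2) (min (R / (2 * M)) (1 / (2 * L)))"
  have rM: "r * M \<le> R / (2 * M) * M" using M by (intro mult_right_mono) (auto simp: r_def)
  have rL: "r * L \<le> 1 / (2 * L) * L" using L by (intro mult_right_mono) (auto simp: r_def)
  have r0: "0 < r" "r \<le> R / 2" using M L R by (auto simp: r_def)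
  interpret picard \<kappa> P x0 u0 R r M L
    by unfold_locales (use kappa box M L r0 rM rL in \<open>auto simp: less_imp_le\<close>)
  obtain Y where Y: "holomorphic_plane Y W" "\<And>w. w \<in> W \<Longrightarrow> Y w \<in> cball u0 R"
    "\<And>v. v \<in> ball u0 r \<Longrightarrow> Y (x0, v) = v"
    "\<And>t v. t \<in> ball x0 r \<Longrightarrow> v \<in> ball u0 r \<Longrightarrow> ((\<lambda>t. Y (t, v)) has_field_derivative \<kappa> (t, Y (t, v))) (at t)"
    using solution by blast
  show ?thesis
  proof (rule that[OF r0(1) _ _ Y(3,4)])
    show "holomorphic_plane Y (ball x0 r \<times> ball u0 r)" using Y(1) by (simp add: W_def)
    show "(t, Y (t, v)) \<in> P" if "t \<in> ball x0 r" "v \<in> ball u0 r" for t v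
      using Y(2)[of "(t, v)"] that box r0 R by (force simp: W_def)
  qed
qed

section \<open>First integrals of direction fields\<close>

definition factors_through :: "(plane \<Rightarrow> complex) \<Rightarrow> plane \<Rightarrow> (plane \<Rightarrow> complex) \<Rightarrow> bool" where
  "factors_through \<psi> w0 k \<longleftrightarrow> (\<exists>\<rho> g E. \<rho> > 0 \<and> g holomorphic_on ball (\<psi> w0) \<rho> \<and> open E \<and> w0 \<in> E \<and>
     (\<forall>w\<in>E. \<psi> w \<in> ball (\<psi> w0) \<rho> \<and> k w = g (\<psi> w)))"

text \<open>
  Near \<open>w0\<close>, every holomorphic function with differential proportional to that of \<open>\<psi>\<close> is a
  holomorphic function of \<open>\<psi>\<close>. The domain of \<open>k\<close> may be arbitrarily small.
\<close>
definition separates :: "(plane \<Rightarrow> complex) \<Rightarrow> plane \<Rightarrow> bool" where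
  "separates \<psi> w0 \<longleftrightarrow> (\<forall>k E. holomorphic_plane k E \<longrightarrow> w0 \<in> E \<longrightarrow>
     (\<forall>w\<in>E. pl_u k w * pl_x \<psi> w = pl_u \<psi> w * pl_x k w) \<longrightarrow> factors_through \<psi> w0 k)"

text \<open>
  The flow map \<open>\<Phi> (t, v) = (t, Y(t, v))\<close> straightens the direction field \<open>du / dx = \<kappa>\<close>. It is
  the identity on the line \<open>t = x0\<close>, so its derivative at \<open>w0\<close> is invertible; the second component of
  the inverse assigns to a point the initial value of the solution through it and is a first
  integral \<open>\<psi>\<close>. A function \<open>k\<close> annihilated by the direction field is constant along solutions,
  hence determined by its values on the line \<open>t = x0\<close>, which are parametrised by \<open>\<psi>\<close>.
\<close>
lemma first_integral_graph:
  assumes kappa: "holomorphic_plane \<kappa> P" and w0: "w0 \<in> P"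
  obtains D \<psi> where "holomorphic_plane \<psi> D" "w0 \<in> D"
    "\<And>w. w \<in> D \<Longrightarrow> w \<in> P \<and> pl_x \<psi> w = - \<kappa> w * pl_u \<psi> w \<and> pl_u \<psi> w \<noteq> 0"
    "separates \<psi> w0"
proof -
  obtain x0 u0 where w0_eq: "w0 = (x0, u0)" by (cases w0)
  obtain r Y where r: "r > 0" and Y: "holomorphic_plane Y (ball x0 r \<times> ball u0 r)"
    and YP: "\<And>t v. t \<in> ball x0 r \<Longrightarrow> v \<in> ball u0 r \<Longrightarrow> (t, Y (t, v)) \<in> P"
    and Y0: "\<And>v. v \<in> ball u0 r \<Longrightarrow> Y (x0, v) = v"
    and Yt: "\<And>t v. t \<in> ball x0 r \<Longrightarrow> v \<in> ball u0 r \<Longrightarrow> ((\<lambda>t. Y (t, v)) has_field_derivative \<kappa> (t, Y (t, v))) (at t)"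
    using holomorphic_flow[OF kappa w0[unfolded w0_eq]] by blast
  define W where "W = ball x0 r \<times> ball u0 r"
  have W: "open W" "w0 \<in> W" using r by (auto simp: W_def w0_eq open_Times)
  note YW = Y[folded W_def]
  define \<Phi> where "\<Phi> w = (fst w, Y w)" for w
  \<comment> \<open>The derivative \<open>F\<close> of \<open>\<Phi>\<close> has the rows \<open>(1, 0)\<close> and \<open>(pl_x Y, pl_u Y)\<close>.\<close>
  have Yx: "pl_x Y (t, v) = \<kappa> (t, Y (t, v))" if "(t, v) \<in> W" for t v
  proof -
    have "((\<lambda>t. Y (t, v)) has_field_derivative pl_x Y (t, v) * 1 + pl_u Y (t, v) * 0) (at t)"
      by (rule DERIV_pld[of Y "\<lambda>t. t" t "\<lambda>_. v"]) (use holomorphic_planeD(2)[OF YW that] in \<open>auto intro!: derivative_eq_intros\<close>)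
    moreover have "((\<lambda>t. Y (t, v)) has_field_derivative \<kappa> (t, Y (t, v))) (at t)"
      using that by (intro Yt) (auto simp: W_def)
    ultimately show ?thesis using DERIV_unique by fastforce
  qed
  have Yu0: "pl_u Y w0 = 1"
  proof -
    have "((\<lambda>v. Y (x0, v)) has_field_derivative pl_x Y w0 * 0 + pl_u Y w0 * 1) (at u0)"
      by (rule DERIV_pld[of Y "\<lambda>_. x0" u0 "\<lambda>v. v"])
         (use holomorphic_planeD(2)[OF YW W(2)] in \<open>auto simp: w0_eq intro!: derivative_eq_intros\<close>)
    moreover have "((\<lambda>v. Y (x0, v)) has_field_derivative 1) (at u0)"
      by (rule has_field_derivative_transform_within_open[OF DERIV_ident open_ball, of _ u0 r]) (use r Y0 in auto)
    ultimately show ?thesis using DERIV_unique by fastforce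
  qed
  define F where "F w = Blinfun (\<lambda>(h, k). (h, pl_x Y w * h + pl_u Y w * k))" for w
  have bl: "bounded_linear (\<lambda>(h, k). (h, a * h + b * k))" for a b :: complex
    unfolding case_prod_unfold by (intro bounded_linear_intros)
  have F: "blinfun_apply (F w) (h, k) = (h, pl_x Y w * h + pl_u Y w * k)" for w h k
    unfolding F_def by (simp add: bounded_linear_Blinfun_apply[OF bl])
  have dF: "(\<Phi> has_derivative blinfun_apply (F w)) (at w)" if "w \<in> W" for w
  proof -
    have "((\<lambda>w. (fst w, Y w)) has_derivative (\<lambda>h. (fst h, (\<lambda>(h, k). pl_x Y w * h + pl_u Y w * k) h))) (at w)"
      using holomorphic_planeD(2)[OF YW that] unfolding pld_def
      by (intro has_derivative_Pair bounded_linear_imp_has_derivative bounded_linear_fst)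
    moreover have "blinfun_apply (F w) = (\<lambda>h. (fst h, (\<lambda>(h, k). pl_x Y w * h + pl_u Y w * k) h))"
      using F[of w] by (auto simp: fun_eq_iff)
    ultimately show ?thesis by (simp add: \<Phi>_def[abs_def])
  qed
  have cF: "continuous_on W F"
  proof -
    have cc: "continuous_on W (pl_x Y)" "continuous_on W (pl_u Y)"
      using holomorphic_plane_continuous holomorphic_plane_pl[OF YW] by blast+
    have "isCont F w" if w: "w \<in> W" for w
    proof (rule continuous_blinfun_componentwiseI)
      fix i j :: plane
      have "continuous_on W (\<lambda>x. (fst j, pl_x Y x * fst j + pl_u Y x * snd j) \<bullet> i)"
        by (intro continuous_intros cc)
      then have "isCont (\<lambda>x. (fst j, pl_x Y x * fst j + pl_u Y x * snd j) \<bullet> i) w"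
        using w W continuous_on_eq_continuous_at by blast
      moreover have "(\<lambda>x. (fst j, pl_x Y x * fst j + pl_u Y x * snd j) \<bullet> i) = (\<lambda>x. blinfun_apply (F x) j \<bullet> i)"
        using F[of _ "fst j" "snd j"] by simp
      ultimately show "isCont (\<lambda>x. blinfun_apply (F x) j \<bullet> i) w" by simp
    qed
    then show ?thesis by (simp add: continuous_at_imp_continuous_on)
  qed
  \<comment> \<open>The inverse of the derivative at \<open>w0\<close>, where \<open>pl_u Y = 1\<close>.\<close>
  define G where "G = Blinfun (\<lambda>(h, k). (h, - pl_x Y w0 * h + 1 * k))"
  have Gap: "blinfun_apply G (h, k) = (h, - pl_x Y w0 * h + k)" for h k
    unfolding G_def bounded_linear_Blinfun_apply[OF bl] by simp
  have GF: "G o\<^sub>L F w0 = id_blinfun"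
  proof (rule blinfun_eqI)
    fix i :: plane
    show "blinfun_apply (G o\<^sub>L F w0) i = blinfun_apply id_blinfun i"
      using F[of w0 "fst i" "snd i"] Gap by (simp add: Yu0)
  qed
  obtain U' V g g' where U': "open U'" "U' \<subseteq> W" "w0 \<in> U'" and V: "open V" "\<Phi> w0 \<in> V"
    and hom: "homeomorphism U' V \<Phi> g"
    and g': "\<And>y. y \<in> V \<Longrightarrow> (g has_derivative (g' y)) (at y)"
      "\<And>y. y \<in> V \<Longrightarrow> g' y = inv (blinfun_apply (F (g y)))"
      "\<And>y. y \<in> V \<Longrightarrow> bij (blinfun_apply (F (g y)))"
    using inverse_function_theorem[OF W(1) dF cF W(2) GF] by metis
  have gU: "g y \<in> U'" "\<Phi> (g y) = y" if "y \<in> V" for y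
    using hom that by (auto simp: homeomorphism_def)
  have g\<Phi>: "\<Phi> w \<in> V" "g (\<Phi> w) = w" if "w \<in> U'" for w
    using hom that by (auto simp: homeomorphism_def)
  have \<Phi>w0: "\<Phi> w0 = w0" using r Y0 by (simp add: \<Phi>_def w0_eq)
  define \<psi> where "\<psi> y = snd (g y)" for y
  have gw0: "g w0 = w0" using g\<Phi>(2)[OF U'(3)] \<Phi>w0 by simp
  have psi: "pl_u Y (g y) \<noteq> 0 \<and> y \<in> P \<and> pld \<psi> y (- \<kappa> y / pl_u Y (g y)) (1 / pl_u Y (g y))" if y: "y \<in> V" for y
  proof -
    have gW: "g y \<in> W" using gU(1)[OF y] U'(2) by blast
    obtain t v where tv: "g y = (t, v)" by (cases "g y")
    have y_eq: "y = (t, Y (t, v))" using gU(2)[OF y] by (simp add: tv \<Phi>_def)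
    have "pl_x Y (t, v) = \<kappa> (t, Y (t, v))" using Yx gW tv by simp
    then have a: "pl_x Y (g y) = \<kappa> y" unfolding tv using y_eq by simp
    have inj: "inj (blinfun_apply (F (g y)))" using g'(3)[OF y] by (rule bij_is_inj)
    have b: "pl_u Y (g y) \<noteq> 0"
    proof
      assume "pl_u Y (g y) = 0"
      then have "blinfun_apply (F (g y)) (0, 1) = blinfun_apply (F (g y)) (0, 0)" by (simp add: F)
      from injD[OF inj this] show False by simp
    qed
    have "g' y (h, k) = (h, - \<kappa> y / pl_u Y (g y) * h + 1 / pl_u Y (g y) * k)" for h k
      unfolding g'(2)[OF y]
      by (rule inv_f_eq[OF inj]) (use b in \<open>simp add: F a field_simps\<close>)
    then have "(\<lambda>z. snd (g' y z)) = (\<lambda>(h, k). - \<kappa> y / pl_u Y (g y) * h + 1 / pl_u Y (g y) * k)"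
      by auto
    moreover have "(\<psi> has_derivative (\<lambda>z. snd (g' y z))) (at y)"
      unfolding \<psi>_def[abs_def] by (rule has_derivative_snd[OF g'(1)[OF y]])
    moreover have "(t, Y (t, v)) \<in> P" using YP gW[unfolded tv W_def] by simp
    then have "y \<in> P" using y_eq by simp
    ultimately show ?thesis using b \<open>y \<in> P\<close> by (simp add: pld_def)
  qed
  have hpsi: "holomorphic_plane \<psi> V"
    by (rule holomorphic_plane_pldI[OF V(1)]) (use psi in blast)
  show ?thesis
  proof (rule that[OF hpsi])
    show "w0 \<in> V" using V \<Phi>w0 by simp
    show on_V: "w \<in> P \<and> pl_x \<psi> w = - \<kappa> w * pl_u \<psi> w \<and> pl_u \<psi> w \<noteq> 0" if "w \<in> V" for w
    proof -
      have q: "pl_u Y (g w) \<noteq> 0" "w \<in> P" "pld \<psi> w (- \<kappa> w / pl_u Y (g w)) (1 / pl_u Y (g w))"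
        using psi[OF that] by blast+
      then show ?thesis using pld_pl[OF q(3)] by simp
    qed
    have "factors_through \<psi> w0 k"
      if k: "holomorphic_plane k E" "w0 \<in> E" and kt: "\<And>w. w \<in> E \<Longrightarrow> pl_x k w = - \<kappa> w * pl_u k w" for k E
    proof -
    have E: "open E" using k holomorphic_planeD(1) by blast
    have c\<Phi>: "continuous_on U' \<Phi>" and cg: "continuous_on V g" using hom by (auto simp: homeomorphism_def)
    have "open (\<Phi> -` E \<inter> U')" using c\<Phi> E U'(1) by (simp add: continuous_on_open_vimage)
    moreover have "w0 \<in> \<Phi> -` E \<inter> U'" using k(2) U' \<Phi>w0 by simp
    ultimately obtain A B where AB: "open A" "open B" "x0 \<in> A" "u0 \<in> B" "A \<times> B \<subseteq> \<Phi> -` E \<inter> U'"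
      unfolding w0_eq by (metis open_prod_elim mem_Sigma_iff)
    obtain \<rho>1 where \<rho>1: "\<rho>1 > 0" "ball x0 \<rho>1 \<subseteq> A" using AB by (meson open_contains_ball)
    obtain \<rho> where \<rho>: "\<rho> > 0" "ball u0 \<rho> \<subseteq> B" using AB by (meson open_contains_ball)
    have box: "\<Phi> (t, v) \<in> E \<and> (t, v) \<in> U'" if "t \<in> ball x0 \<rho>1" "v \<in> ball u0 \<rho>" for t v
      using that \<rho>1 \<rho> AB by blast
    define h where "h v = k (x0, v)" for v
    have ph: "\<psi> w0 = u0" by (simp add: \<psi>_def gw0) (simp add: w0_eq)
    have hh: "h holomorphic_on ball u0 \<rho>"
      unfolding holomorphic_on_def
    proof
      fix v assume v: "v \<in> ball u0 \<rho>"
      have "\<Phi> (x0, v) \<in> E" "(x0, v) \<in> W" using box[OF _ v, of x0] \<rho>1 U' by auto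
      then have "(x0, v) \<in> E" using Y0 by (simp add: \<Phi>_def W_def)
      from DERIV_pld[of k "\<lambda>_. x0" v "\<lambda>v. v", OF holomorphic_planeD(2)[OF k(1) this] DERIV_const DERIV_ident]
      show "h field_differentiable (at v within ball u0 \<rho>)"
        unfolding h_def by (blast intro: field_differentiable_at_within DERIV_imp_field_differentiable)
    qed
    \<comment> \<open>Along a solution the derivative of \<open>k\<close> is \<open>pl_x k + \<kappa> pl_u k = 0\<close>.\<close>
    have const: "k (\<Phi> (t, v)) = h v" if t: "t \<in> ball x0 \<rho>1" and v: "v \<in> ball u0 \<rho>" for t v
    proof -
      have "((\<lambda>t. k (t, Y (t, v))) has_field_derivative 0) (at s within ball x0 \<rho>1)" if s: "s \<in> ball x0 \<rho>1" for s
      proof -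
        have sE: "(s, Y (s, v)) \<in> E" and sW: "(s, v) \<in> W" using box[OF s v] U' by (auto simp: \<Phi>_def)
        have "((\<lambda>t. Y (t, v)) has_field_derivative \<kappa> (s, Y (s, v))) (at s)"
          using sW by (intro Yt) (auto simp: W_def)
        from DERIV_pld[of k "\<lambda>t. t" s "\<lambda>t. Y (t, v)", OF holomorphic_planeD(2)[OF k(1) sE] DERIV_ident this]
        show ?thesis using kt[OF sE] by (simp add: has_field_derivative_at_within mult.commute)
      qed
      from has_field_derivative_zero_constant[OF convex_ball this]
      obtain c where c: "\<And>s. s \<in> ball x0 \<rho>1 \<Longrightarrow> k (s, Y (s, v)) = c" by blast
      have "(x0, v) \<in> W" using box[of x0 v] \<rho>1 v U' by auto
      then have "k (x0, Y (x0, v)) = h v" using Y0 by (simp add: h_def W_def)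
      then show ?thesis using c[OF t] c[of x0] \<rho>1 by (simp add: \<Phi>_def)
    qed
    define E' where "E' = g -` (ball x0 \<rho>1 \<times> ball u0 \<rho>) \<inter> V"
    have E': "open E'" unfolding E'_def
      using cg V(1) by (metis continuous_on_open_vimage open_Times open_ball)
    have "\<psi> w \<in> ball u0 \<rho> \<and> k w = h (\<psi> w)" if w: "w \<in> E'" for w
    proof -
      have gw: "fst (g w) \<in> ball x0 \<rho>1" "snd (g w) \<in> ball u0 \<rho>" "w \<in> V"
        using w by (auto simp: E'_def mem_Times_iff)
      have "k w = k (\<Phi> (fst (g w), snd (g w)))" using gU(2)[OF gw(3)] by simp
      also have "\<dots> = h (\<psi> w)" unfolding \<psi>_def by (rule const[OF gw(1,2)])
      finally show ?thesis using gw(2) by (simp add: \<psi>_def)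
    qed
    moreover have "w0 \<in> E'" using gw0 \<rho>1 \<rho> V \<Phi>w0 by (simp add: E'_def w0_eq)
    ultimately show "factors_through \<psi> w0 k"
      using \<rho>(1) hh E' unfolding ph factors_through_def by blast
    qed
    note main = this
    show "separates \<psi> w0"
      unfolding separates_def
    proof (intro allI impI)
      fix k E assume k: "holomorphic_plane k E" "w0 \<in> E" "\<forall>w\<in>E. pl_u k w * pl_x \<psi> w = pl_u \<psi> w * pl_x k w"
      have "open (E \<inter> V)" using holomorphic_planeD(1)[OF k(1)] V(1) by (rule open_Int)
      then have kEV: "holomorphic_plane k (E \<inter> V)" by (rule holomorphic_plane_subset[OF k(1)]) auto
      show "factors_through \<psi> w0 k"
      proof (rule main[OF kEV])
        fix w assume w: "w \<in> E \<inter> V"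
        then have V': "pl_x \<psi> w = - \<kappa> w * pl_u \<psi> w" "pl_u \<psi> w \<noteq> 0" using on_V by blast+
        have "pl_u \<psi> w * pl_x k w = pl_u k w * pl_x \<psi> w" using k(3) w by simp
        also have "\<dots> = pl_u \<psi> w * (- \<kappa> w * pl_u k w)" unfolding V'(1) by simp
        finally have "pl_u \<psi> w * pl_x k w = pl_u \<psi> w * (- \<kappa> w * pl_u k w)" .
        with V'(2) show "pl_x k w = - \<kappa> w * pl_u k w" by (metis mult_cancel_left)
      qed (use k(2) V \<Phi>w0 in simp)
    qed
  qed
qed

lemma pl_swap:
  "pl_x (\<lambda>w. F (snd w, fst w)) w = pl_u F (snd w, fst w)"
  "pl_u (\<lambda>w. F (snd w, fst w)) w = pl_x F (snd w, fst w)"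
  unfolding pl_x_def pl_u_def dpd_def dir_1_def dir_2_def by simp_all

lemma holomorphic_plane_swap:
  assumes "holomorphic_plane F D"
  shows "holomorphic_plane (\<lambda>w. F (snd w, fst w)) ((\<lambda>w. (snd w, fst w)) -` D)"
proof (rule holomorphic_plane_pldI)
  show "open ((\<lambda>w::plane. (snd w, fst w)) -` D)"
    by (intro open_vimage holomorphic_planeD(1)[OF assms] continuous_intros)
  fix w :: plane assume "w \<in> (\<lambda>w. (snd w, fst w)) -` D"
  then have "pld F (snd w, fst w) (pl_x F (snd w, fst w)) (pl_u F (snd w, fst w))"
    using holomorphic_planeD(2)[OF assms] by simp
  from pld_compose[of F snd w fst, OF this pld_snd pld_fst]
  show "pld (\<lambda>w. F (snd w, fst w)) w (pl_u F (snd w, fst w)) (pl_x F (snd w, fst w))" by simp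
qed

lemma separates_swap:
  assumes "separates \<psi> (snd w0, fst w0)"
  shows "separates (\<lambda>w. \<psi> (snd w, fst w)) w0"
  unfolding separates_def
proof (intro allI impI)
  let ?s = "\<lambda>w::plane. (snd w, fst w)"
  fix k E assume k: "holomorphic_plane k E" "w0 \<in> E"
    and tr: "\<forall>w\<in>E. pl_u k w * pl_x (\<lambda>w. \<psi> (?s w)) w = pl_u (\<lambda>w. \<psi> (?s w)) w * pl_x k w"
  have "\<forall>w\<in>?s -` E. pl_u (\<lambda>w. k (?s w)) w * pl_x \<psi> w = pl_u \<psi> w * pl_x (\<lambda>w. k (?s w)) w"
    unfolding pl_swap
  proof
    fix w assume "w \<in> ?s -` E"
    then show "pl_x k (?s w) * pl_x \<psi> w = pl_u \<psi> w * pl_u k (?s w)"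
      using tr[unfolded pl_swap, rule_format, of "?s w"] by (simp add: mult.commute)
  qed
  then have "factors_through \<psi> (?s w0) (\<lambda>w. k (?s w))"
    using assms holomorphic_plane_swap[OF k(1)] k(2) unfolding separates_def by simp
  then obtain \<rho> g E' where E': "\<rho> > 0" "g holomorphic_on ball (\<psi> (?s w0)) \<rho>" "open E'" "?s w0 \<in> E'"
     "\<forall>w\<in>E'. \<psi> w \<in> ball (\<psi> (?s w0)) \<rho> \<and> k (?s w) = g (\<psi> w)" unfolding factors_through_def by blast
  show "factors_through (\<lambda>w. \<psi> (?s w)) w0 k"
    unfolding factors_through_def
    by (rule exI[of _ \<rho>], rule exI[of _ g], rule exI[of _ "?s -` E'"])
       (use E' in \<open>auto intro!: open_vimage continuous_intros\<close>)
qed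

lemma holomorphic_plane_quotient:
  assumes a: "holomorphic_plane a D" and b: "holomorphic_plane b D"
  shows "holomorphic_plane (\<lambda>w. a w / b w) {w \<in> D. b w \<noteq> 0}"
proof -
  have "open {w \<in> D. b w \<noteq> 0}"
    using continuous_open_preimage[OF holomorphic_plane_continuous[OF b] holomorphic_planeD(1)[OF b], of "- {0}"]
    by (simp add: vimage_def Int_def open_Compl)
  moreover have "\<exists>a' b'. pld (\<lambda>w. a w / b w) w a' b'" if "w \<in> D" "b w \<noteq> 0" for w
  proof -
    have "pld (\<lambda>w. inverse (b w)) w (- inverse ((b w)^2) * pl_x b w) (- inverse ((b w)^2) * pl_u b w)"
      by (rule pld_DERIV[OF holomorphic_planeD(2)[OF b that(1)]])
         (use that in \<open>auto intro!: derivative_eq_intros simp: power2_eq_square\<close>)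
    from pld_mult[OF holomorphic_planeD(2)[OF a that(1)] this]
    show ?thesis unfolding divide_inverse by blast
  qed
  ultimately show ?thesis unfolding holomorphic_plane_def pld_def[symmetric] by blast
qed

lemma holomorphic_plane_minus:
  assumes "holomorphic_plane F D" shows "holomorphic_plane (\<lambda>w. - F w) D"
  by (rule holomorphic_plane_pldI[OF holomorphic_planeD(1)[OF assms]])
     (rule pld_DERIV[OF holomorphic_planeD(2)[OF assms], where h = uminus], auto intro!: derivative_eq_intros)

text \<open>
  The differential of \<open>\<psi>\<close> is proportional to \<open>a dx + b du\<close>. Working with the pair \<open>(a, b)\<close> rather than
  with a slope treats vertical and non-vertical level curves alike.
\<close>
lemma first_integral:
  assumes a: "holomorphic_plane a P" and b: "holomorphic_plane b P" and w0: "w0 \<in> P" and nz: "a w0 \<noteq> 0 \<or> b w0 \<noteq> 0"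
  obtains D \<psi> where "holomorphic_plane \<psi> D" "w0 \<in> D"
    "\<And>w. w \<in> D \<Longrightarrow> w \<in> P \<and> (\<exists>\<mu>. \<mu> \<noteq> 0 \<and> pl_x \<psi> w = \<mu> * a w \<and> pl_u \<psi> w = \<mu> * b w)"
    "separates \<psi> w0"
proof (cases "b w0 = 0")
  case False
  define \<kappa> where "\<kappa> w = (- a w) / b w" for w
  define Q where "Q = {w \<in> P. b w \<noteq> 0}"
  have \<kappa>: "holomorphic_plane \<kappa> Q"
    unfolding \<kappa>_def[abs_def] Q_def by (rule holomorphic_plane_quotient[OF holomorphic_plane_minus[OF a] b])
  have wQ: "w0 \<in> Q" using w0 False by (simp add: Q_def)
  obtain D \<psi> where psi: "holomorphic_plane \<psi> D" "w0 \<in> D"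
    and D: "\<And>w. w \<in> D \<Longrightarrow> w \<in> Q \<and> pl_x \<psi> w = - \<kappa> w * pl_u \<psi> w \<and> pl_u \<psi> w \<noteq> 0"
    and sep: "separates \<psi> w0"
    by (rule first_integral_graph[OF \<kappa> wQ]) (rule that)
  show ?thesis
  proof (rule that[OF psi _ sep])
    show "w \<in> P \<and> (\<exists>\<mu>. \<mu> \<noteq> 0 \<and> pl_x \<psi> w = \<mu> * a w \<and> pl_u \<psi> w = \<mu> * b w)" if "w \<in> D" for w
      using D[OF that] by (intro conjI exI[of _ "pl_u \<psi> w / b w"]) (auto simp: Q_def \<kappa>_def)
  qed
next
  case True
  then have nza: "a w0 \<noteq> 0" using nz by simp
  \<comment> \<open>The level curve through the point is vertical: exchange the two variables.\<close>
  let ?s = "\<lambda>w::plane. (snd w, fst w)"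
  define \<kappa> where "\<kappa> w = (- b (?s w)) / a (?s w)" for w
  define Q where "Q = {w \<in> ?s -` P. a (?s w) \<noteq> 0}"
  have \<kappa>: "holomorphic_plane \<kappa> Q"
    unfolding \<kappa>_def[abs_def] Q_def
    by (rule holomorphic_plane_quotient[OF holomorphic_plane_minus[OF holomorphic_plane_swap[OF b]] holomorphic_plane_swap[OF a]])
  have wQ: "?s w0 \<in> Q" using w0 nza by (simp add: Q_def)
  obtain D \<psi> where psi: "holomorphic_plane \<psi> D" "?s w0 \<in> D"
    and D: "\<And>w. w \<in> D \<Longrightarrow> w \<in> Q \<and> pl_x \<psi> w = - \<kappa> w * pl_u \<psi> w \<and> pl_u \<psi> w \<noteq> 0"
    and sep: "separates \<psi> (?s w0)"
    by (rule first_integral_graph[OF \<kappa> wQ]) (rule that)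
  show ?thesis
  proof (rule that[OF holomorphic_plane_swap[OF psi(1)] _ _ separates_swap[OF sep]])
    show "w0 \<in> ?s -` D" using psi(2) by simp
    show "w \<in> P \<and> (\<exists>\<mu>. \<mu> \<noteq> 0 \<and> pl_x (\<lambda>w. \<psi> (?s w)) w = \<mu> * a w \<and> pl_u (\<lambda>w. \<psi> (?s w)) w = \<mu> * b w)"
      if "w \<in> ?s -` D" for w
      using D[of "?s w"] that unfolding pl_swap
      by (intro conjI exI[of _ "pl_u \<psi> (?s w) / a w"]) (auto simp: Q_def \<kappa>_def)
  qed
qed

section \<open>Functions with prescribed Schwarzian derivative\<close>

text \<open>
  The logarithmic derivative \<open>v = \<Psi>'' / \<Psi>'\<close> satisfies the Riccati equation \<open>v' = v\<^sup>2 / 2 + k\<close>,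
  whose solution is a special case of a holomorphic flow; \<open>\<Psi>' = exp (\<integral>v)\<close> has no zeros.
\<close>
lemma prescribed_schwarzian:
  assumes k: "k holomorphic_on ball t0 \<rho>" and "\<rho> > 0"
  shows "\<exists>r \<Psi> \<Psi>' v. r > 0 \<and> (\<forall>t\<in>ball t0 r. (\<Psi> has_field_derivative \<Psi>' t) (at t) \<and> \<Psi>' t \<noteq> 0 \<and>
    (\<Psi>' has_field_derivative \<Psi>' t * v t) (at t) \<and> (v has_field_derivative (v t)^2 / 2 + k t) (at t))"
proof -
  define P where "P = ball t0 \<rho> \<times> (UNIV :: complex set)"
  define \<kappa> where "\<kappa> = (\<lambda>w::plane. snd w * snd w * (1/2) + k (fst w))"
  have k': "(k has_field_derivative deriv k t) (at t)" if "t \<in> ball t0 \<rho>" for t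
    using k that holomorphic_derivI open_ball by blast
  have hk: "holomorphic_plane \<kappa> P"
    unfolding holomorphic_plane_def pld_def[symmetric]
  proof (intro conjI ballI)
    show "open P" unfolding P_def by (intro open_Times) auto
    fix w assume "w \<in> P"
    then have t: "fst w \<in> ball t0 \<rho>" by (auto simp: P_def)
    from pld_add[OF pld_mult[OF pld_mult[OF pld_snd pld_snd] pld_const] pld_DERIV[OF pld_fst k'[OF t]]]
    show "\<exists>a b. pld \<kappa> w a b" unfolding \<kappa>_def by blast
  qed
  have t0P: "(t0, 0) \<in> P" using assms by (simp add: P_def)
  obtain r Y where r: "r > 0" and "holomorphic_plane Y (ball t0 r \<times> ball 0 r)"
    and "\<And>t v. t \<in> ball t0 r \<Longrightarrow> v \<in> ball 0 r \<Longrightarrow> (t, Y (t, v)) \<in> P"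
    and "\<And>v. v \<in> ball 0 r \<Longrightarrow> Y (t0, v) = v"
    and Yt: "\<And>t v. t \<in> ball t0 r \<Longrightarrow> v \<in> ball 0 r \<Longrightarrow> ((\<lambda>t. Y (t, v)) has_field_derivative \<kappa> (t, Y (t, v))) (at t)"
    using holomorphic_flow[OF hk t0P] by blast
  define v where "v t = Y (t, 0)" for t
  have v: "(v has_field_derivative (v t)^2 / 2 + k t) (at t)" if "t \<in> ball t0 r" for t
    using Yt[OF that, of 0] r by (simp add: v_def[abs_def] \<kappa>_def power2_eq_square)
  have prim: "\<exists>H. \<forall>t\<in>ball t0 r. (H has_field_derivative h t) (at t)"
    if "\<And>t. t \<in> ball t0 r \<Longrightarrow> h field_differentiable (at t)" for h
  proof -
    have "h holomorphic_on ball t0 r" unfolding holomorphic_on_def using that field_differentiable_at_within by blast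
    then obtain H where "\<And>s. s \<in> ball t0 r \<Longrightarrow> (H has_field_derivative h s) (at s within ball t0 r)"
      using holomorphic_convex_primitive'[OF convex_ball open_ball] by blast
    then show ?thesis using at_within_open[OF _ open_ball] by metis
  qed
  obtain Z where Z: "\<And>t. t \<in> ball t0 r \<Longrightarrow> (Z has_field_derivative v t) (at t)"
    using prim[of v] v DERIV_imp_field_differentiable by blast
  define \<Psi>' where "\<Psi>' t = exp (Z t)" for t
  have p: "(\<Psi>' has_field_derivative \<Psi>' t * v t) (at t)" if "t \<in> ball t0 r" for t
    unfolding \<Psi>'_def using Z[OF that] by (auto intro!: derivative_eq_intros)
  obtain \<Psi> where \<Psi>: "\<And>t. t \<in> ball t0 r \<Longrightarrow> (\<Psi> has_field_derivative \<Psi>' t) (at t)"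
    using prim[of \<Psi>'] p DERIV_imp_field_differentiable by blast
  show ?thesis
    by (rule exI[of _ r], rule exI[of _ \<Psi>], rule exI[of _ \<Psi>'], rule exI[of _ v], intro conjI ballI r \<Psi> p v)
       (simp_all add: \<Psi>'_def)
qed

section \<open>Composition with a function of one variable\<close>

text \<open>
  The chain rule \<open>S(\<Psi>(\<omega>)) = S(\<omega>) + {\<Psi>, \<omega>} (D\<omega>)\<^sup>2\<close>, with \<open>{\<Psi>, \<omega>} = v' - v\<^sup>2 / 2\<close> expressed by
  \<open>v = \<Psi>'' / \<Psi>'\<close>.
\<close>
lemma (in jet_coordinate) schwarzian_compose:
  assumes 1: "\<And>z. z \<in> N \<Longrightarrow> (\<Psi> has_field_derivative \<Psi>' (\<omega> z)) (at (\<omega> z))"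
    and nz: "\<And>z. z \<in> N \<Longrightarrow> \<Psi>' (\<omega> z) \<noteq> 0"
    and 2: "\<And>z. z \<in> N \<Longrightarrow> (\<Psi>' has_field_derivative \<Psi>' (\<omega> z) * v (\<omega> z)) (at (\<omega> z))"
    and 3: "\<And>z. z \<in> N \<Longrightarrow> (v has_field_derivative v' (\<omega> z)) (at (\<omega> z))"
  shows "jet_coordinate N f (\<lambda>z. \<Psi> (\<omega> z))"
    "z \<in> N \<Longrightarrow> schwarzian f (\<lambda>z. \<Psi> (\<omega> z)) z = s z + (v' (\<omega> z) - (v (\<omega> z))^2 / 2) * (B z)^2"
proof -
  define \<eta> where "\<eta> = (\<lambda>z. \<Psi> (\<omega> z))"
  have h: "hol \<eta>" "hol (\<lambda>z. \<Psi>' (\<omega> z))" "hol (\<lambda>z. v (\<omega> z))"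
    unfolding \<eta>_def using hol_compose[OF hol_omega, of _ \<Psi>'] hol_compose[OF hol_omega, of _ "\<lambda>t. \<Psi>' t * v t"]
      hol_compose[OF hol_omega, of _ v'] 1 2 3 by blast+
  have D1: "D \<eta> z = \<Psi>' (\<omega> z) * B z" if "z \<in> N" for z
    unfolding \<eta>_def by (rule D_compose[OF hol_omega 1 that])
  have D2: "D (\<lambda>z. \<Psi>' (\<omega> z)) z = \<Psi>' (\<omega> z) * v (\<omega> z) * B z" if "z \<in> N" for z
    by (rule D_compose[OF hol_omega, where h' = "\<lambda>t. \<Psi>' t * v t", OF 2 that])
  have D3: "D (\<lambda>z. v (\<omega> z)) z = v' (\<omega> z) * B z" if "z \<in> N" for z
    by (rule D_compose[OF hol_omega 3 that])
  have pq: "pd_p \<eta> z = 0" "pd_q \<eta> z = 0" if "z \<in> N" for z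
    unfolding \<eta>_def using pd_compose(3,4)[OF hol_omega, of \<Psi> \<Psi>', OF 1 that] omega_p[OF that] omega_q[OF that] by simp_all
  show "jet_coordinate N f (\<lambda>z. \<Psi> (\<omega> z))"
    unfolding \<eta>_def[symmetric]
    by unfold_locales (use h pq nz speed_nonzero in \<open>auto simp: D1\<close>)
  have ld_D: "ld_D f \<eta> z = v (\<omega> z) * B z + Y z" if z: "z \<in> N" for z
  proof -
    have "D (D \<eta>) z = D (\<lambda>z. \<Psi>' (\<omega> z) * B z) z"
      by (rule D_cong[OF D1 _ z]) (use h in simp_all)
    also have "\<dots> = \<Psi>' (\<omega> z) * v (\<omega> z) * B z * B z + \<Psi>' (\<omega> z) * D B z"
      using z h by (simp add: D_rules D2)
    finally show ?thesis
      using nz[OF z] speed_nonzero[OF z] by (simp add: ld_D_def D1 z field_simps)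
  qed
  show "schwarzian f (\<lambda>z. \<Psi> (\<omega> z)) z = s z + (v' (\<omega> z) - (v (\<omega> z))^2 / 2) * (B z)^2" if z: "z \<in> N"
  proof -
    have "D (ld_D f \<eta>) z = D (\<lambda>z. v (\<omega> z) * B z + Y z) z"
      by (rule D_cong[OF ld_D _ z]) (use h in simp_all)
    also have "\<dots> = v' (\<omega> z) * B z * B z + v (\<omega> z) * D B z + D Y z"
      using z h by (simp add: D_rules D3)
    finally have d: "D (ld_D f \<eta>) z = v' (\<omega> z) * B z * B z + v (\<omega> z) * D B z + D Y z" .
    have DB: "D B z = Y z * B z" using speed_nonzero[OF z] by (simp add: ld_D_def)
    show ?thesis
      unfolding \<eta>_def[symmetric] schwarzian_def[of f \<eta>] schwarzian_def[of f \<omega>] d ld_D[OF z] DB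
      by (simp add: power2_eq_square field_simps)
  qed
qed

section \<open>Functions of jets that descend to the plane\<close>

text \<open>
  The fibres of a polydisc over the plane are convex, so that a function with vanishing derivatives in
  \<open>p\<close> and \<open>q\<close> descends to the plane.
\<close>
definition jet_box :: "jet \<Rightarrow> real \<Rightarrow> jet set" where
  "jet_box z0 \<epsilon> = {z. fst z \<in> ball (fst z0) \<epsilon> \<and> fst (snd z) \<in> ball (fst (snd z0)) \<epsilon> \<and> jet_p z \<in> ball (jet_p z0) \<epsilon> \<and> jet_q z \<in> ball (jet_q z0) \<epsilon>}"

lemma jet_box_Times:
  "jet_box (x, u, p, q) \<epsilon> = ball x \<epsilon> \<times> ball u \<epsilon> \<times> ball p \<epsilon> \<times> ball q \<epsilon>"
  unfolding jet_box_def jet_p_def jet_q_def by auto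

lemma open_jet_box: "open (jet_box z0 \<epsilon>)"
  by (cases z0) (auto simp: jet_box_Times intro!: open_Times)

lemma jet_box_subset:
  assumes "open N" "z0 \<in> N"
  obtains \<epsilon> where "\<epsilon> > 0" "jet_box z0 \<epsilon> \<subseteq> N"
proof -
  obtain e where e: "e > 0" "ball z0 e \<subseteq> N" using assms by (meson open_contains_ball)
  \<comment> \<open>The distance is at most the sum of the four coordinate distances.\<close>
  have "jet_box z0 (e / 4) \<subseteq> ball z0 e"
  proof
    fix z assume z: "z \<in> jet_box z0 (e / 4)"
    obtain x u p q where [simp]: "z = (x, u, p, q)" by (cases z)
    obtain x' u' p' q' where [simp]: "z0 = (x', u', p', q')" by (cases z0)
    have tri: "dist (a, b) (c, d) \<le> dist a c + dist b d" for a c :: "'a::metric_space" and b d :: "'b::metric_space"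
      unfolding dist_Pair_Pair using sqrt_sum_squares_le_sum[of "dist a c" "dist b d"] by simp
    have "dist z0 z \<le> dist x' x + (dist u' u + (dist p' p + dist q' q))"
      using tri[of x' "(u', p', q')" x "(u, p, q)"] tri[of u' "(p', q')" u "(p, q)"] tri[of p' q' p q] by simp
    then show "z \<in> ball z0 e" using z by (simp add: jet_box_Times)
  qed
  with e show ?thesis using that[of "e / 4"] by simp
qed

lemma jet_box_plane:
  assumes F: "holomorphic_jet F (jet_box z0 \<epsilon>)" and "\<epsilon> > 0"
    and p: "\<And>z. z \<in> jet_box z0 \<epsilon> \<Longrightarrow> pd_p F z = 0" and q: "\<And>z. z \<in> jet_box z0 \<epsilon> \<Longrightarrow> pd_q F z = 0"
  obtains F0 where "holomorphic_plane F0 (ball (fst z0) \<epsilon> \<times> ball (fst (snd z0)) \<epsilon>)"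
    "\<And>z. z \<in> jet_box z0 \<epsilon> \<Longrightarrow> F z = on_jets F0 z"
proof -
  obtain x0 u0 p0 q0 where z0: "z0 = (x0, u0, p0, q0)" by (cases z0)
  note box = jet_box_Times[of x0 u0 p0 q0, folded z0]
  have jd: "jd F z (pd_x F z) (pd_u F z) 0 0" if "z \<in> jet_box z0 \<epsilon>" for z
    using F p[OF that] q[OF that] that unfolding holomorphic_jet_jd by metis
  \<comment> \<open>Evaluation on the section through the centre of the fibre.\<close>
  define F0 where "F0 w = F (fst w, snd w, p0, q0)" for w
  note sl = slice_has_derivative[OF bounded_linear_dir(4) holomorphic_jet_slice(4)[OF F], folded pd_eq_dpd]
    slice_has_derivative[OF bounded_linear_dir(3) holomorphic_jet_slice(3)[OF F], folded pd_eq_dpd]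
  have eq: "F (x, u, p, q) = F0 (x, u)" if z: "(x, u, p, q) \<in> jet_box z0 \<epsilon>" for x u p q
  proof -
    have "((\<lambda>q. F (x, u, p, q)) has_field_derivative 0) (at t within ball q0 \<epsilon>)" if t: "t \<in> ball q0 \<epsilon>" for t
    proof -
      have b: "(x, u, p, t) \<in> jet_box z0 \<epsilon>" using z t by (simp add: box)
      show ?thesis
        using sl(1)[of "(x, u, p, 0)" t] q[OF b] b by (simp add: dir_defs has_field_derivative_at_within)
    qed
    from has_field_derivative_zero_constant[OF convex_ball this]
    obtain c where c: "\<And>t. t \<in> ball q0 \<epsilon> \<Longrightarrow> F (x, u, p, t) = c" by blast
    have "((\<lambda>p. F (x, u, p, q0)) has_field_derivative 0) (at t within ball p0 \<epsilon>)" if t: "t \<in> ball p0 \<epsilon>" for t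
    proof -
      have b: "(x, u, t, q0) \<in> jet_box z0 \<epsilon>" using z t \<open>\<epsilon> > 0\<close> by (simp add: box)
      show ?thesis
        using sl(2)[of "(x, u, 0, q0)" t] p[OF b] b by (simp add: dir_defs has_field_derivative_at_within)
    qed
    from has_field_derivative_zero_constant[OF convex_ball this]
    obtain d where d: "\<And>t. t \<in> ball p0 \<epsilon> \<Longrightarrow> F (x, u, t, q0) = d" by blast
    have "F (x, u, p, q) = F (x, u, p, q0)" using c[of q] c[of q0] z \<open>\<epsilon> > 0\<close> by (simp add: box)
    also have "\<dots> = F (x, u, p0, q0)" using d[of p] d[of p0] z \<open>\<epsilon> > 0\<close> by (simp add: box)
    finally show ?thesis by (simp add: F0_def)
  qed
  have "holomorphic_plane F0 (ball x0 \<epsilon> \<times> ball u0 \<epsilon>)"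
  proof (rule holomorphic_plane_pldI)
    show "open (ball x0 \<epsilon> \<times> ball u0 \<epsilon>)" by (intro open_Times open_ball)
    fix w assume w: "w \<in> ball x0 \<epsilon> \<times> ball u0 \<epsilon>"
    have z: "(fst w, snd w, p0, q0) \<in> jet_box z0 \<epsilon>" using w \<open>\<epsilon> > 0\<close> by (auto simp: box)
    have "((\<lambda>w::plane. (fst w, snd w, p0, q0)) has_derivative (\<lambda>h. (fst h, snd h, 0, 0))) (at w)"
      by (intro has_derivative_Pair has_derivative_const bounded_linear_imp_has_derivative bounded_linear_fst bounded_linear_snd)
    from has_derivative_compose[OF this, of F "\<lambda>(h, k, l, m). pd_x F (fst w, snd w, p0, q0) * h + pd_u F (fst w, snd w, p0, q0) * k + 0 * l + 0 * m"]
    show "pld F0 w (pd_x F (fst w, snd w, p0, q0)) (pd_u F (fst w, snd w, p0, q0))"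
      using jd[OF z] unfolding pld_def jd_def F0_def[abs_def] by (simp add: case_prod_unfold)
  qed
  moreover have "F z = on_jets F0 z" if "z \<in> jet_box z0 \<epsilon>" for z
    using eq that by (cases z) (simp add: on_jets_def)
  ultimately show ?thesis using that[of F0] by (simp add: z0)
qed

lemma holomorphic_jet_subset:
  "holomorphic_jet F U \<Longrightarrow> open N \<Longrightarrow> N \<subseteq> U \<Longrightarrow> holomorphic_jet F N"
  unfolding holomorphic_jet_def by blast

abbreviation base :: "jet \<Rightarrow> plane" where "base z \<equiv> (fst z, fst (snd z))"

lemma open_base_vimage: "open D \<Longrightarrow> open (base -` D)"
  by (intro open_vimage continuous_intros)

lemma on_jets_base: "on_jets F z = F (base z)"
  by (simp add: on_jets_def case_prod_unfold)

definition base_box :: "jet \<Rightarrow> real \<Rightarrow> plane set" where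
  "base_box z0 \<epsilon> = ball (fst z0) \<epsilon> \<times> ball (fst (snd z0)) \<epsilon>"

lemma base_in_base_box: "z \<in> jet_box z0 \<epsilon> \<Longrightarrow> base z \<in> base_box z0 \<epsilon>"
  by (auto simp: jet_box_def base_box_def)

lemma base_box_lift:
  assumes "y \<in> base_box z0 \<epsilon>" "\<epsilon> > 0"
  obtains z where "z \<in> jet_box z0 \<epsilon>" "base z = y"
  using assms that[of "(fst y, snd y, snd (snd z0))"]
  by (auto simp: base_box_def jet_box_def jet_p_def jet_q_def case_prod_unfold)

lemma jet_box_descend:
  assumes F: "holomorphic_jet F N" and sub: "jet_box z0 \<epsilon> \<subseteq> N" and e: "\<epsilon> > 0"
    and pq: "\<And>z. z \<in> N \<Longrightarrow> pd_p F z = 0" "\<And>z. z \<in> N \<Longrightarrow> pd_q F z = 0"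
  obtains F0 where "holomorphic_plane F0 (base_box z0 \<epsilon>)" "\<And>z. z \<in> jet_box z0 \<epsilon> \<Longrightarrow> F z = F0 (base z)"
    "\<And>z. z \<in> jet_box z0 \<epsilon> \<Longrightarrow> pd_x F z = pl_x F0 (base z)" "\<And>z. z \<in> jet_box z0 \<epsilon> \<Longrightarrow> pd_u F z = pl_u F0 (base z)"
proof -
  interpret jet_region "jet_box z0 \<epsilon>" by unfold_locales (rule open_jet_box)
  have FX: "hol F" by (rule holomorphic_jet_subset[OF F open_jet_box sub])
  obtain F0 where F0: "holomorphic_plane F0 (base_box z0 \<epsilon>)" "\<And>z. z \<in> jet_box z0 \<epsilon> \<Longrightarrow> F z = on_jets F0 z"
    using jet_box_plane[OF FX e] pq sub unfolding base_box_def by blast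
  have "hol (on_jets F0)" by (rule holomorphic_jet_on_jets[OF F0(1) open_jet_box base_in_base_box])
  from pd_cong[of F "on_jets F0", OF F0(2) this]
  have "pd_x F z = on_jets (pl_x F0) z" "pd_u F z = on_jets (pl_u F0) z" if "z \<in> jet_box z0 \<epsilon>" for z
    using that by (simp_all add: pd_on_jets)
  with F0 show ?thesis using that[of F0] by (simp add: on_jets_base)
qed

lemma jet_coordinate_on_jets:
  assumes f: "holomorphic_jet f N" and N: "open N" and F: "holomorphic_plane F D"
    and sub: "\<And>z. z \<in> N \<Longrightarrow> base z \<in> D"
    and nz: "\<And>z. z \<in> N \<Longrightarrow> pl_x F (base z) + jet_p z * pl_u F (base z) \<noteq> 0"
  shows "jet_coordinate N f (on_jets F)"
proof unfold_locales
  show "open N" "holomorphic_jet f N" by fact+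
  show "holomorphic_jet (on_jets F) N" by (rule holomorphic_jet_on_jets[OF F N sub])
  fix z assume "z \<in> N"
  then show "pd_p (on_jets F) z = 0" "pd_q (on_jets F) z = 0" "Dhat f (on_jets F) z \<noteq> 0"
    using nz by (simp_all add: Dhat_def total_deriv_def pd_on_jets on_jets_base)
qed

section \<open>Sufficiency of the conditions\<close>

text \<open>
  The root \<open>m\<close> of \<open>m\<^sup>2 - b m + a c = 0\<close> splits the quadratic polynomial also where its
  leading coefficient vanishes. Of the two values of \<open>s\<close> one can always be chosen such that
  \<open>m \<noteq> 0\<close>.
\<close>
lemma quadratic_factors:
  fixes a b c s m p :: complex
  assumes disc: "b^2 - 4 * a * c = - 4" and s: "s^2 = - 4" and m: "m = (b + s) / 2" and nz: "m \<noteq> 0"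
  shows "(a + m * p) * (1 + c / m * p) = a + b * p + c * p^2" "a * (c / m) - m = - s"
proof -
  have m2: "2 * m = b + s" unfolding m by simp
  with disc s have mm: "m * m + a * c = b * m" by algebra
  have "(a + m * p) * (1 + c / m * p) = a + (m * m + a * c) / m * p + c * p^2"
    using nz by (simp add: power2_eq_square field_simps)
  then show "(a + m * p) * (1 + c / m * p) = a + b * p + c * p^2" using nz by (simp add: mm)
  have "a * (c / m) - m = (a * c - m * m) / m" using nz by (simp add: field_simps)
  also have "a * c - m * m = (b - 2 * m) * m" using mm by (simp add: algebra_simps)
  also have "(b - 2 * m) * m / m = - s" using nz m2 by simp
  finally show "a * (c / m) - m = - s" .
qed

text \<open>
  The two linear factors of \<open>1 / J\<close> are, up to factors depending on \<open>(x, u)\<close>, the speeds of first integrals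
  \<open>\<phi>\<close> and \<open>\<psi>\<close> of two direction fields. The same factors occur in the Jacobian, whence
  \<open>\<delta> = - s J\<close> with a constant \<open>s\<close>. By \<open>I\<^sub>1 J = 3 D J\<close> this is exactly what makes the defect
  independent of \<open>q\<close>.
\<close>
lemma adapted_coordinates:
  assumes f: "holomorphic_jet f U" and N: "open N" "z0 \<in> N" "N \<subseteq> U" and J: "holomorphic_jet J N"
    and inv: "\<And>z. z \<in> N \<Longrightarrow> (J z)^2 = - I5 f z \<and> I4 f z = 0 \<and> I5 f z \<noteq> 0 \<and> I6 f z = 0 \<and> I7 f J z = 0"
  obtains N' D \<phi> \<psi> where "holomorphic_plane \<phi> D" "holomorphic_plane \<psi> D" "z0 \<in> N'" "N' \<subseteq> U"
    "\<And>z. z \<in> N' \<Longrightarrow> base z \<in> D" "schwarzian_defect N' f (on_jets \<phi>) (on_jets \<psi>)"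
    "separates \<phi> (base z0)" "separates \<psi> (base z0)"
proof -
  obtain \<epsilon> where e: "\<epsilon> > 0" "jet_box z0 \<epsilon> \<subseteq> N" using jet_box_subset[OF N(1,2)] .
  define X where "X = jet_box z0 \<epsilon>"
  have X: "open X" "z0 \<in> X" "X \<subseteq> N" using e open_jet_box by (auto simp: X_def jet_box_def)
  interpret canonical_invariants X f J
  proof unfold_locales
    show "open X" by fact
    show "holomorphic_jet f X" "holomorphic_jet J X"
      using holomorphic_jet_subset f J X N(3) by blast+
  qed (use inv X(3) in blast)+
  define P where "P = base_box z0 \<epsilon>"
  have P: "base z \<in> P" if "z \<in> X" for z using base_in_base_box that by (simp add: P_def X_def)
  have XX: "jet_box z0 \<epsilon> \<subseteq> X" by (simp add: X_def)
  obtain W0 where W0: "holomorphic_plane W0 P" "\<And>z. z \<in> X \<Longrightarrow> w0 z = W0 (base z)"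
    by (rule jet_box_descend[OF hol_w(2) XX e(1) pd_w012(2,1), folded P_def X_def], assumption+) (rule that)
  obtain W1 where W1: "holomorphic_plane W1 P" "\<And>z. z \<in> X \<Longrightarrow> w1 z = W1 (base z)"
    by (rule jet_box_descend[OF hol_w(3) XX e(1) pd_w012(4,3), folded P_def X_def], assumption+) (rule that)
  obtain W2 where W2: "holomorphic_plane W2 P" "\<And>z. z \<in> X \<Longrightarrow> w2 z = W2 (base z)"
    by (rule jet_box_descend[OF hol_w(4) XX e(1) pd_w012(6,5), folded P_def X_def], assumption+) (rule that)
  have w: "w z = W0 (base z) + W1 (base z) * jet_p z + W2 (base z) * (jet_p z)^2" if "z \<in> X" for z
    using w_quadratic[of z] W0(2) W1(2) W2(2) that by simp
  have disc: "(W1 y)^2 - 4 * W0 y * W2 y = - 4" if "y \<in> P" for y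
    using base_box_lift[OF that[unfolded P_def] e(1)] w_discriminant W0(2) W1(2) W2(2) unfolding X_def by metis
  define y0 where "y0 = base z0"
  have y0: "y0 \<in> P" unfolding y0_def by (rule P[OF X(2)])
  \<comment> \<open>At the base point at least one of the two roots makes \<open>W1 + s\<close> nonzero.\<close>
  obtain s where s: "s^2 = - 4" "W1 y0 + s \<noteq> 0"
  proof (cases "W1 y0 + 2 * \<i> = 0")
    case True
    then have "W1 y0 = - (2 * \<i>)" by (simp only: eq_neg_iff_add_eq_0)
    then show ?thesis using that[of "- 2 * \<i>"] by (simp add: power_mult_distrib)
  qed (use that[of "2 * \<i>"] in \<open>simp add: power_mult_distrib\<close>)
  define M where "M y = (W1 y + s) / 2" for y
  have hM: "holomorphic_plane M P"
  proof (rule holomorphic_plane_pldI[OF holomorphic_planeD(1)[OF W1(1)]])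
    fix y assume "y \<in> P"
    have "((\<lambda>t. (t + s) / 2) has_field_derivative 1/2) (at (W1 y))"
      by (auto intro!: derivative_eq_intros)
    from pld_DERIV[OF holomorphic_planeD(2)[OF W1(1) \<open>y \<in> P\<close>] this]
    show "pld M y (1/2 * pl_x W1 y) (1/2 * pl_u W1 y)" unfolding M_def .
  qed
  define P' where "P' = {y \<in> P. M y \<noteq> 0}"
  have hq: "holomorphic_plane (\<lambda>y. W2 y / M y) P'" unfolding P'_def by (rule holomorphic_plane_quotient[OF W2(1) hM])
  have P': "open P'" "P' \<subseteq> P" "y0 \<in> P'" using holomorphic_planeD(1)[OF hq] y0 s(2) by (auto simp: P'_def M_def)
  have h1: "holomorphic_plane (\<lambda>y. 1) P'" by (rule holomorphic_plane_pldI[OF P'(1) pld_const])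
  note hM' = holomorphic_plane_subset[OF hM P'(1,2)] and hW0' = holomorphic_plane_subset[OF W0(1) P'(1,2)]
  have nzM: "M y0 \<noteq> 0" using P'(3) by (simp add: P'_def)
  obtain D1 \<phi> where phi: "holomorphic_plane \<phi> D1" "y0 \<in> D1"
    "\<And>y. y \<in> D1 \<Longrightarrow> y \<in> P' \<and> (\<exists>\<mu>. \<mu> \<noteq> 0 \<and> pl_x \<phi> y = \<mu> * W0 y \<and> pl_u \<phi> y = \<mu> * M y)"
    "separates \<phi> y0"
    by (rule first_integral[OF hW0' hM' P'(3) disjI2[OF nzM]]) (rule that)
  obtain D2 \<psi> where psi: "holomorphic_plane \<psi> D2" "y0 \<in> D2"
    "\<And>y. y \<in> D2 \<Longrightarrow> y \<in> P' \<and> (\<exists>\<mu>. \<mu> \<noteq> 0 \<and> pl_x \<psi> y = \<mu> * 1 \<and> pl_u \<psi> y = \<mu> * (W2 y / M y))"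
    "separates \<psi> y0"
    by (rule first_integral[OF h1 hq P'(3) disjI1[OF one_neq_zero]]) (rule that)
  define E where "E = D1 \<inter> D2"
  have E: "open E" "E \<subseteq> D1" "E \<subseteq> D2" "y0 \<in> E"
    using phi psi holomorphic_planeD(1) by (auto simp: E_def)
  note hE = holomorphic_plane_subset[OF phi(1) E(1,2)] holomorphic_plane_subset[OF psi(1) E(1,3)]
  define N' where "N' = X \<inter> base -` E"
  have N': "open N'" "z0 \<in> N'" "N' \<subseteq> X" "\<And>z. z \<in> N' \<Longrightarrow> base z \<in> E"
    using X open_base_vimage[OF E(1)] E(4) by (auto simp: N'_def y0_def)
  \<comment> \<open>The two speeds and the Jacobian, as functions of the base point and \<open>p\<close>.\<close>
  define AA where "AA z = pl_x \<phi> (base z) + jet_p z * pl_u \<phi> (base z)" for z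
  define BB where "BB z = pl_x \<psi> (base z) + jet_p z * pl_u \<psi> (base z)" for z
  define jac where "jac z = pl_x \<phi> (base z) * pl_u \<psi> (base z) - pl_u \<phi> (base z) * pl_x \<psi> (base z)" for z
  have key: "AA z * BB z \<noteq> 0" "jac z \<noteq> 0" "jac z = - s * J z * (AA z * BB z)" if z: "z \<in> N'" for z
  proof -
    define y where "y = base z"
    have y: "y \<in> D1" "y \<in> D2" using N'(4)[OF z] E by (auto simp: y_def)
    obtain \<mu> where \<mu>: "\<mu> \<noteq> 0" "pl_x \<phi> y = \<mu> * W0 y" "pl_u \<phi> y = \<mu> * M y" "y \<in> P'" using phi(3)[OF y(1)] by blast
    obtain \<nu> where \<nu>: "\<nu> \<noteq> 0" "pl_x \<psi> y = \<nu> * 1" "pl_u \<psi> y = \<nu> * (W2 y / M y)" using psi(3)[OF y(2)] by blast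
    have yP: "y \<in> P" "M y \<noteq> 0" using \<mu>(4) by (auto simp: P'_def)
    note q = quadratic_factors[OF disc[OF yP(1)] s(1) M_def yP(2)]
    have zX: "z \<in> X" using z N'(3) by blast
    have alg: "(\<mu> * a + p * (\<mu> * m)) * (\<nu> * 1 + p * (\<nu> * c)) = \<mu> * \<nu> * ((a + m * p) * (1 + c * p))"
      "\<mu> * a * (\<nu> * c) - \<mu> * m * (\<nu> * 1) = \<mu> * \<nu> * (a * c - m)" for a m c p
      by (simp_all add: algebra_simps)
    have AB: "AA z * BB z = \<mu> * \<nu> * w z"
      unfolding AA_def BB_def y_def[symmetric] \<mu> \<nu> alg(1) by (simp only: q(1) w[OF zX, folded y_def])
    have j: "jac z = - \<mu> * \<nu> * s"
      unfolding jac_def y_def[symmetric] \<mu> \<nu> alg(2) q(2) by simp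
    have "w z \<noteq> 0" using Jw[OF zX] by auto
    moreover have "s \<noteq> 0" using s(1) by auto
    moreover have "- \<mu> * \<nu> * s = - s * J z * (\<mu> * \<nu> * w z)" using Jw[OF zX] by (simp add: algebra_simps)
    ultimately show "AA z * BB z \<noteq> 0" "jac z \<noteq> 0" "jac z = - s * J z * (AA z * BB z)"
      unfolding AB j using \<mu>(1) \<nu>(1) by simp_all
  qed
  have fN': "holomorphic_jet f N'" by (rule holomorphic_jet_subset[OF f N'(1)]) (use N' X N in blast)
  have JN': "holomorphic_jet J N'" by (rule holomorphic_jet_subset[OF J N'(1)]) (use N' X N in blast)
  interpret c1: jet_coordinate N' f "on_jets \<phi>"
    by (rule jet_coordinate_on_jets[OF fN' N'(1) hE(1) N'(4)]) (use key(1) in \<open>auto simp: AA_def\<close>)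
  interpret c2: jet_coordinate N' f "on_jets \<psi>"
    by (rule jet_coordinate_on_jets[OF fN' N'(1) hE(2) N'(4)]) (use key(1) in \<open>auto simp: BB_def\<close>)
  interpret cp: coordinate_pair N' f "on_jets \<phi>" "on_jets \<psi>"
    by unfold_locales (use key(2) in \<open>simp add: pd_on_jets on_jets_base jac_def\<close>)
  have delta: "cp.\<delta> z = - s * J z" if z: "z \<in> N'" for z
    unfolding cp.delta_jacobian[OF z] cp.speed_eq[OF z] pd_on_jets on_jets_base
      jac_def[symmetric] AA_def[symmetric] BB_def[symmetric] key(3)[OF z]
    using key(1)[OF z] by simp
  interpret sd: schwarzian_defect N' f "on_jets \<phi>" "on_jets \<psi>"
  proof unfold_locales
    fix z assume z: "z \<in> N'"
    have zX: "z \<in> X" using z N'(3) by blast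
    have "Dhat f cp.\<delta> z = - s * Dhat f J z"
      using c1.D_cong[of cp.\<delta> "\<lambda>z. - s * J z", OF delta _ z] c1.D_rules(3)[OF z _ JN', of "\<lambda>_. - s"] JN' by simp
    then have "I1 f z * cp.\<delta> z = 3 * Dhat f cp.\<delta> z"
      using I1_J[OF zX] delta[OF z] by simp
    moreover have "pd_q cp.K z = 3 * Dhat f cp.\<delta> z - I1 f z * cp.\<delta> z"
      using cp.K_q_eq[OF z] by (simp add: I1_def)
    ultimately show "pd_q cp.K z = 0" by simp
    show "I4 f z = 0" by (rule I4_0[OF zX])
  qed
  show ?thesis
    using that[OF hE N'(2) _ N'(4) sd.schwarzian_defect_axioms] phi(4) psi(4) N' X N unfolding y0_def by blast
qed

text \<open>
  On a small polydisc \<open>k = g1(\<psi>)\<close> and \<open>l = g2(\<phi>)\<close>, so the defect is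
  \<open>g1(\<psi>) B\<^sup>2 + g2(\<phi>) A\<^sup>2\<close>. Passing to \<open>\<Psi>(\<psi>)\<close> and \<open>\<Phi>(\<phi>)\<close> with Schwarzian derivatives \<open>- g1\<close> and
  \<open>g2\<close> adds \<open>- g1(\<psi>) B\<^sup>2\<close> to \<open>S(\<psi>)\<close> and \<open>g2(\<phi>) A\<^sup>2\<close> to \<open>S(\<phi>)\<close> and so removes it.
\<close>
lemma equivalence_from_adapted:
  assumes sd: "schwarzian_defect N f (on_jets \<phi>) (on_jets \<psi>)"
    and h: "holomorphic_plane \<phi> D" "holomorphic_plane \<psi> D"
    and N: "z0 \<in> N" "N \<subseteq> U" "\<And>z. z \<in> N \<Longrightarrow> base z \<in> D"
    and sep: "separates \<phi> (base z0)" "separates \<psi> (base z0)"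
  shows "point_equivalent_near f U z0 canonical_rhs canonical_domain"
proof -
  interpret schwarzian_defect N f "on_jets \<phi>" "on_jets \<psi>" by (rule sd)
  define y0 where "y0 = base z0"
  obtain \<epsilon> where e: "\<epsilon> > 0" "jet_box z0 \<epsilon> \<subseteq> N" using jet_box_subset[OF open_N N(1)] .
  define X where "X = jet_box z0 \<epsilon>"
  have X: "open X" "z0 \<in> X" "X \<subseteq> N" using e open_jet_box by (auto simp: X_def jet_box_def)
  define Q where "Q = base_box z0 \<epsilon>"
  have y0Q: "y0 \<in> Q" using base_in_base_box X(2) by (simp add: y0_def Q_def X_def)
  obtain k0 where k0: "holomorphic_plane k0 Q"
    "\<And>z. z \<in> X \<Longrightarrow> k z = k0 (base z)" "\<And>z. z \<in> X \<Longrightarrow> pd_x k z = pl_x k0 (base z)" "\<And>z. z \<in> X \<Longrightarrow> pd_u k z = pl_u k0 (base z)"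
    by (rule jet_box_descend[OF hol_kl(1) e(2,1) pd_kl(2,1), folded Q_def X_def], assumption+) (rule that)
  obtain l0 where l0: "holomorphic_plane l0 Q"
    "\<And>z. z \<in> X \<Longrightarrow> l z = l0 (base z)" "\<And>z. z \<in> X \<Longrightarrow> pd_x l z = pl_x l0 (base z)" "\<And>z. z \<in> X \<Longrightarrow> pd_u l z = pl_u l0 (base z)"
    by (rule jet_box_descend[OF hol_kl(2) e(2,1) pd_kl(4,3), folded Q_def X_def], assumption+) (rule that)
  have tr: "pl_u k0 y * pl_x \<psi> y = pl_u \<psi> y * pl_x k0 y" "pl_u l0 y * pl_x \<phi> y = pl_u \<phi> y * pl_x l0 y" if yQ: "y \<in> Q" for y
  proof -
    obtain z where z: "z \<in> X" "base z = y" using base_box_lift[OF yQ[unfolded Q_def] e(1)] unfolding X_def by blast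
    have zN: "z \<in> N" using z X by blast
    show "pl_u k0 y * pl_x \<psi> y = pl_u \<psi> y * pl_x k0 y" "pl_u l0 y * pl_x \<phi> y = pl_u \<phi> y * pl_x l0 y"
      using kl_transport[OF zN] unfolding k0(3,4)[OF z(1)] l0(3,4)[OF z(1)] pd_on_jets on_jets_base z(2) by simp_all
  qed
  have ft: "factors_through \<psi> y0 k0" "factors_through \<phi> y0 l0"
    using sep k0(1) l0(1) y0Q tr unfolding separates_def y0_def[symmetric] by blast+
  obtain \<rho>1 g1 E1 where
    g1: "\<rho>1 > 0" "g1 holomorphic_on ball (\<psi> y0) \<rho>1" and E1: "open E1" "y0 \<in> E1" "\<forall>y\<in>E1. \<psi> y \<in> ball (\<psi> y0) \<rho>1 \<and> k0 y = g1 (\<psi> y)"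
    using ft(1) unfolding factors_through_def by blast
  obtain \<rho>2 g2 E2 where
    g2: "\<rho>2 > 0" "g2 holomorphic_on ball (\<phi> y0) \<rho>2" and E2: "open E2" "y0 \<in> E2" "\<forall>y\<in>E2. \<phi> y \<in> ball (\<phi> y0) \<rho>2 \<and> l0 y = g2 (\<phi> y)"
    using ft(2) unfolding factors_through_def by blast
  have ng1: "(\<lambda>t. - g1 t) holomorphic_on ball (\<psi> y0) \<rho>1" using g1(2) by (rule holomorphic_on_minus)
  obtain r1 \<Psi> \<Psi>' v1 where r1: "r1 > 0"
    and all1: "\<forall>t\<in>ball (\<psi> y0) r1. (\<Psi> has_field_derivative \<Psi>' t) (at t) \<and> \<Psi>' t \<noteq> 0 \<and>
      (\<Psi>' has_field_derivative \<Psi>' t * v1 t) (at t) \<and> (v1 has_field_derivative (v1 t)^2 / 2 + - g1 t) (at t)"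
    using prescribed_schwarzian[OF ng1 g1(1)] by (elim exE conjE) (rule that)
  have \<Psi>: "\<And>t. t \<in> ball (\<psi> y0) r1 \<Longrightarrow> (\<Psi> has_field_derivative \<Psi>' t) (at t)"
      "\<And>t. t \<in> ball (\<psi> y0) r1 \<Longrightarrow> \<Psi>' t \<noteq> 0"
      "\<And>t. t \<in> ball (\<psi> y0) r1 \<Longrightarrow> (\<Psi>' has_field_derivative \<Psi>' t * v1 t) (at t)"
      "\<And>t. t \<in> ball (\<psi> y0) r1 \<Longrightarrow> (v1 has_field_derivative (v1 t)^2 / 2 + - g1 t) (at t)"
    using all1 by simp_all
  obtain r2 \<Phi> \<Phi>' v2 where r2: "r2 > 0"
    and all2: "\<forall>t\<in>ball (\<phi> y0) r2. (\<Phi> has_field_derivative \<Phi>' t) (at t) \<and> \<Phi>' t \<noteq> 0 \<and>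
      (\<Phi>' has_field_derivative \<Phi>' t * v2 t) (at t) \<and> (v2 has_field_derivative (v2 t)^2 / 2 + g2 t) (at t)"
    using prescribed_schwarzian[OF g2(2,1)] by (elim exE conjE) (rule that)
  have \<Phi>: "\<And>t. t \<in> ball (\<phi> y0) r2 \<Longrightarrow> (\<Phi> has_field_derivative \<Phi>' t) (at t)"
      "\<And>t. t \<in> ball (\<phi> y0) r2 \<Longrightarrow> \<Phi>' t \<noteq> 0"
      "\<And>t. t \<in> ball (\<phi> y0) r2 \<Longrightarrow> (\<Phi>' has_field_derivative \<Phi>' t * v2 t) (at t)"
      "\<And>t. t \<in> ball (\<phi> y0) r2 \<Longrightarrow> (v2 has_field_derivative (v2 t)^2 / 2 + g2 t) (at t)"
    using all2 by simp_all
  have Dopen: "open D" using holomorphic_planeD(1)[OF h(1)] .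
  define H1 where "H1 = D \<inter> \<psi> -` ball (\<psi> y0) r1"
  define H2 where "H2 = D \<inter> \<phi> -` ball (\<phi> y0) r2"
  have H: "open H1" "open H2"
    unfolding H1_def H2_def
    by (intro continuous_open_preimage Dopen open_ball holomorphic_plane_continuous h)+
  define D' where "D' = H1 \<inter> H2 \<inter> E1 \<inter> E2"
  have D': "open D'" using H E1(1) E2(1) by (auto simp: D'_def)
  have y0D: "y0 \<in> D" unfolding y0_def by (rule N(3)[OF N(1)])
  have y0D': "y0 \<in> D'" using y0D r1 r2 E1(2) E2(2) by (auto simp: D'_def H1_def H2_def)
  define N' where "N' = X \<inter> base -` D'"
  have N': "open N'" "z0 \<in> N'" "N' \<subseteq> X" "N' \<subseteq> N" "\<And>z. z \<in> N' \<Longrightarrow> base z \<in> D'"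
    using X open_base_vimage[OF D'] y0D' by (auto simp: N'_def y0_def)
  have in1: "on_jets \<psi> z \<in> ball (\<psi> y0) r1" and in2: "on_jets \<phi> z \<in> ball (\<phi> y0) r2" if "z \<in> N'" for z
    using N'(5)[OF that] by (auto simp: on_jets_base D'_def H1_def H2_def)
  have sub: "holomorphic_jet F N'" if "hol F" for F by (rule holomorphic_jet_subset[OF that N'(1,4)])
  interpret c1: jet_coordinate N' f "on_jets \<phi>"
    by unfold_locales (use N' sub first.omega_p first.omega_q first.speed_nonzero in auto)
  interpret c2: jet_coordinate N' f "on_jets \<psi>"
    by unfold_locales (use N' sub second.omega_p second.omega_q second.speed_nonzero in auto)
  define \<phi>2 where "\<phi>2 y = \<Phi> (\<phi> y)" for y
  define \<psi>2 where "\<psi>2 y = \<Psi> (\<psi> y)" for y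
  have oj: "on_jets \<phi>2 = (\<lambda>z. \<Phi> (on_jets \<phi> z))" "on_jets \<psi>2 = (\<lambda>z. \<Psi> (on_jets \<psi> z))"
    by (auto simp: fun_eq_iff on_jets_base \<phi>2_def \<psi>2_def)
  have s1: "jet_coordinate N' f (on_jets \<phi>2)"
    "\<And>z. z \<in> N' \<Longrightarrow> schwarzian f (on_jets \<phi>2) z = schwarzian f (on_jets \<phi>) z
        + (((v2 (on_jets \<phi> z))^2 / 2 + g2 (on_jets \<phi> z)) - (v2 (on_jets \<phi> z))^2 / 2) * (Dhat f (on_jets \<phi>) z)^2"
    unfolding oj
    by (rule c1.schwarzian_compose[where \<Psi>' = \<Phi>' and v = v2 and v' = "\<lambda>t. (v2 t)^2 / 2 + g2 t"],
        (erule \<Phi>[OF in2] | assumption)+)+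
  have s2: "jet_coordinate N' f (on_jets \<psi>2)"
    "\<And>z. z \<in> N' \<Longrightarrow> schwarzian f (on_jets \<psi>2) z = schwarzian f (on_jets \<psi>) z
        + (((v1 (on_jets \<psi> z))^2 / 2 + - g1 (on_jets \<psi> z)) - (v1 (on_jets \<psi> z))^2 / 2) * (Dhat f (on_jets \<psi>) z)^2"
    unfolding oj
    by (rule c2.schwarzian_compose[where \<Psi>' = \<Psi>' and v = v1 and v' = "\<lambda>t. (v1 t)^2 / 2 + - g1 t"],
        (erule \<Psi>[OF in1] | assumption)+)+
  interpret d1: jet_coordinate N' f "on_jets \<phi>2" by (rule s1(1))
  interpret d2: jet_coordinate N' f "on_jets \<psi>2" by (rule s2(1))
  have pc1: "pd_x (on_jets \<phi>2) z = \<Phi>' (on_jets \<phi> z) * pd_x (on_jets \<phi>) z"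
    "pd_u (on_jets \<phi>2) z = \<Phi>' (on_jets \<phi> z) * pd_u (on_jets \<phi>) z" if "z \<in> N'" for z
    unfolding oj by (rule c1.pd_compose[OF c1.hol_omega _ that], erule \<Phi>(1)[OF in2])+
  have pc2: "pd_x (on_jets \<psi>2) z = \<Psi>' (on_jets \<psi> z) * pd_x (on_jets \<psi>) z"
    "pd_u (on_jets \<psi>2) z = \<Psi>' (on_jets \<psi> z) * pd_u (on_jets \<psi>) z" if "z \<in> N'" for z
    unfolding oj by (rule c1.pd_compose[OF c2.hol_omega _ that], erule \<Psi>(1)[OF in1])+
  have jac: "pd_x (on_jets \<phi>2) z * pd_u (on_jets \<psi>2) z - pd_u (on_jets \<phi>2) z * pd_x (on_jets \<psi>2) z \<noteq> 0" if z: "z \<in> N'" for z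
  proof -
    have "pd_x (on_jets \<phi>2) z * pd_u (on_jets \<psi>2) z - pd_u (on_jets \<phi>2) z * pd_x (on_jets \<psi>2) z
      = \<Phi>' (on_jets \<phi> z) * \<Psi>' (on_jets \<psi> z) *
        (pd_x (on_jets \<phi>) z * pd_u (on_jets \<psi>) z - pd_u (on_jets \<phi>) z * pd_x (on_jets \<psi>) z)"
      unfolding pc1(1,2)[OF z] pc2(1,2)[OF z] by (simp add: algebra_simps)
    then show ?thesis
      using \<Phi>(2)[OF in2[OF z]] \<Psi>(2)[OF in1[OF z]] jacobian_nonzero[of z] N'(4) z by auto
  qed
  interpret cp: coordinate_pair N' f "on_jets \<phi>2" "on_jets \<psi>2" by unfold_locales (rule jac)
  have eq: "schwarzian f (on_jets \<psi>2) z = schwarzian f (on_jets \<phi>2) z" if z: "z \<in> N'" for z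
  proof -
    have zX: "z \<in> X" "z \<in> N" and b: "base z \<in> E1" "base z \<in> E2"
      using z N'(3,4,5) by (auto simp: D'_def)
    have "k z = g1 (on_jets \<psi> z)" "l z = g2 (on_jets \<phi> z)"
      using E1(3) E2(3) b k0(2)[OF zX(1)] l0(2)[OF zX(1)] by (auto simp: on_jets_base)
    then show ?thesis
      using K_kl(1)[OF zX(2)] unfolding s1(2)[OF z] s2(2)[OF z] K_def by (simp add: algebra_simps)
  qed
  have hp: "holomorphic_plane \<phi>2 D'" "holomorphic_plane \<psi>2 D'"
  proof -
    have p: "pld \<phi>2 y (\<Phi>' (\<phi> y) * pl_x \<phi> y) (\<Phi>' (\<phi> y) * pl_u \<phi> y)" "pld \<psi>2 y (\<Psi>' (\<psi> y) * pl_x \<psi> y) (\<Psi>' (\<psi> y) * pl_u \<psi> y)"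
      if y: "y \<in> D'" for y
    proof -
      have yD: "y \<in> D" "\<phi> y \<in> ball (\<phi> y0) r2" "\<psi> y \<in> ball (\<psi> y0) r1" using y by (auto simp: D'_def H1_def H2_def)
      show "pld \<phi>2 y (\<Phi>' (\<phi> y) * pl_x \<phi> y) (\<Phi>' (\<phi> y) * pl_u \<phi> y)" "pld \<psi>2 y (\<Psi>' (\<psi> y) * pl_x \<psi> y) (\<Psi>' (\<psi> y) * pl_u \<psi> y)"
        unfolding \<phi>2_def[abs_def] \<psi>2_def[abs_def]
        by (rule pld_DERIV[OF holomorphic_planeD(2)[OF h(1) yD(1)] \<Phi>(1)[OF yD(2)]]
            pld_DERIV[OF holomorphic_planeD(2)[OF h(2) yD(1)] \<Psi>(1)[OF yD(3)]])+
    qed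
    show "holomorphic_plane \<phi>2 D'" by (rule holomorphic_plane_pldI[OF D' p(1)])
    show "holomorphic_plane \<psi>2 D'" by (rule holomorphic_plane_pldI[OF D' p(2)])
  qed
  have low: "total_deriv_low (on_jets \<phi>2) z \<noteq> 0" if z: "z \<in> N'" for z
    using d1.speed_nonzero[OF z] by (simp add: cp.total_deriv_low_q pd_on_jets)
  have pj: "prol_jet \<phi>2 \<psi>2 z \<in> canonical_domain" if z: "z \<in> N'" for z
    using cp.prolongation(1)[OF refl refl z] cp.P_nonzero[OF z] by (simp add: canonical_domain_def jet_p_def)
  have iff: "\<forall>r. r = f z \<longleftrightarrow> prol_r \<phi>2 \<psi>2 z r = canonical_rhs (prol_jet \<phi>2 \<psi>2 z)" if z: "z \<in> N'" for z
    using cp.prolongation_iff[OF refl refl z] eq[OF z] by blast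
  show ?thesis
    unfolding point_equivalent_near_def
  proof (rule exI[of _ \<phi>2], rule exI[of _ \<psi>2], rule exI[of _ D'], rule exI[of _ N'], intro conjI ballI)
    show "N' \<subseteq> U" using N'(4) N(2) by blast
  qed (use hp N' jac low pj iff in \<open>simp_all\<close>)
qed

lemma sufficiency:
  assumes f: "holomorphic_jet f U" and N: "open N" "z0 \<in> N" "N \<subseteq> U" and J: "holomorphic_jet J N"
    and inv: "\<And>z. z \<in> N \<Longrightarrow> (J z)^2 = - I5 f z \<and> I4 f z = 0 \<and> I5 f z \<noteq> 0 \<and> I6 f z = 0 \<and> I7 f J z = 0"
  shows "point_equivalent_near f U z0 canonical_rhs canonical_domain"
proof (rule adapted_coordinates[OF f N J inv])
  fix N' D \<phi> \<psi>
  assume a: "holomorphic_plane \<phi> D" "holomorphic_plane \<psi> D" "z0 \<in> N'" "N' \<subseteq> U"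
    and b: "\<And>z. z \<in> N' \<Longrightarrow> base z \<in> D"
    and c: "schwarzian_defect N' f (on_jets \<phi>) (on_jets \<psi>)" "separates \<phi> (base z0)" "separates \<psi> (base z0)"
  show ?thesis by (rule equivalence_from_adapted[OF c(1) a b c(2,3)])
qed

section \<open>The symmetries of the canonical equation\<close>

lemma pl_commute:
  assumes "holomorphic_plane F D" "w \<in> D"
  shows "pl_u (pl_x F) w = pl_x (pl_u F) w"
  unfolding pl_x_def pl_u_def
  by (rule dpd_commute[OF bounded_linear_dir_plane holomorphic_planeD(1)[OF assms(1)] holomorphic_plane_continuous[OF assms(1)]
      holomorphic_plane_slice[OF assms(1)] assms(2)])

lemma pld_cong:
  assumes "pld G w a b" "open D" "w \<in> D" "\<And>w. w \<in> D \<Longrightarrow> F w = G w"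
  shows "pld F w a b"
  unfolding pld_def
  by (rule has_derivative_transform_within_open[OF assms(1)[unfolded pld_def] assms(2,3)]) (simp add: assms(4))

lemma pl_zero:
  assumes "open D" "w \<in> D" "\<And>w. w \<in> D \<Longrightarrow> F w = 0"
  shows "pl_x F w = 0" "pl_u F w = 0"
  using pld_pl[OF pld_cong[OF pld_const[of 0] assms(1,2), of F]] assms(3) by simp_all

lemma plane_constant:
  assumes "holomorphic_plane F D" "connected D" "\<And>w. w \<in> D \<Longrightarrow> pl_x F w = 0" "\<And>w. w \<in> D \<Longrightarrow> pl_u F w = 0"
  obtains c where "\<And>w. w \<in> D \<Longrightarrow> F w = c"
proof -
  have "(F has_derivative (\<lambda>h. 0)) (at w)" if "w \<in> D" for w
    using holomorphic_planeD(2)[OF assms(1) that] assms(3,4)[OF that] by (simp add: pld_def case_prod_unfold)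
  then have eq: "F w = F w'" if "w \<in> D" "w' \<in> D" for w w'
    using has_derivative_zero_unique_connected[of D F w w'] assms(2) holomorphic_planeD(1)[OF assms(1)] that by blast
  show ?thesis
  proof (cases "D = {}")
    case False
    then obtain w where "w \<in> D" by blast
    then show ?thesis using that[of "F w"] eq by blast
  qed (use that in blast)
qed

lemma canonical_rhs_eq: "canonical_rhs = (\<lambda>z. 3/2 * (jet_q z)^2 / jet_p z)"
  by (simp add: fun_eq_iff canonical_rhs_def)

locale symmetry_region =
  fixes \<xi> \<eta> :: "plane \<Rightarrow> complex" and D :: "plane set"
  assumes h: "holomorphic_plane \<xi> D" "holomorphic_plane \<eta> D"
begin

definition "N = canonical_domain \<inter> (\<lambda>z. (fst z, fst (snd z))) -` D"

lemma D: "open D" using holomorphic_planeD(1)[OF h(1)] .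

lemma open_N: "open N"
proof -
  have "open {z::jet. jet_p z \<noteq> 0}"
    unfolding jet_p_def case_prod_unfold by (intro open_Collect_neq continuous_intros)
  moreover have "open ((\<lambda>z::jet. (fst z, fst (snd z))) -` D)"
    by (intro open_vimage D continuous_intros)
  ultimately show ?thesis unfolding N_def canonical_domain_def by (intro open_Int)
qed

sublocale jet_region N by unfold_locales (rule open_N)

lemma p_nonzero: "z \<in> N \<Longrightarrow> jet_p z \<noteq> 0" by (simp add: N_def canonical_domain_def)

lemma hol_on_jets [simp, intro]: "holomorphic_plane F D \<Longrightarrow> hol (on_jets F)"
  by (rule holomorphic_jet_on_jets[OF _ open_N]) (auto simp: N_def)

lemma hpl [simp, intro]:
  "holomorphic_plane F D \<Longrightarrow> holomorphic_plane (pl_x F) D" "holomorphic_plane F D \<Longrightarrow> holomorphic_plane (pl_u F) D"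
  using holomorphic_plane_pl by blast+

lemmas h_simp [simp] = h

lemma commute: "z \<in> N \<Longrightarrow> holomorphic_plane F D \<Longrightarrow> on_jets (pl_u (pl_x F)) z = on_jets (pl_x (pl_u F)) z"
  by (simp add: on_jets_def case_prod_unfold pl_commute N_def)

abbreviation "X F \<equiv> on_jets (pl_x F)"
abbreviation "U F \<equiv> on_jets (pl_u F)"

lemma sym_p_eq: "sym_p \<xi> \<eta> = (\<lambda>z. X \<eta> z + jet_p z * (U \<eta> z - X \<xi> z) - (jet_p z)^2 * U \<xi> z)"
  by (simp add: fun_eq_iff sym_p_def total_deriv_low_def pd_on_jets power2_eq_square algebra_simps)

text \<open>
  The classical prolongation formulas, here and in \<open>sym_r_eq\<close>, as polynomials in \<open>p\<close>, \<open>q\<close>, \<open>r\<close> over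
  the derivatives of \<open>\<xi>\<close> and \<open>\<eta>\<close>; they are needed in this form to compare coefficients.
\<close>
lemma sym_q_eq:
  assumes z: "z \<in> N"
  shows "sym_q \<xi> \<eta> z = X (pl_x \<eta>) z + jet_p z * (2 * X (pl_u \<eta>) z - X (pl_x \<xi>) z)
     + (jet_p z)^2 * (U (pl_u \<eta>) z - 2 * X (pl_u \<xi>) z) - (jet_p z)^3 * U (pl_u \<xi>) z
     + jet_q z * (U \<eta> z - 2 * X \<xi> z - 3 * jet_p z * U \<xi> z)"
  unfolding sym_q_def total_deriv_low_def sym_p_eq using z
  by (simp add: pd_rules pd_on_jets commute) (simp add: power2_eq_square power3_eq_cube algebra_simps)

lemma sym_r_eq:
  assumes z: "z \<in> N"
  shows "sym_r \<xi> \<eta> z r = X (pl_x (pl_x \<eta>)) z + jet_p z * (3 * X (pl_x (pl_u \<eta>)) z - X (pl_x (pl_x \<xi>)) z)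
     + (jet_p z)^2 * (3 * X (pl_u (pl_u \<eta>)) z - 3 * X (pl_x (pl_u \<xi>)) z)
     + (jet_p z)^3 * (U (pl_u (pl_u \<eta>)) z - 3 * X (pl_u (pl_u \<xi>)) z)
     - (jet_p z)^4 * U (pl_u (pl_u \<xi>)) z
     + jet_q z * (3 * X (pl_u \<eta>) z - 3 * X (pl_x \<xi>) z + jet_p z * (3 * U (pl_u \<eta>) z - 9 * X (pl_u \<xi>) z) - 6 * (jet_p z)^2 * U (pl_u \<xi>) z)
     - 3 * (jet_q z)^2 * U \<xi> z + r * (U \<eta> z - 3 * X \<xi> z - 4 * jet_p z * U \<xi> z)"
proof -
  let ?G = "\<lambda>z. X (pl_x \<eta>) z + jet_p z * (2 * X (pl_u \<eta>) z - X (pl_x \<xi>) z)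
     + (jet_p z)^2 * (U (pl_u \<eta>) z - 2 * X (pl_u \<xi>) z) - (jet_p z)^3 * U (pl_u \<xi>) z
     + jet_q z * (U \<eta> z - 2 * X \<xi> z - 3 * jet_p z * U \<xi> z)"
  have hG: "hol ?G" by simp
  have c2: "on_jets (pl_x (pl_u (pl_x F))) z = on_jets (pl_x (pl_x (pl_u F))) z"
    "on_jets (pl_u (pl_x (pl_u F))) z = on_jets (pl_x (pl_u (pl_u F))) z"
    "on_jets (pl_u (pl_x (pl_x F))) z = on_jets (pl_x (pl_x (pl_u F))) z" if "holomorphic_plane F D" for F
  proof -
    show "on_jets (pl_u (pl_x (pl_u F))) z = on_jets (pl_x (pl_u (pl_u F))) z"
      using commute[OF z, of "pl_u F"] that by simp
    have "pd_x (on_jets (pl_u (pl_x F))) z = pd_x (on_jets (pl_x (pl_u F))) z"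
      by (rule pd_cong[OF commute _ z]) (use that in simp_all)
    then show "on_jets (pl_x (pl_u (pl_x F))) z = on_jets (pl_x (pl_x (pl_u F))) z" by (simp add: pd_on_jets)
    then show "on_jets (pl_u (pl_x (pl_x F))) z = on_jets (pl_x (pl_x (pl_u F))) z"
      using commute[OF z, of "pl_x F"] that by simp
  qed
  have pc: "pd_x (sym_q \<xi> \<eta>) z = pd_x ?G z" "pd_u (sym_q \<xi> \<eta>) z = pd_u ?G z"
    "pd_p (sym_q \<xi> \<eta>) z = pd_p ?G z" "pd_q (sym_q \<xi> \<eta>) z = pd_q ?G z"
    by (rule pd_cong[OF sym_q_eq hG z], assumption)+
  have "sym_r \<xi> \<eta> z r = total_deriv r ?G z - r * (X \<xi> z + jet_p z * U \<xi> z)"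
    unfolding sym_r_def total_deriv_def total_deriv_low_def pc
    by (simp add: pd_on_jets)
  then show ?thesis
    unfolding total_deriv_def using z
    by (simp add: pd_rules pd_on_jets commute c2) (simp add: power2_eq_square power3_eq_cube power4_eq_xxxx algebra_simps)
qed

lemma pd_canonical:
  assumes z: "z \<in> N"
  shows "pd_x canonical_rhs z = 0" "pd_u canonical_rhs z = 0"
    "pd_p canonical_rhs z = - (3/2 * (jet_q z)^2 / (jet_p z)^2)" "pd_q canonical_rhs z = 3 * jet_q z / jet_p z"
  unfolding canonical_rhs_eq using z
  by (simp_all add: pd_divide pd_rules p_nonzero)

text \<open>
  The part of the symmetry condition that is free of \<open>q\<close>.
\<close>
definition "c0 z = X (pl_x (pl_x \<eta>)) z + jet_p z * (3 * X (pl_x (pl_u \<eta>)) z - X (pl_x (pl_x \<xi>)) z)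
     + (jet_p z)^2 * (3 * X (pl_u (pl_u \<eta>)) z - 3 * X (pl_x (pl_u \<xi>)) z)
     + (jet_p z)^3 * (U (pl_u (pl_u \<eta>)) z - 3 * X (pl_u (pl_u \<xi>)) z)
     - (jet_p z)^4 * U (pl_u (pl_u \<xi>)) z"

text \<open>
  For the canonical right-hand side the condition is a quadratic polynomial in \<open>q\<close>.
\<close>
lemma symmetry_defect:
  assumes z: "z \<in> N"
  shows "sym_r \<xi> \<eta> z (canonical_rhs z) - (on_jets \<xi> z * pd_x canonical_rhs z + on_jets \<eta> z * pd_u canonical_rhs z
     + sym_p \<xi> \<eta> z * pd_p canonical_rhs z + sym_q \<xi> \<eta> z * pd_q canonical_rhs z)
     = c0 z - 3 * jet_q z * (X (pl_x \<eta>) z / jet_p z + X (pl_u \<eta>) z + jet_p z * X (pl_u \<xi>) z + (jet_p z)^2 * U (pl_u \<xi>) z)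
       + 3/2 * (jet_q z)^2 * (X \<eta> z / (jet_p z)^2 - U \<xi> z)"
proof -
  have alg: "c + q * (3 * exu - 3 * kxx + p * (3 * euu - 9 * kxu) - 6 * p^2 * kuu) - 3 * q^2 * ku + (3/2 * q^2 / p) * (eu - 3 * kx - 4 * p * ku)
    - (0 + (ex + p * (eu - kx) - p^2 * ku) * (- (3/2 * q^2 / p^2))
       + (exx + p * (2 * exu - kxx) + p^2 * (euu - 2 * kxu) - p^3 * kuu + q * (eu - 2 * kx - 3 * p * ku)) * (3 * q / p))
    = c - 3 * q * (exx / p + exu + p * kxu + p^2 * kuu) + 3/2 * q^2 * (ex / p^2 - ku)"
    if "p \<noteq> 0" for c q p exu kxx euu kxu kuu ku eu kx ex exx :: complex
    using that by (simp add: field_simps power2_eq_square power3_eq_cube)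
  have sp: "sym_p \<xi> \<eta> z = X \<eta> z + jet_p z * (U \<eta> z - X \<xi> z) - (jet_p z)^2 * U \<xi> z" by (simp add: sym_p_eq)
  have cr: "canonical_rhs z = 3/2 * (jet_q z)^2 / jet_p z" by (simp add: canonical_rhs_def)
  show ?thesis
    unfolding sym_r_eq[OF z] pd_canonical[OF z] sym_q_eq[OF z] sp cr c0_def[symmetric]
    unfolding mult_zero_right add_0_left by (rule alg[OF p_nonzero[OF z], unfolded add_0_left])
qed

definition "symmetric \<longleftrightarrow> (\<forall>z\<in>canonical_domain. (fst z, fst (snd z)) \<in> D \<longrightarrow>
   sym_r \<xi> \<eta> z (canonical_rhs z) = on_jets \<xi> z * pd_x canonical_rhs z + on_jets \<eta> z * pd_u canonical_rhs z
     + sym_p \<xi> \<eta> z * pd_p canonical_rhs z + sym_q \<xi> \<eta> z * pd_q canonical_rhs z)"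

lemma symmetric_iff:
  "symmetric \<longleftrightarrow> (\<forall>z\<in>N. c0 z - 3 * jet_q z * (X (pl_x \<eta>) z / jet_p z + X (pl_u \<eta>) z + jet_p z * X (pl_u \<xi>) z + (jet_p z)^2 * U (pl_u \<xi>) z)
       + 3/2 * (jet_q z)^2 * (X \<eta> z / (jet_p z)^2 - U \<xi> z) = 0)"
proof -
  have "symmetric \<longleftrightarrow> (\<forall>z\<in>N. sym_r \<xi> \<eta> z (canonical_rhs z) - (on_jets \<xi> z * pd_x canonical_rhs z + on_jets \<eta> z * pd_u canonical_rhs z
     + sym_p \<xi> \<eta> z * pd_p canonical_rhs z + sym_q \<xi> \<eta> z * pd_q canonical_rhs z) = 0)"
    unfolding symmetric_def N_def by auto
  then show ?thesis by (simp add: symmetry_defect cong: ball_cong)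
qed

text \<open>
  The coefficient of \<open>q\<^sup>2\<close> forces \<open>\<eta>\<^sub>x = \<xi>\<^sub>u = 0\<close>, by its dependence on \<open>p\<close>. The
  coefficient of \<open>q\<close> then vanishes, and the rest reduces to \<open>p\<^sup>3 \<eta>\<^sub>u\<^sub>u\<^sub>u - p \<xi>\<^sub>x\<^sub>x\<^sub>x\<close>. Coefficients are separated by evaluating at
  \<open>q \<in> {0, 1, -1}\<close> and \<open>p \<in> {1, 2}\<close>.
\<close>
lemma determining_equations:
  assumes symmetric
  shows "w \<in> D \<Longrightarrow> pl_x \<eta> w = 0" "w \<in> D \<Longrightarrow> pl_u \<xi> w = 0"
    "w \<in> D \<Longrightarrow> pl_x (pl_x (pl_x \<xi>)) w = 0" "w \<in> D \<Longrightarrow> pl_u (pl_u (pl_u \<eta>)) w = 0"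
proof -
  have eq: "c0 (x, u, p, q) - 3 * q * (pl_x (pl_x \<eta>) (x, u) / p + pl_x (pl_u \<eta>) (x, u) + p * pl_x (pl_u \<xi>) (x, u) + p^2 * pl_u (pl_u \<xi>) (x, u))
       + 3/2 * q^2 * (pl_x \<eta> (x, u) / p^2 - pl_u \<xi> (x, u)) = 0" if "(x, u) \<in> D" "p \<noteq> 0" for x u p q
  proof -
    have "(x, u, p, q) \<in> N" using that by (simp add: N_def canonical_domain_def jet_p_def)
    then show ?thesis
      using assms unfolding symmetric_iff by (auto simp: on_jets_def jet_p_def jet_q_def)
  qed
  have c0q: "c0 (x, u, p, q) = c0 (x, u, p, 0)" for x u p q
    by (simp add: c0_def on_jets_def jet_p_def)
  have c0: "c0 (x, u, p, 0) = 0" if "(x, u) \<in> D" "p \<noteq> 0" for x u p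
    using eq[OF that, of 0] by simp
  have 1: "pl_x \<eta> w = 0 \<and> pl_u \<xi> w = 0" if w: "w \<in> D" for w
  proof -
    obtain x u where xu: "w = (x, u)" by (cases w)
    have "pl_x \<eta> (x, u) / p^2 - pl_u \<xi> (x, u) = 0" if p: "p \<noteq> 0" for p
    proof -
      define c where "c = pl_x (pl_x \<eta>) (x, u) / p + pl_x (pl_u \<eta>) (x, u) + p * pl_x (pl_u \<xi>) (x, u) + p^2 * pl_u (pl_u \<xi>) (x, u)"
      define d where "d = pl_x \<eta> (x, u) / p^2 - pl_u \<xi> (x, u)"
      have "- 3 * c + 3/2 * d = 0" "3 * c + 3/2 * d = 0"
        using eq[OF w[unfolded xu] p, of 1] eq[OF w[unfolded xu] p, of "-1"] c0[OF w[unfolded xu] p]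
        unfolding c_def[symmetric] d_def[symmetric] c0q[of x u p 1] c0q[of x u p "-1"] by simp_all
      then have "(- 3 * c + 3/2 * d) + (3 * c + 3/2 * d) = 0" by (simp only: add_0_left)
      then have "d = 0" by simp
      then show ?thesis by (simp add: d_def)
    qed
    from this[of 1] this[of 2] show ?thesis by (simp add: xu)
  qed
  show ex: "w \<in> D \<Longrightarrow> pl_x \<eta> w = 0" and ku: "w \<in> D \<Longrightarrow> pl_u \<xi> w = 0" for w using 1 by blast+
  note z = pl_zero[OF D]
  have exx: "pl_x (pl_x \<eta>) w = 0" and exu: "pl_x (pl_u \<eta>) w = 0" and kxu: "pl_x (pl_u \<xi>) w = 0" and kuu: "pl_u (pl_u \<xi>) w = 0"
    if "w \<in> D" for w
    using z[OF that, of "pl_x \<eta>", OF ex] z[OF that, of "pl_u \<xi>", OF ku] pl_commute[OF h(2) that] by simp_all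
  have 3: "pl_x (pl_x (pl_x \<xi>)) w = 0 \<and> pl_u (pl_u (pl_u \<eta>)) w = 0" if w: "w \<in> D" for w
  proof -
    obtain x u where xu: "w = (x, u)" by (cases w)
    have t: "pl_x (pl_x (pl_x \<eta>)) w = 0" "pl_x (pl_x (pl_u \<eta>)) w = 0" "pl_x (pl_u (pl_u \<eta>)) w = 0"
      "pl_x (pl_x (pl_u \<xi>)) w = 0" "pl_x (pl_u (pl_u \<xi>)) w = 0" "pl_u (pl_u (pl_u \<xi>)) w = 0"
      using z[OF w, of "pl_x (pl_x \<eta>)", OF exx] z[OF w, of "pl_x (pl_u \<eta>)", OF exu] z[OF w, of "pl_x (pl_u \<xi>)", OF kxu]
        z[OF w, of "pl_u (pl_u \<xi>)", OF kuu] pl_commute[OF holomorphic_plane_pl(2)[OF h(2)] w] by simp_all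
    have "- p * pl_x (pl_x (pl_x \<xi>)) w + p^3 * pl_u (pl_u (pl_u \<eta>)) w = 0" if "p \<noteq> 0" for p
      using c0[OF w[unfolded xu] that] t unfolding c0_def by (simp add: on_jets_def jet_p_def xu)
    from this[of 1] this[of 2] show ?thesis by (auto simp: add_eq_0_iff2)
  qed
  then show "w \<in> D \<Longrightarrow> pl_x (pl_x (pl_x \<xi>)) w = 0" "w \<in> D \<Longrightarrow> pl_u (pl_u (pl_u \<eta>)) w = 0" for w by blast+
qed

end

text \<open>
  Each step subtracts the leading term and uses that a function with vanishing differential on a
  connected set is constant. The variables \<open>v\<close>, \<open>dv\<close>, \<open>dn\<close> stand for the coordinate concerned, the
  derivative in it and the derivative in the other coordinate; both choices occur.
\<close>
lemma quadratic_in_one_variable: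
  assumes F: "holomorphic_plane F D" and con: "connected D"
    and v: "v = fst \<and> dv = pl_x \<and> dn = pl_u \<or> v = snd \<and> dv = pl_u \<and> dn = pl_x"
    and n: "\<And>w. w \<in> D \<Longrightarrow> dn F w = 0" and v3: "\<And>w. w \<in> D \<Longrightarrow> dv (dv (dv F)) w = 0"
  obtains a b c where "\<And>w. w \<in> D \<Longrightarrow> F w = a + b * v w + c * (v w)^2"
proof -
  have D: "open D" using holomorphic_planeD(1)[OF F] .
  have hdv: "holomorphic_plane (dv G) D" if "holomorphic_plane G D" for G
    using v holomorphic_plane_pl[OF that] by blast
  have com: "dn (dv G) w = dv (dn G) w" if "holomorphic_plane G D" "w \<in> D" for G w
    using v pl_commute[OF that] by auto
  have z: "dv G w = 0" if "w \<in> D" "\<And>w. w \<in> D \<Longrightarrow> G w = 0" for G w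
    using v pl_zero[OF D that] by auto
  have sub: "holomorphic_plane (\<lambda>w. G w - k * v w ^ m) D \<and>
      (\<forall>w\<in>D. dv (\<lambda>w. G w - k * v w ^ m) w = dv G w - k * of_nat m * v w ^ (m - 1) \<and> dn (\<lambda>w. G w - k * v w ^ m) w = dn G w)"
    if G: "holomorphic_plane G D" for G k m
  proof -
    have d: "((\<lambda>t. - (k * t ^ m)) has_field_derivative - k * of_nat m * t ^ (m - 1)) (at t)" for t :: complex
      by (auto intro!: derivative_eq_intros)
    from v show ?thesis
    proof (elim disjE conjE)
      assume [simp]: "v = fst" "dv = pl_x" "dn = pl_u"
      have p: "pld (\<lambda>w. G w - k * v w ^ m) w (pl_x G w + - k * of_nat m * fst w ^ (m - 1) * 1) (pl_u G w + - k * of_nat m * fst w ^ (m - 1) * 0)"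
        if "w \<in> D" for w
        using pld_add[OF holomorphic_planeD(2)[OF G that] pld_DERIV[OF pld_fst d]] by simp
      show ?thesis using holomorphic_plane_pldI[OF D p] pld_pl[OF p] by simp
    next
      assume [simp]: "v = snd" "dv = pl_u" "dn = pl_x"
      have p: "pld (\<lambda>w. G w - k * v w ^ m) w (pl_x G w + - k * of_nat m * snd w ^ (m - 1) * 0) (pl_u G w + - k * of_nat m * snd w ^ (m - 1) * 1)"
        if "w \<in> D" for w
        using pld_add[OF holomorphic_planeD(2)[OF G that] pld_DERIV[OF pld_snd d]] by simp
      show ?thesis using holomorphic_plane_pldI[OF D p] pld_pl[OF p] by simp
    qed
  qed
  have const: "\<exists>c. \<forall>w\<in>D. G w = c"
    if "holomorphic_plane G D" "\<And>w. w \<in> D \<Longrightarrow> dv G w = 0" "\<And>w. w \<in> D \<Longrightarrow> dn G w = 0" for G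
    using plane_constant[OF that(1) con] v that(2,3) by metis
  have n1: "dn (dv F) w = 0" if "w \<in> D" for w using com[OF F that] z[OF that n] by simp
  have n2: "dn (dv (dv F)) w = 0" if "w \<in> D" for w using com[OF hdv[OF F] that] z[OF that n1] by simp
  obtain c where c: "\<forall>w\<in>D. dv (dv F) w = c" using const[OF hdv[OF hdv[OF F]] v3 n2] by blast
  note s1 = sub[OF hdv[OF F], of c 1]
  obtain b where b: "\<forall>w\<in>D. dv F w - c * v w ^ 1 = b"
    using const[OF conjunct1[OF s1]] s1 c n1 by auto
  note s2 = sub[OF F, of "c/2" 2]
  note s3 = sub[OF conjunct1[OF s2], of b 1]
  obtain a where a: "\<forall>w\<in>D. F w - c/2 * v w ^ 2 - b * v w ^ 1 = a"
    using const[OF conjunct1[OF s3]] s3 s2 b n by (auto simp: algebra_simps)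
  show ?thesis
    using that[of a b "c/2"] a by (auto simp: algebra_simps)
qed

lemma quadratic_zero:
  fixes a b c x :: complex
  assumes "e > 0" and z: "\<And>t. t \<in> ball x e \<Longrightarrow> a + b * t + c * t^2 = 0"
  shows "a = 0" "b = 0" "c = 0"
proof -
  define d where "d = (of_real (e / 2) :: complex)"
  have d: "d \<noteq> 0" "x + d \<in> ball x e" "x - d \<in> ball x e" "x \<in> ball x e"
    using assms(1) by (auto simp: d_def dist_norm)
  note e1 = z[OF d(2)] and e2 = z[OF d(3)] and e0 = z[OF d(4)]
  \<comment> \<open>The second difference isolates the leading coefficient.\<close>
  have "2 * (c * d^2) = (a + b * (x + d) + c * (x + d)^2) + (a + b * (x - d) + c * (x - d)^2) - 2 * (a + b * x + c * x^2)"
    by (simp add: algebra_simps power2_eq_square)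
  then have "2 * (c * d^2) = 0" unfolding e0 e1 e2 by simp
  then show c: "c = 0" using d by simp
  have f: "a + b * (x + d) = 0" "a + b * x = 0" using e0 e1 c by simp_all
  have "b * d = (a + b * (x + d)) - (a + b * x)" by (simp add: algebra_simps)
  also have "\<dots> = 0" unfolding f by simp
  finally have "b * d = 0" .
  then show b: "b = 0" using d by simp
  show "a = 0" using e0 b c by simp
qed

text \<open>
  The six fields \<open>x\<^sup>i \<partial>\<^sub>x\<close> and \<open>u\<^sup>i \<partial>\<^sub>u\<close>, \<open>i \<le> 2\<close>, extended by zero outside \<open>D\<close>.
\<close>
definition mono_field :: "plane set \<Rightarrow> nat \<Rightarrow> plane \<Rightarrow> complex \<times> complex" where
  "mono_field D i w = (if w \<in> D then if i < 3 then (fst w ^ i, 0) else (0, snd w ^ (i - 3)) else (0, 0))"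

lemma sum_fun_apply: "(\<Sum>i\<in>A. f i) w = (\<Sum>i\<in>A. f i w)"
  by (induction A rule: infinite_finite_induct) auto

lemma mono_field_sum:
  "(\<Sum>i<6. vf_scale (c i) (mono_field D i)) w =
     (if w \<in> D then (c 0 + c 1 * fst w + c 2 * (fst w)^2, c 3 + c 4 * snd w + c 5 * (snd w)^2) else (0, 0))"
  unfolding sum_fun_apply vf_scale_def mono_field_def
  by (simp add: eval_nat_numeral lessThan_Suc algebra_simps)

lemma mono_field_independent:
  assumes D: "open D" "D \<noteq> {}" and z: "(\<Sum>i<6. vf_scale (c i) (mono_field D i)) = 0" and i: "i < 6"
  shows "c i = 0"
proof -
  obtain x u where "(x, u) \<in> D" using D(2) by auto
  then obtain A B where AB: "open A" "open B" "x \<in> A" "u \<in> B" "A \<times> B \<subseteq> D"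
    using D(1) open_prod_elim by (metis mem_Sigma_iff)
  obtain e1 e2 where e: "e1 > 0" "ball x e1 \<subseteq> A" "e2 > 0" "ball u e2 \<subseteq> B"
    using AB by (meson open_contains_ball)
  have s: "(c 0 + c 1 * fst w + c 2 * (fst w)^2, c 3 + c 4 * snd w + c 5 * (snd w)^2) = (0, 0)" if "w \<in> D" for w
    using mono_field_sum[of c D w] that unfolding z by (simp add: zero_prod_def)
  have "c 0 + c 1 * t + c 2 * t^2 = 0" if "t \<in> ball x e1" for t
  proof -
    have "(t, u) \<in> D" using that e(2) AB(4,5) by blast
    from s[OF this] show ?thesis by simp
  qed
  note 1 = quadratic_zero[OF e(1) this]
  have "c 3 + c 4 * t + c 5 * t^2 = 0" if "t \<in> ball u e2" for t
  proof -
    have "(x, t) \<in> D" using that e(4) AB(3,5) by blast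
    from s[OF this] show ?thesis by simp
  qed
  note 2 = quadratic_zero[OF e(3) this]
  have "i = 0 \<or> i = 1 \<or> i = 2 \<or> i = 3 \<or> i = 4 \<or> i = 5" using i by linarith
  then show ?thesis using 1 2 by auto
qed

lemma pld_quadratic:
  assumes "v = fst \<and> (\<alpha>, \<beta>) = (1, 0) \<or> v = snd \<and> (\<alpha>, \<beta>) = (0, 1)"
  shows "pld (\<lambda>w. a + b * v w + c * (v w)^2) w (\<alpha> * (b + 2 * c * v w)) (\<beta> * (b + 2 * c * v w))"
proof -
  have d: "((\<lambda>t. a + b * t + c * t^2) has_field_derivative b + 2 * c * t) (at t)" for t :: complex
    by (auto intro!: derivative_eq_intros)
  show ?thesis
    using assms pld_DERIV[OF pld_fst[of w] d] pld_DERIV[OF pld_snd[of w] d] by (auto simp: mult.commute)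
qed

lemma quadratic_field_symmetric:
  assumes D: "open D" and xi: "\<And>w. w \<in> D \<Longrightarrow> \<xi> w = a + b * fst w + c * (fst w)^2"
    and eta: "\<And>w. w \<in> D \<Longrightarrow> \<eta> w = a' + b' * snd w + c' * (snd w)^2"
  shows "symmetry_region \<xi> \<eta> D" "symmetry_region.symmetric \<xi> \<eta> D"
proof -
  have px: "pld \<xi> w (b + 2 * c * fst w) 0" and pe: "pld \<eta> w 0 (b' + 2 * c' * snd w)" if "w \<in> D" for w
    using pld_cong[OF pld_quadratic[of fst 1 0 a b c w] D that xi] pld_cong[OF pld_quadratic[of snd 0 1 a' b' c' w] D that eta]
    by simp_all
  show reg: "symmetry_region \<xi> \<eta> D"
    by unfold_locales (rule holomorphic_plane_pldI[OF D px], assumption, rule holomorphic_plane_pldI[OF D pe], assumption)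
  interpret symmetry_region \<xi> \<eta> D by (rule reg)
  have d1: "pl_x \<xi> w = b + 2 * c * fst w" "pl_u \<xi> w = 0" "pl_x \<eta> w = 0" "pl_u \<eta> w = b' + 2 * c' * snd w" if "w \<in> D" for w
    using pld_pl[OF px[OF that]] pld_pl[OF pe[OF that]] by simp_all
  have d2: "pl_x (pl_x \<xi>) w = 2 * c" "pl_u (pl_u \<eta>) w = 2 * c'" if "w \<in> D" for w
  proof -
    have "pld (pl_x \<xi>) w (2 * c) 0" "pld (pl_u \<eta>) w 0 (2 * c')"
      using pld_cong[OF pld_quadratic[of fst 1 0 b "2 * c" 0 w] D that, of "pl_x \<xi>"]
        pld_cong[OF pld_quadratic[of snd 0 1 b' "2 * c'" 0 w] D that, of "pl_u \<eta>"] d1 by simp_all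
    from pld_pl[OF this(1)] pld_pl[OF this(2)] show "pl_x (pl_x \<xi>) w = 2 * c" "pl_u (pl_u \<eta>) w = 2 * c'" by simp_all
  qed
  have d3: "pl_x (pl_x (pl_x \<xi>)) w = 0" "pl_u (pl_u (pl_u \<eta>)) w = 0"
    if "w \<in> D" for w
    using pld_pl[OF pld_cong[OF pld_const[of "2 * c"] D that, of "pl_x (pl_x \<xi>)"]] d2
      pld_pl[OF pld_cong[OF pld_const[of "2 * c'"] D that, of "pl_u (pl_u \<eta>)"]] by simp_all
  note z = pl_zero[OF D]
  have z2: "pl_x (pl_x \<eta>) w = 0" "pl_x (pl_u \<eta>) w = 0" "pl_x (pl_u \<xi>) w = 0" "pl_u (pl_u \<xi>) w = 0" if "w \<in> D" for w
    using z[OF that, of "pl_x \<eta>", OF d1(3)] z[OF that, of "pl_u \<xi>", OF d1(2)] pl_commute[OF h(2) that] by simp_all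
  have z3: "pl_x (pl_x (pl_x \<eta>)) w = 0" "pl_x (pl_x (pl_u \<eta>)) w = 0" "pl_x (pl_u (pl_u \<eta>)) w = 0"
      "pl_x (pl_x (pl_u \<xi>)) w = 0" "pl_x (pl_u (pl_u \<xi>)) w = 0" "pl_u (pl_u (pl_u \<xi>)) w = 0" if "w \<in> D" for w
    using z[OF that, of "pl_x (pl_x \<eta>)", OF z2(1)] z[OF that, of "pl_x (pl_u \<eta>)", OF z2(2)] z[OF that, of "pl_x (pl_u \<xi>)", OF z2(3)]
        z[OF that, of "pl_u (pl_u \<xi>)", OF z2(4)] pl_commute[OF holomorphic_plane_pl(2)[OF h(2)] that] by simp_all
  show symmetric
    unfolding symmetric_iff c0_def
    by (rule ballI) (simp add: N_def on_jets_def case_prod_unfold z3 z2 d3 d1)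
qed

text \<open>
  The fields \<open>mono_field D i\<close> form a basis: they are symmetries because the determining equations are
  also sufficient, they span because every symmetry is quadratic, and they are independent because a
  quadratic polynomial vanishing on a disc is zero.
\<close>
theorem dim_point_symmetries:
  assumes D: "open D" "connected D" "D \<noteq> {}"
  shows "vector_space.dim vf_scale (point_symmetries canonical_rhs canonical_domain D) = 6"
proof -
  interpret vector_space vf_scale by (rule vector_space_vf_scale)
  define S where "S = point_symmetries canonical_rhs canonical_domain D"
  define B where "B = mono_field D ` {..<6}"
  have S: "Z \<in> S \<longleftrightarrow> (\<exists>\<xi> \<eta>. Z = (\<lambda>w. (\<xi> w, \<eta> w)) \<and> symmetry_region \<xi> \<eta> D \<and> (\<forall>w. w \<notin> D \<longrightarrow> Z w = (0, 0)) \<and> symmetry_region.symmetric \<xi> \<eta> D)" for Z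
  proof -
    have "symmetry_region \<xi> \<eta> D \<longleftrightarrow> holomorphic_plane \<xi> D \<and> holomorphic_plane \<eta> D" for \<xi> \<eta>
      by (simp add: symmetry_region_def)
    then have e: "holomorphic_plane \<xi> D \<and> holomorphic_plane \<eta> D \<and> C \<and>
        (\<forall>z\<in>canonical_domain. (fst z, fst (snd z)) \<in> D \<longrightarrow>
           sym_r \<xi> \<eta> z (canonical_rhs z) =
             on_jets \<xi> z * pd_x canonical_rhs z + on_jets \<eta> z * pd_u canonical_rhs z
             + sym_p \<xi> \<eta> z * pd_p canonical_rhs z + sym_q \<xi> \<eta> z * pd_q canonical_rhs z)
      \<longleftrightarrow> symmetry_region \<xi> \<eta> D \<and> C \<and> symmetry_region.symmetric \<xi> \<eta> D" for \<xi> \<eta> C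
      using symmetry_region.symmetric_def[of \<xi> \<eta> D] by (cases "holomorphic_plane \<xi> D"; cases "holomorphic_plane \<eta> D") simp_all
    show ?thesis
      unfolding S_def point_symmetries_def mem_Collect_eq e ..
  qed
  have inj: "inj_on (mono_field D) {..<6}"
  proof (rule inj_onI, rule ccontr)
    fix i j :: nat assume ij: "i \<in> {..<6}" "j \<in> {..<6}" "mono_field D i = mono_field D j" "i \<noteq> j"
    define c where "c k = (if k = i then 1 else if k = j then -1 else 0 :: complex)" for k
    have "(\<Sum>k<6. vf_scale (c k) (mono_field D k)) = (\<Sum>k\<in>{i, j}. vf_scale (c k) (mono_field D k))"
      by (rule sum.mono_neutral_right) (use ij in \<open>auto simp: c_def\<close>)
    also have "\<dots> = 0" using ij by (simp add: c_def)
    finally have "c i = 0" using mono_field_independent[OF D(1,3)] ij by blast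
    then show False by (simp add: c_def)
  qed
  have "dim S = 6"
  proof (rule dim_unique)
    show "card B = 6" unfolding B_def by (simp add: card_image inj)
    show "independent B"
    proof (rule independent_if_scalars_zero)
      show "finite B" by (simp add: B_def)
      fix g X assume sum: "(\<Sum>x\<in>B. vf_scale (g x) x) = 0" and X: "X \<in> B"
      have "(\<Sum>i<6. vf_scale (g (mono_field D i)) (mono_field D i)) = 0"
        using sum unfolding B_def sum.reindex[OF inj] by (simp add: o_def)
      from mono_field_independent[OF D(1,3) this] X show "g X = 0" by (auto simp: B_def)
    qed
    show "B \<subseteq> S"
    proof
      fix Z assume "Z \<in> B"
      then obtain i where i: "i < 6" "Z = mono_field D i" by (auto simp: B_def)
      define c where "c k = (if k = i then 1 else 0 :: complex)" for k
      have "(\<Sum>k<6. vf_scale (c k) (mono_field D k)) = (\<Sum>k\<in>{i}. vf_scale (c k) (mono_field D k))"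
        by (rule sum.mono_neutral_right) (use i in \<open>auto simp: c_def\<close>)
      then have Z: "Z w = (if w \<in> D then (c 0 + c 1 * fst w + c 2 * (fst w)^2, c 3 + c 4 * snd w + c 5 * (snd w)^2) else (0, 0))" for w
        using mono_field_sum[of c D w] by (simp add: i c_def)
      have "Z = (\<lambda>w. (fst (Z w), snd (Z w)))" by simp
      moreover note quadratic_field_symmetric[OF D(1), of "\<lambda>w. fst (Z w)" "c 0" "c 1" "c 2" "\<lambda>w. snd (Z w)" "c 3" "c 4" "c 5"]
      ultimately show "Z \<in> S" unfolding S using Z by (intro exI[of _ "\<lambda>w. fst (Z w)"] exI[of _ "\<lambda>w. snd (Z w)"]) simp
    qed
    show "S \<subseteq> span B"
    proof
      fix Z assume "Z \<in> S"
      then obtain \<xi> \<eta> where Z: "Z = (\<lambda>w. (\<xi> w, \<eta> w))" "symmetry_region \<xi> \<eta> D" "\<forall>w. w \<notin> D \<longrightarrow> Z w = (0, 0)"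
        and sym: "symmetry_region.symmetric \<xi> \<eta> D" unfolding S by blast
      note con = D(2)
      interpret symmetry_region \<xi> \<eta> D by (rule Z(2))
      note de = determining_equations[OF sym]
      obtain a b c where x: "\<And>w. w \<in> D \<Longrightarrow> \<xi> w = a + b * fst w + c * (fst w)^2"
        using quadratic_in_one_variable[OF h(1) con, of fst pl_x pl_u] de(2,3) by blast
      obtain a' b' c' where e: "\<And>w. w \<in> D \<Longrightarrow> \<eta> w = a' + b' * snd w + c' * (snd w)^2"
        using quadratic_in_one_variable[OF h(2) con, of snd pl_u pl_x] de(1,4) by blast
      define k where "k i = [a, b, c, a', b', c'] ! i" for i
      have "Z = (\<Sum>i<6. vf_scale (k i) (mono_field D i))"
      proof
        fix w show "Z w = (\<Sum>i<6. vf_scale (k i) (mono_field D i)) w"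
        proof (cases "w \<in> D")
          case True
          then show ?thesis unfolding mono_field_sum using x e by (simp add: Z(1) k_def)
        next
          case False
          with Z(3) have "Z w = (0, 0)" by blast
          then show ?thesis unfolding mono_field_sum using False by simp
        qed
      qed
      moreover have "(\<Sum>i<6. vf_scale (k i) (mono_field D i)) \<in> span B"
        by (intro span_sum span_scale span_base) (auto simp: B_def)
      ultimately show "Z \<in> span B" by simp
    qed
  qed
  then show ?thesis by (simp add: S_def)
qed

section \<open>Characterisation of the canonical equation\<close>

theorem theorem3p4:
  fixes f :: "jet \<Rightarrow> complex" and U :: "jet set" and z0 :: jet
  assumes "holomorphic_jet f U" and "z0 \<in> U"
  shows "(point_equivalent_near f U z0 canonical_rhs canonical_domain \<longleftrightarrow>
            (\<exists>N J. open N \<and> z0 \<in> N \<and> N \<subseteq> U \<and> holomorphic_jet J N \<and>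
               (\<forall>z\<in>N. (J z)^2 = - I5 f z \<and>
                  I4 f z = 0 \<and> I5 f z \<noteq> 0 \<and> I6 f z = 0 \<and> I7 f J z = 0)))
       \<and> (\<forall>D :: plane set. open D \<and> connected D \<and> D \<noteq> {} \<longrightarrow>
            vector_space.dim vf_scale
              (point_symmetries canonical_rhs canonical_domain D) = 6)"
proof (intro conjI allI impI iffI)
  assume "point_equivalent_near f U z0 canonical_rhs canonical_domain"
  then show "\<exists>N J. open N \<and> z0 \<in> N \<and> N \<subseteq> U \<and> holomorphic_jet J N \<and>
               (\<forall>z\<in>N. (J z)^2 = - I5 f z \<and>
                  I4 f z = 0 \<and> I5 f z \<noteq> 0 \<and> I6 f z = 0 \<and> I7 f J z = 0)"
    by (rule necessity[OF assms(1)])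
next
  assume "\<exists>N J. open N \<and> z0 \<in> N \<and> N \<subseteq> U \<and> holomorphic_jet J N \<and>
               (\<forall>z\<in>N. (J z)^2 = - I5 f z \<and>
                  I4 f z = 0 \<and> I5 f z \<noteq> 0 \<and> I6 f z = 0 \<and> I7 f J z = 0)"
  then obtain N J where NJ: "open N" "z0 \<in> N" "N \<subseteq> U" "holomorphic_jet J N"
    and inv: "\<forall>z\<in>N. (J z)^2 = - I5 f z \<and> I4 f z = 0 \<and> I5 f z \<noteq> 0 \<and> I6 f z = 0 \<and> I7 f J z = 0"
    by blast
  show "point_equivalent_near f U z0 canonical_rhs canonical_domain"
    by (rule sufficiency[OF assms(1) NJ bspec[OF inv]])
next
  fix D :: "plane set"
  assume "open D \<and> connected D \<and> D \<noteq> {}"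
  then show "vector_space.dim vf_scale (point_symmetries canonical_rhs canonical_domain D) = 6"
    by (intro dim_point_symmetries) auto
qed

end
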